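(* There exist a full conjunctive query $Q(\mathbf{Z})$ and a family, indexed by $n\in\mathbb{N}$, of sets $\mathbf{PC}=\mathbf{PC}_n$ of partition constraints on the relations of $Q$, with $\mathbf{DC}=\mathbf{DC}_n\subset\mathbf{PC}_n$ denoting the subset of those constraints that are degree constraints, such that the following are true (all asymptotics are for $n\to\infty$): 1. Bounds based on degree constraints are asymptotically sub-optimal, i.e. $\sup_{I\vDash\mathbf{PC}}|Q^I(\mathbf{Z})| = o\big(CB_{\mathrm{Comb}}(Q,\mathbf{DC})\big)=o\big(\sup_{I\vDash\mathbf{DC}}|Q^I(\mathbf{Z})|\big)$. 2. There is an algorithm that enumerates $Q^I$ for instances $I\vDash\mathbf{PC}$ in time $O\big(\sup_{I\vDash\mathbf{PC}}|Q^I(\mathbf{Z})|\big)$. 3. No VAAT algorithm can enumerate $Q^I$ for instances $I\vDash\mathbf{PC}$ in time $O\big(\sup_{I\vDash\mathbf{PC}}|Q^I(\mathbf{Z})|\big)$.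
   Context: A (full) conjunctive query is an expression $Q(\mathbf{Z})\leftarrow R_1(\mathbf{Z}_1)\Join\dots\Join R_k(\mathbf{Z}_k)$ with $\mathbf{Z}=\bigcup_i\mathbf{Z}_i$, where $R_i$ is a relation over the set of variables $\mathbf{Z}_i$. A database instance $I$ gives a concrete finite set of tuples for each $R_i$; $Q^I(\mathbf{Z})$ is the natural join of these relations. $\pi$ and $\sigma$ denote projection and selection. Degree constraint: for a relation $R(\mathbf{Z}')$ and $\mathbf{X}\subseteq\mathbf{Y}\subseteq\mathbf{Z}'$, $DC_R(\mathbf{X},\mathbf{Y},d)$ asserts $\max_{\mathbf{x}}|\pi_{\mathbf{Y}}\sigma_{\mathbf{X}=\mathbf{x}}R|\le d$, the maximum being over all assignments $\mathbf{x}$ of values to $\mathbf{X}$; $DC_R(\mathbf{X},\mathbf{Y})$ denotes the least such $d$. The case $\mathbf{X}=\emptyset$, $\mathbf{Y}=\mathbf{Z}'$ is a cardinality constraint. Partition constraint: for $\mathbf{Y}\subseteq\mathbf{Z}'$ and a set $\mathcal{X}\subseteq 2^{\mathbf{Y}}$ of sets of variables, $PC_R(\mathcal{X},\mathbf{Y},d)$ asserts $\min_{(R^{\mathbf{X}})_{\mathbf{X}\in\mathcal{X}}}\max_{\mathbf{X}\in\mathcal{X}}DC_{R^{\mathbf{X}}}(\mathbf{X},\mathbf{Y})\le d$, where the minimum is over all families of pairwise disjoint (possibly empty) subrelations with union $R$. A degree constraint $DC_R(\mathbf{X},\mathbf{Y},d)$ is identified with $PC_R(\{\mathbf{X}\},\mathbf{Y},d)$.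 $I\vDash\mathbf{PC}$ means $I$ satisfies all constraints in $\mathbf{PC}$ (similarly for $\mathbf{DC}$). Combinatorics bound: $CB_{\mathrm{Comb}}(Q,\mathbf{DC})=\sup_{I\vDash\mathbf{DC}}|Q^I(\mathbf{Z})|$. Standing assumption: every variable of the query is covered by at least one cardinality constraint, so this is finite. VAAT algorithm: for an ordering $Z_1,\dots,Z_r$ of $\mathbf{Z}$ let $Q_i(Z_1,\dots,Z_i)\leftarrow \pi_{Z_1,\dots,Z_i}R_1\Join\dots\Join\pi_{Z_1,\dots,Z_i}R_k$, where each $R_j$ is projected onto those of its variables that are among $Z_1,\dots,Z_i$. A join algorithm (an algorithm that on input $Q$ and $I$ outputs $Q^I$) is a VAAT (variable-at-a-time) algorithm if there is some ordering $Z_1,\dots,Z_r$ of $\mathbf{Z}$, whose choice may depend on $I$, such that it takes time $\Omega(\max_i|Q_i^I|)$ on databases $I$. *)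

theory Defs
  imports "HOL-Library.Landau_Symbols" "HOL-Library.Disjoint_Sets"
begin

section \<open>Queries and databases\<close>

text \<open>
  Variables and values are natural numbers.  A tuple over a set of variables is a partial map
  with that domain.  A query is the list of the schemas of its atoms; the order of the variables
  within a schema matters only when a relation is written down as the input of a program.
  The relation of the \<open>i\<close>-th atom in a database \<open>I\<close> is \<open>I ! i\<close>.
\<close>

type_synonym tuple = "nat \<Rightarrow> nat option"
type_synonym relation = "tuple set"
type_synonym query = "nat list list"
type_synonym database = "relation list"

definition wf_query :: "query \<Rightarrow> bool" where
  "wf_query Q \<longleftrightarrow> (\<forall>zs \<in> set Q. distinct zs)"

definition query_vars :: "query \<Rightarrow> nat set" where
  "query_vars Q = (\<Union>zs \<in> set Q. set zs)"

definition is_database :: "query \<Rightarrow> database \<Rightarrow> bool" where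
  "is_database Q I \<longleftrightarrow> list_all2 (\<lambda>zs R. finite R \<and> (\<forall>t \<in> R. dom t = set zs)) Q I"

definition database_size :: "database \<Rightarrow> nat" where
  "database_size I = sum_list (map card I)"

definition project :: "nat set \<Rightarrow> relation \<Rightarrow> relation" where
  "project Y R = (\<lambda>t. t |` Y) ` R"

definition select :: "nat set \<Rightarrow> tuple \<Rightarrow> relation \<Rightarrow> relation" where
  "select X x R = {t \<in> R. t |` X = x}"

definition natural_join :: "nat set list \<Rightarrow> relation list \<Rightarrow> relation" where
  "natural_join Zs Rs =
     {t. dom t = \<Union> (set Zs) \<and> (\<forall>j < length Zs. t |` (Zs ! j) \<in> Rs ! j)}"

definition answer :: "query \<Rightarrow> database \<Rightarrow> relation" where
  "answer Q I = natural_join (map set Q) I"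

text \<open>For \<open>W\<close> the first \<open>i\<close> variables of an ordering, this is \<open>Q\<^sub>i\<close> evaluated on \<open>I\<close>.\<close>

definition restricted_answer :: "nat set \<Rightarrow> query \<Rightarrow> database \<Rightarrow> relation" where
  "restricted_answer W Q I =
     natural_join (map (\<lambda>zs. set zs \<inter> W) Q) (map2 (\<lambda>zs R. project (set zs \<inter> W) R) Q I)"


section \<open>Partition constraints and the combinatorial bound\<close>

definition degree :: "relation \<Rightarrow> nat set \<Rightarrow> nat set \<Rightarrow> nat" where
  "degree R X Y = Max ((\<lambda>x. card (project Y (select X x R))) ` {x. dom x = X})"

datatype pconstraint =
  PConstraint (atom: nat) (sources: "nat set set") (target: "nat set") (bound: nat)

definition wf_constraint :: "query \<Rightarrow> pconstraint \<Rightarrow> bool" where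
  "wf_constraint Q c \<longleftrightarrow>
     atom c < length Q \<and> target c \<subseteq> set (Q ! atom c) \<and> (\<forall>X \<in> sources c. X \<subseteq> target c)"

text \<open>
  The minimum over all partitions is at most the bound iff some partition attains the bound.
\<close>

definition satisfies :: "database \<Rightarrow> pconstraint \<Rightarrow> bool" where
  "satisfies I c \<longleftrightarrow>
     (\<exists>P :: nat set \<Rightarrow> relation.
        disjoint_family_on P (sources c) \<and>
        (\<Union>X \<in> sources c. P X) = I ! atom c \<and>
        (\<forall>X \<in> sources c. degree (P X) X (target c) \<le> bound c))"

definition models :: "query \<Rightarrow> pconstraint set \<Rightarrow> database set" where
  "models Q C = {I. is_database Q I \<and> (\<forall>c \<in> C. satisfies I c)}"

definition degree_constraints :: "pconstraint set \<Rightarrow> pconstraint set" where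
  "degree_constraints C = {c \<in> C. \<exists>X. sources c = {X}}"

definition is_cardinality_constraint :: "query \<Rightarrow> pconstraint \<Rightarrow> bool" where
  "is_cardinality_constraint Q c \<longleftrightarrow> sources c = {{}} \<and> target c = set (Q ! atom c)"

definition covered :: "query \<Rightarrow> pconstraint set \<Rightarrow> bool" where
  "covered Q C \<longleftrightarrow>
     (\<forall>z \<in> query_vars Q. \<exists>c \<in> C. is_cardinality_constraint Q c \<and> z \<in> target c)"

text \<open>
  A supremum in \<^typ>\<open>nat\<close>; it is meaningful for \<^term>\<open>covered Q C\<close>, which bounds the set.
\<close>

definition comb_bound :: "query \<Rightarrow> pconstraint set \<Rightarrow> nat" where
  "comb_bound Q C = (SUP I \<in> models Q C. card (answer Q I))"


section \<open>A random access machine with uniform cost\<close>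

text \<open>
  Algorithms are structured programs over finitely many scalar registers and finitely many
  unbounded arrays of natural numbers, with random access.  Every evaluation of a syntax node
  costs one time unit.  Arithmetic is limited to addition and truncated subtraction, so that
  unit cost does not give access to large numbers beyond the usual random access machine.
\<close>

datatype exp =
    Const nat
  | Reg nat
  | Fetch nat exp  \<comment> \<open>array name and index\<close>
  | Plus exp exp
  | Minus exp exp

datatype test =
    Less exp exp
  | Equal exp exp
  | Neg test
  | Conj test test

datatype program =
    Skip
  | Assign nat exp
  | Store nat exp exp  \<comment> \<open>array name, index, value\<close>
  | Emit exp  \<comment> \<open>append a number to the output\<close>
  | Seq program program
  | Cond test program program
  | While test program

record state =
  regs :: "nat \<Rightarrow> nat"
  arrays :: "nat \<Rightarrow> nat \<Rightarrow> nat"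
  out :: "nat list"

primrec exp_val :: "exp \<Rightarrow> state \<Rightarrow> nat" where
  "exp_val (Const k) s = k"
| "exp_val (Reg x) s = regs s x"
| "exp_val (Fetch a e) s = arrays s a (exp_val e s)"
| "exp_val (Plus e f) s = exp_val e s + exp_val f s"
| "exp_val (Minus e f) s = exp_val e s - exp_val f s"

primrec exp_cost :: "exp \<Rightarrow> nat" where
  "exp_cost (Const k) = 1"
| "exp_cost (Reg x) = 1"
| "exp_cost (Fetch a e) = 1 + exp_cost e"
| "exp_cost (Plus e f) = 1 + exp_cost e + exp_cost f"
| "exp_cost (Minus e f) = 1 + exp_cost e + exp_cost f"

primrec test_val :: "test \<Rightarrow> state \<Rightarrow> bool" where
  "test_val (Less e f) s \<longleftrightarrow> exp_val e s < exp_val f s"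
| "test_val (Equal e f) s \<longleftrightarrow> exp_val e s = exp_val f s"
| "test_val (Neg b) s \<longleftrightarrow> \<not> test_val b s"
| "test_val (Conj b c) s \<longleftrightarrow> test_val b s \<and> test_val c s"

primrec test_cost :: "test \<Rightarrow> nat" where
  "test_cost (Less e f) = 1 + exp_cost e + exp_cost f"
| "test_cost (Equal e f) = 1 + exp_cost e + exp_cost f"
| "test_cost (Neg b) = 1 + test_cost b"
| "test_cost (Conj b c) = 1 + test_cost b + test_cost c"

text \<open>\<open>exec p s t s'\<close>: started in \<open>s\<close>, program \<open>p\<close> halts in \<open>s'\<close> after \<open>t\<close> time units.\<close>

inductive exec :: "program \<Rightarrow> state \<Rightarrow> nat \<Rightarrow> state \<Rightarrow> bool" where
  Skip: "exec Skip s 1 s"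
| Assign: "exec (Assign x e) s (1 + exp_cost e) (s\<lparr>regs := (regs s)(x := exp_val e s)\<rparr>)"
| Store: "exec (Store a e f) s (1 + exp_cost e + exp_cost f)
    (s\<lparr>arrays := (arrays s)(a := (arrays s a)(exp_val e s := exp_val f s))\<rparr>)"
| Emit: "exec (Emit e) s (1 + exp_cost e) (s\<lparr>out := out s @ [exp_val e s]\<rparr>)"
| Seq: "exec p s t s' \<Longrightarrow> exec q s' u s'' \<Longrightarrow> exec (Seq p q) s (t + u) s''"
| CondTrue: "test_val b s \<Longrightarrow> exec p s t s' \<Longrightarrow> exec (Cond b p q) s (1 + test_cost b + t) s'"
| CondFalse: "\<not> test_val b s \<Longrightarrow> exec q s t s' \<Longrightarrow> exec (Cond b p q) s (1 + test_cost b + t) s'"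
| WhileFalse: "\<not> test_val b s \<Longrightarrow> exec (While b p) s (1 + test_cost b) s"
| WhileTrue: "test_val b s \<Longrightarrow> exec p s t s' \<Longrightarrow> exec (While b p) s' u s'' \<Longrightarrow>
    exec (While b p) s (1 + test_cost b + t + u) s''"

inductive_cases exec_elims:
  "exec Skip s t s'"
  "exec (Assign x e) s t s'"
  "exec (Store a e f) s t s'"
  "exec (Emit e) s t s'"
  "exec (Seq p q) s t s'"
  "exec (Cond b p q) s t s'"
  "exec (While b p) s t s'"

lemma exec_deterministic:
  "exec p s t s' \<Longrightarrow> exec p s u s'' \<Longrightarrow> t = u \<and> s' = s''"
proof (induction arbitrary: u s'' rule: exec.induct)
  case (Seq p s t s' q v s1)
  from Seq.prems show ?case by (rule exec_elims) (metis Seq.IH)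
next
  case (CondTrue b s p t s' q)
  from CondTrue.prems show ?case by (rule exec_elims) (use CondTrue.hyps in \<open>auto dest: CondTrue.IH\<close>)
next
  case (CondFalse b s q t s' p)
  from CondFalse.prems show ?case by (rule exec_elims) (use CondFalse.hyps in \<open>auto dest: CondFalse.IH\<close>)
next
  case (WhileFalse b s p)
  from WhileFalse.prems show ?case by (rule exec_elims) (use WhileFalse.hyps in simp_all)
next
  case (WhileTrue b s p t s' v s1)
  from WhileTrue.prems show ?case by (rule exec_elims) (use WhileTrue.hyps in \<open>auto dest: WhileTrue.IH\<close>)
qed (erule exec_elims; simp)+

lemma exec_time_pos: "exec p s t s' \<Longrightarrow> t > 0"
  by (induction rule: exec.induct) auto


section \<open>Join algorithms\<close>

text \<open>
  The input consists of the query (number of atoms; arity and variables of each atom) followed by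
  the database (number of rows and the rows of each relation).  It is stored in array 0;
  everything else is initially 0.  The rows of a relation may come in any order.
\<close>

definition row :: "nat list \<Rightarrow> tuple \<Rightarrow> nat list" where
  "row zs t = map (\<lambda>z. the (t z)) zs"

definition is_listing :: "query \<Rightarrow> database \<Rightarrow> nat list list list \<Rightarrow> bool" where
  "is_listing Q I D \<longleftrightarrow> length D = length Q \<and>
     (\<forall>i < length Q. distinct (D ! i) \<and> set (D ! i) = row (Q ! i) ` (I ! i))"

definition encode :: "query \<Rightarrow> nat list list list \<Rightarrow> nat list" where
  "encode Q D =
     length Q # concat (map (\<lambda>zs. length zs # zs) Q) @
     concat (map (\<lambda>rows. length rows # concat rows) D)"

definition init_state :: "nat list \<Rightarrow> state" where
  "init_state xs =
     \<lparr>regs = (\<lambda>_. 0),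
      arrays = (\<lambda>a i. if a = 0 \<and> i < length xs then xs ! i else 0),
      out = []\<rparr>"

text \<open>
  The program halts on every presentation of the database, having emitted each tuple of the answer
  exactly once, as a row over the query variables in increasing order.
\<close>

definition enumerates :: "program \<Rightarrow> query \<Rightarrow> database \<Rightarrow> bool" where
  "enumerates p Q I \<longleftrightarrow>
     (\<forall>D. is_listing Q I D \<longrightarrow>
       (\<exists>t s ts. exec p (init_state (encode Q D)) t s \<and>
          distinct ts \<and> set ts = answer Q I \<and>
          out s = concat (map (row (sorted_list_of_set (query_vars Q))) ts)))"

text \<open>The worst case over the finitely many presentations of a database.\<close>

definition run_time :: "program \<Rightarrow> query \<Rightarrow> database \<Rightarrow> nat" where
  "run_time p Q I = Max {t. \<exists>D s. is_listing Q I D \<and> exec p (init_state (encode Q D)) t s}"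

definition enumerates_in_time ::
    "program \<Rightarrow> query \<Rightarrow> (nat \<Rightarrow> database set) \<Rightarrow> (nat \<Rightarrow> nat) \<Rightarrow> bool" where
  "enumerates_in_time p Q \<I> T \<longleftrightarrow>
     (\<forall>n. \<forall>I \<in> \<I> n. enumerates p Q I) \<and>
     (\<exists>c :: real. \<forall>\<^sub>F n in sequentially. \<forall>I \<in> \<I> n. real (run_time p Q I) \<le> c * real (T n))"

definition is_join_algorithm :: "query \<Rightarrow> program \<Rightarrow> bool" where
  "is_join_algorithm Q p \<longleftrightarrow> (\<forall>I. is_database Q I \<longrightarrow> enumerates p Q I)"

definition is_ordering :: "query \<Rightarrow> nat list \<Rightarrow> bool" where
  "is_ordering Q zs \<longleftrightarrow> distinct zs \<and> set zs = query_vars Q"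

definition max_intermediate :: "nat list \<Rightarrow> query \<Rightarrow> database \<Rightarrow> nat" where
  "max_intermediate zs Q I =
     Max ((\<lambda>i. card (restricted_answer (set (take i zs)) Q I)) ` {1..length zs})"

definition large_databases :: "query \<Rightarrow> database filter" where
  "large_databases Q = inf (filtercomap database_size at_top) (principal {I. is_database Q I})"

text \<open>
  The ordering may depend on the database.  The lower bound is asymptotic in the number of tuples
  of the database.
\<close>

definition is_vaat :: "query \<Rightarrow> program \<Rightarrow> bool" where
  "is_vaat Q p \<longleftrightarrow> is_join_algorithm Q p \<and>
     (\<exists>ord :: database \<Rightarrow> nat list. (\<forall>I. is_ordering Q (ord I)) \<and>
        (\<lambda>I. real (run_time p Q I))
          \<in> \<Omega>[large_databases Q](\<lambda>I. real (max_intermediate (ord I) Q I)))"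

end

theory Submission
  imports Defs "HOL-Library.Nat_Bijection"
begin

text \<open>
  The query is a triangle over three blocks of two variables each, with a private variable in
  every atom.  The partition constraint says that each relation splits into five parts, in each of
  which one of the five columns is a key; the private column takes only \<open>O(n\<^sup>2)\<close> values, and all
  relations have size \<open>O(n\<^sup>4)\<close>.

  Evaluation in linear time: a row for which a shared column is a key can afford to enumerate the
  rows of the neighbouring relation that agree with it in this column, because these lists are
  disjoint for different rows.  The third row of a triangle is then looked up by its columns 0 and
  2, which form a key by a further degree constraint.  The partition itself is never computed.
  Each row uses the column with the shortest list, and for each value of the private column the row with the longest such list is called
  heavy and skipped.  At most one row per private value relies on the private key, so skipping
  the most expensive one costs at most as much as an optimal partition would.  There are
  \<open>O(n\<^sup>2)\<close> heavy rows, and the triangles of heavy rows are found by trying \<open>O(n\<^sup>4)\<close> pairs.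

  A variable-at-a-time algorithm fails because, for each shared variable \<open>z\<close>, there is a database in which
  \<open>z\<close> carries the keys of the two big relations and the third relation is an \<open>n \<times> n\<close> grid: without \<open>z\<close>,
  the join has \<open>n \<cdot> n \<cdot> n\<^sup>3\<close> tuples.  The disjoint union of the six databases is bad for every ordering,
  since some shared variable comes last among the shared ones.  Degree constraints alone
  admit the full grid of side \<open>n\<^sup>2\<close>, with \<open>n\<^sup>6\<close> triangles.
\<close>

section \<open>A program logic with running time\<close>

text \<open>Two features of the query serve the lower bound. Variables come in pairs so that leaving
  out the last shared variable \<open>z\<close> keeps its twin, which still carries the block value:
  without \<open>z\<close> the part for \<open>z\<close> only asks for equal block values, whereas
  with \<open>z\<close> the pairs stored in its two relations must match as well. The relation
  without \<open>z\<close> is a grid in which no shared column is a key, so it needs a private one;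
  since private columns take few values, this does not spoil the upper bound: there are few heavy
  rows, and all pairs of them can be tried.

  The size of the answer under the partition constraints is not bounded by counting. The program
  emits the whole answer in O(n^4) steps and every emission costs time, so the algorithm itself
  yields the bound. A diagonal database attains n^4, which makes this running time linear in the
  supremum. The partition, which the program never sees, enters only the analysis of the running
  time.\<close>

text \<open>
  The time is part of the postcondition, counted from the start time \<open>t\<close>.
\<close>

definition wp :: "program \<Rightarrow> (nat \<Rightarrow> state \<Rightarrow> bool) \<Rightarrow> nat \<Rightarrow> state \<Rightarrow> bool" where
  "wp p Q t s \<longleftrightarrow> (\<exists>u s'. exec p s u s' \<and> Q (t + u) s')"

text \<open>Determinism of \<open>exec\<close> turns one known execution into an equivalence, so the
  rules for atomic programs can be rewrite rules.\<close>

lemma wp_iff: "exec p s u s' \<Longrightarrow> wp p Q t s \<longleftrightarrow> Q (t + u) s'"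
  unfolding wp_def using exec_deterministic by blast

lemma wp_Skip [simp]: "wp Skip Q t s \<longleftrightarrow> Q (t + 1) s"
  by (rule wp_iff[OF exec.Skip])

lemma wp_Assign [simp]:
  "wp (Assign x e) Q t s \<longleftrightarrow>
     Q (t + (1 + exp_cost e)) (s\<lparr>regs := (regs s)(x := exp_val e s)\<rparr>)"
  by (rule wp_iff[OF exec.Assign])

lemma wp_Store [simp]:
  "wp (Store a e f) Q t s \<longleftrightarrow>
     Q (t + (1 + exp_cost e + exp_cost f))
       (s\<lparr>arrays := (arrays s)(a := (arrays s a)(exp_val e s := exp_val f s))\<rparr>)"
  by (rule wp_iff[OF exec.Store])

lemma wp_Emit [simp]:
  "wp (Emit e) Q t s \<longleftrightarrow> Q (t + (1 + exp_cost e)) (s\<lparr>out := out s @ [exp_val e s]\<rparr>)"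
  by (rule wp_iff[OF exec.Emit])

lemma wp_Seq [simp]: "wp (Seq p q) Q t s \<longleftrightarrow> wp p (wp q Q) t s"
proof
  assume "wp (Seq p q) Q t s"
  then obtain u s' where "exec (Seq p q) s u s'" and Q: "Q (t + u) s'" unfolding wp_def by blast
  then show "wp p (wp q Q) t s"
    by (auto simp: wp_def elim!: exec_elims) (metis add.assoc)
next
  assume "wp p (wp q Q) t s"
  then show "wp (Seq p q) Q t s"
    by (auto simp: wp_def) (metis exec.Seq add.assoc)
qed

lemma wp_Cond [simp]:
  "wp (Cond b p q) Q t s \<longleftrightarrow>
     (if test_val b s then wp p Q (t + (1 + test_cost b)) s else wp q Q (t + (1 + test_cost b)) s)"
  unfolding wp_def
  by (auto elim!: exec_elims)
     (metis add.assoc plus_1_eq_Suc exec.CondTrue exec.CondFalse add_Suc_right add_Suc)+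

lemma wp_mono: "wp p Q t s \<Longrightarrow> (\<And>t' s'. Q t' s' \<Longrightarrow> R t' s') \<Longrightarrow> wp p R t s"
  unfolding wp_def by blast

text \<open>Total correctness: termination comes from the measure \<open>\<mu>\<close>, while the
  running time is accumulated in the invariant, which sees the current time.\<close>

lemma wp_While:
  assumes "I t s"
    and "\<And>t s. I t s \<Longrightarrow> test_val b s \<Longrightarrow>
           wp p (\<lambda>t' s'. I t' s' \<and> (\<mu> s' :: nat) < \<mu> s) (t + (1 + test_cost b)) s"
    and "\<And>t s. I t s \<Longrightarrow> \<not> test_val b s \<Longrightarrow> Q (t + (1 + test_cost b)) s"
  shows "wp (While b p) Q t s"
  using assms(1)
proof (induction "\<mu> s" arbitrary: t s rule: less_induct)
  case less
  show ?case
  proof (cases "test_val b s")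
    case True
    obtain u s' where 1: "exec p s u s'" "I (t + (1 + test_cost b) + u) s'" "\<mu> s' < \<mu> s"
      using assms(2)[OF less.prems True] unfolding wp_def by blast
    obtain v s'' where 2: "exec (While b p) s' v s''" "Q (t + (1 + test_cost b) + u + v) s''"
      using less.hyps[OF 1(3,2)] unfolding wp_def by blast
    show ?thesis unfolding wp_def
      using exec.WhileTrue[OF True 1(1) 2(1)] 2(2) by (metis add.assoc)
  next
    case False
    then show ?thesis using assms(3)[OF less.prems False]
      unfolding wp_def by (blast intro: exec.WhileFalse)
  qed
qed

text \<open>Names of arrays and registers are constants of the syntax, so a loop over relations or
  columns cannot be a \<open>While\<close>; it is unrolled into the program text.\<close>

primrec rep :: "nat \<Rightarrow> (nat \<Rightarrow> program) \<Rightarrow> program" where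
  "rep 0 f = Skip"
| "rep (Suc m) f = Seq (rep m f) (f m)"

lemma wp_rep:
  assumes "I 0 s"
    and "\<And>i t s. i < m \<Longrightarrow> I i s \<Longrightarrow> wp (f i) (\<lambda>t' s'. t' \<le> t + c i \<and> I (Suc i) s') t s"
  shows "wp (rep m f) (\<lambda>t' s'. t' \<le> t + 1 + (\<Sum>i<m. c i) \<and> I m s') t s"
  using assms
proof (induction m)
  case (Suc m)
  have "wp (rep m f) (\<lambda>t' s'. t' \<le> t + 1 + (\<Sum>i<m. c i) \<and> I m s') t s"
    using Suc by simp
  then show ?case
    unfolding rep.simps wp_Seq
    by (rule wp_mono) (rule wp_mono[OF Suc.prems(2)], auto)
qed simp

text \<open>
  Array 0 is the input.  The other arrays are named by a kind and two indices, usually a relation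
  and a column, and the registers by a kind and a relation.
\<close>

definition nm :: "nat \<Rightarrow> nat \<Rightarrow> nat \<Rightarrow> nat" where
  "nm a j k = Suc (prod_encode (a, prod_encode (j, k)))"

definition rg :: "nat \<Rightarrow> nat \<Rightarrow> nat" where
  "rg a j = prod_encode (a, j)"

lemma nm_eq [simp]: "nm a j k = nm a' j' k' \<longleftrightarrow> a = a' \<and> j = j' \<and> k = k'"
  by (simp add: nm_def prod_encode_eq)

lemma nm_nonzero [simp]: "nm a j k \<noteq> 0" "0 \<noteq> nm a j k"
  by (simp_all add: nm_def)

lemma rg_eq [simp]: "rg a j = rg a' j' \<longleftrightarrow> a = a' \<and> j = j'"
  by (simp add: rg_def prod_encode_eq)

text \<open>In this order: the current row of a relation, the address of its first row, the address
  past its last row, the head of its list of heavy rows, a bound on all key values, and the next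
  free cell of a lookup table.\<close>

abbreviation (input) "RX \<equiv> rg 0"
abbreviation (input) "RST \<equiv> rg 1"
abbreviation (input) "REN \<equiv> rg 2"
abbreviation (input) "RHH \<equiv> rg 3"
abbreviation (input) "RK \<equiv> rg 4 0"
abbreviation (input) "RNX \<equiv> rg 5 0"

definition for_rows :: "nat \<Rightarrow> program \<Rightarrow> program" where
  "for_rows j body =
     Seq (Assign (RX j) (Reg (RST j)))
         (While (Less (Reg (RX j)) (Reg (REN j)))
            (Seq body (Assign (RX j) (Plus (Reg (RX j)) (Const 5)))))"

text \<open>The loop test and the increment cost 4 each, hence 8 per row; the initial assignment and
  the failing test give the 6. The cost \<open>f\<close> varies with the row because the enumeration
  is later charged row by row.\<close>

lemma wp_for_rows:
  assumes st: "regs s (RST j) = a" and inv: "Inv 0 s"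
    and stable: "\<And>i s v. Inv i s \<Longrightarrow> Inv i (s\<lparr>regs := (regs s)(RX j := v)\<rparr>)"
    and en: "\<And>i s. Inv i s \<Longrightarrow> regs s (REN j) = a + 5 * m"
    and body: "\<And>i t s. i < m \<Longrightarrow> Inv i s \<Longrightarrow> regs s (RX j) = a + 5 * i \<Longrightarrow>
        wp body (\<lambda>t' s'. t' \<le> t + f i \<and> Inv (Suc i) s' \<and> regs s' (RX j) = a + 5 * i) t s"
  shows "wp (for_rows j body) (\<lambda>t' s'. t' \<le> t + 6 + (\<Sum>i<m. f i + 8) \<and> Inv m s') t s"
  unfolding for_rows_def wp_Seq wp_Assign
proof (rule wp_While[where \<mu> = "\<lambda>s. a + 5 * m - regs s (RX j)" and
      I = "\<lambda>t' s'. \<exists>i\<le>m. Inv i s' \<and> regs s' (RX j) = a + 5 * i \<and> t' \<le> t + 2 + (\<Sum>i<i. f i + 8)"])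
  show "\<exists>i\<le>m. Inv i (s\<lparr>regs := (regs s)(RX j := exp_val (Reg (RST j)) s)\<rparr>) \<and>
     regs (s\<lparr>regs := (regs s)(RX j := exp_val (Reg (RST j)) s)\<rparr>) (RX j) = a + 5 * i \<and>
     t + (1 + exp_cost (Reg (RST j))) \<le> t + 2 + (\<Sum>i<i. f i + 8)"
    using inv stable st by (intro exI[of _ 0]) auto
next
  fix t' s' assume "\<exists>i\<le>m. Inv i s' \<and> regs s' (RX j) = a + 5 * i \<and> t' \<le> t + 2 + (\<Sum>i<i. f i + 8)"
    and b: "test_val (Less (Reg (RX j)) (Reg (REN j))) s'"
  then obtain i where i: "i \<le> m" "Inv i s'" "regs s' (RX j) = a + 5 * i"
      "t' \<le> t + 2 + (\<Sum>i<i. f i + 8)" by blast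
  with b en[OF i(2)] have "i < m" by simp
  show "wp (Seq body (Assign (RX j) (Plus (Reg (RX j)) (Const 5))))
     (\<lambda>t' s''. (\<exists>i\<le>m. Inv i s'' \<and> regs s'' (RX j) = a + 5 * i \<and> t' \<le> t + 2 + (\<Sum>i<i. f i + 8)) \<and>
        a + 5 * m - regs s'' (RX j) < a + 5 * m - regs s' (RX j))
     (t' + (1 + test_cost (Less (Reg (RX j)) (Reg (REN j))))) s'"
    unfolding wp_Seq
  proof (rule wp_mono[OF body[OF \<open>i < m\<close> i(2,3)]])
    fix t1 s1
    assume "t1 \<le> t' + (1 + test_cost (Less (Reg (RX j)) (Reg (REN j)))) + f i \<and> Inv (Suc i) s1 \<and>
         regs s1 (RX j) = a + 5 * i"
    with i \<open>i < m\<close> stable[of "Suc i" s1]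
    show "wp (Assign (RX j) (Plus (Reg (RX j)) (Const 5)))
      (\<lambda>t' s''. (\<exists>i\<le>m. Inv i s'' \<and> regs s'' (RX j) = a + 5 * i \<and> t' \<le> t + 2 + (\<Sum>i<i. f i + 8)) \<and>
        a + 5 * m - regs s'' (RX j) < a + 5 * m - regs s' (RX j)) t1 s1"
      by (auto intro!: exI[of _ "Suc i"])
  qed
next
  fix t' s' assume "\<exists>i\<le>m. Inv i s' \<and> regs s' (RX j) = a + 5 * i \<and> t' \<le> t + 2 + (\<Sum>i<i. f i + 8)"
    and b: "\<not> test_val (Less (Reg (RX j)) (Reg (REN j))) s'"
  then obtain i where i: "i \<le> m" "Inv i s'" "regs s' (RX j) = a + 5 * i"
      "t' \<le> t + 2 + (\<Sum>i<i. f i + 8)" by blast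
  with b en[OF i(2)] have "i = m" by simp
  with i show "t' + (1 + test_cost (Less (Reg (RX j)) (Reg (REN j)))) \<le> t + 6 + (\<Sum>i<m. f i + 8) \<and> Inv m s'"
    by simp
qed

text \<open>
  The rows in a list are linked in decreasing order of their addresses; address 0, which is never
  that of a row, ends the list.
\<close>

definition chain_loop :: "nat \<Rightarrow> nat \<Rightarrow> program \<Rightarrow> program" where
  "chain_loop a x body =
     While (Neg (Equal (Reg x) (Const 0))) (Seq body (Assign x (Fetch a (Reg x))))"

abbreviation max_or_0 :: "nat set \<Rightarrow> nat" where "max_or_0 S \<equiv> Max (insert 0 S)"

text \<open>In a traversal the rows already treated are those above the current address; following
  the link adds exactly the current row.\<close>

lemma above_max_or_0_below:
  assumes "finite S" "0 \<notin> S" "q \<in> S"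
  shows "{p \<in> S. max_or_0 {r \<in> S. r < q} < p} = insert q {p \<in> S. q < p}"
proof -
  have "max_or_0 {r \<in> S. r < q} < p \<longleftrightarrow> p = q \<or> q < p" if "p \<in> S" for p
    using assms that by (cases "p = 0") (auto simp: not_less_iff_gr_or_eq)
  then show ?thesis using assms by blast
qed

text \<open>Links go strictly downwards to 0, so the register itself is the termination measure and
  also determines the set of rows already treated. The 5 pays for the failing test, the 8 for test
  and link.\<close>

lemma wp_chain_loop:
  assumes S: "finite S" "0 \<notin> S" and x: "regs s x = max_or_0 S" and inv: "Inv {} s"
    and stable: "\<And>D s v. Inv D s \<Longrightarrow> Inv D (s\<lparr>regs := (regs s)(x := v)\<rparr>)"
    and nxt: "\<And>D s p. Inv D s \<Longrightarrow> p \<in> S \<Longrightarrow> arrays s a p = max_or_0 {q \<in> S. q < p}"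
    and body: "\<And>q D t s. q \<in> S \<Longrightarrow> q \<notin> D \<Longrightarrow> D \<subseteq> S \<Longrightarrow> Inv D s \<Longrightarrow> regs s x = q \<Longrightarrow>
        wp body (\<lambda>t' s'. t' \<le> t + f q \<and> Inv (insert q D) s' \<and> regs s' x = q) t s"
  shows "wp (chain_loop a x body) (\<lambda>t' s'. t' \<le> t + 5 + (\<Sum>q\<in>S. f q + 8) \<and> Inv S s') t s"
  unfolding chain_loop_def
proof (rule wp_While[where \<mu> = "\<lambda>s. regs s x" and
      I = "\<lambda>t' s'. regs s' x \<in> insert 0 S \<and> Inv {p \<in> S. regs s' x < p} s' \<and>
           t' \<le> t + (\<Sum>q\<in>{p \<in> S. regs s' x < p}. f q + 8)"])
  have "max_or_0 S \<in> insert 0 S" using S by (intro Max_in) auto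
  moreover have e: "{p \<in> S. max_or_0 S < p} = {}" using S by (auto simp: not_less)
  ultimately show "regs s x \<in> insert 0 S \<and> Inv {p \<in> S. regs s x < p} s \<and>
           t \<le> t + (\<Sum>q\<in>{p \<in> S. regs s x < p}. f q + 8)"
    unfolding x e using inv by simp
next
  fix t' s'
  assume I: "regs s' x \<in> insert 0 S \<and> Inv {p \<in> S. regs s' x < p} s' \<and>
           t' \<le> t + (\<Sum>q\<in>{p \<in> S. regs s' x < p}. f q + 8)"
    and b: "test_val (Neg (Equal (Reg x) (Const 0))) s'"
  define q where "q = regs s' x"
  define D where "D = {p \<in> S. q < p}"
  have q: "q \<in> S" "q \<noteq> 0" using I b by (auto simp: q_def)
  show "wp (Seq body (Assign x (Fetch a (Reg x))))
     (\<lambda>t' s''. (regs s'' x \<in> insert 0 S \<and> Inv {p \<in> S. regs s'' x < p} s'' \<and>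
           t' \<le> t + (\<Sum>q\<in>{p \<in> S. regs s'' x < p}. f q + 8)) \<and> regs s'' x < regs s' x)
     (t' + (1 + test_cost (Neg (Equal (Reg x) (Const 0))))) s'"
    unfolding wp_Seq
  proof (rule wp_mono[OF body[where q = q and D = D]])
    fix t1 s1
    assume *: "t1 \<le> t' + (1 + test_cost (Neg (Equal (Reg x) (Const 0)))) + f q \<and>
        Inv (insert q D) s1 \<and> regs s1 x = q"
    define r where "r = max_or_0 {r \<in> S. r < q}"
    have n: "arrays s1 a q = r" unfolding r_def using nxt * q by blast
    have m: "r \<in> insert 0 {r \<in> S. r < q}" unfolding r_def using S by (intro Max_in) auto
    have e: "{p \<in> S. r < p} = insert q D"
      unfolding r_def using above_max_or_0_below[OF S q(1)] by (simp add: D_def)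
    have "(\<Sum>q\<in>insert q D. f q + 8) = f q + 8 + (\<Sum>q\<in>D. f q + 8)"
      using S by (subst sum.insert) (auto simp: D_def)
    moreover have "t' \<le> t + (\<Sum>q\<in>D. f q + 8)" using I by (simp add: D_def q_def)
    ultimately have "t1 + 3 \<le> t + (\<Sum>q\<in>insert q D. f q + 8)"
      using * by simp
    moreover have "r < q" "r \<in> insert 0 S"
      using m q(2) by auto
    moreover have "Inv (insert q D) (s1\<lparr>regs := (regs s1)(x := r)\<rparr>)"
      using stable * by blast
    ultimately show "wp (Assign x (Fetch a (Reg x)))
      (\<lambda>t' s''. (regs s'' x \<in> insert 0 S \<and> Inv {p \<in> S. regs s'' x < p} s'' \<and>
           t' \<le> t + (\<Sum>q\<in>{p \<in> S. regs s'' x < p}. f q + 8)) \<and> regs s'' x < regs s' x) t1 s1"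
      using * n by (simp add: e q_def[symmetric])
  qed (use q I in \<open>auto simp: D_def q_def\<close>)
next
  fix t' s'
  assume I: "regs s' x \<in> insert 0 S \<and> Inv {p \<in> S. regs s' x < p} s' \<and>
           t' \<le> t + (\<Sum>q\<in>{p \<in> S. regs s' x < p}. f q + 8)"
    and b: "\<not> test_val (Neg (Equal (Reg x) (Const 0))) s'"
  then have e: "{p \<in> S. regs s' x < p} = S" using S(2) by (auto intro: gr0I)
  show "t' + (1 + test_cost (Neg (Equal (Reg x) (Const 0)))) \<le> t + 5 + (\<Sum>q\<in>S. f q + 8) \<and> Inv S s'"
    using I unfolding e by simp
qed

section \<open>Preprocessing\<close>

definition unchanged :: "nat set \<Rightarrow> nat set \<Rightarrow> state \<Rightarrow> state \<Rightarrow> bool" where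
  "unchanged A R s s' \<longleftrightarrow> (\<forall>a. a \<notin> A \<longrightarrow> arrays s' a = arrays s a) \<and>
     (\<forall>r. r \<notin> R \<longrightarrow> regs s' r = regs s r) \<and> out s' = out s"

lemma unchanged_refl: "unchanged A R s s"
  by (simp add: unchanged_def)

lemma unchanged_trans: "unchanged A R s s' \<Longrightarrow> unchanged A' R' s' s'' \<Longrightarrow> A' \<subseteq> A \<Longrightarrow> R' \<subseteq> R \<Longrightarrow> unchanged A R s s''"
  unfolding unchanged_def by (metis subsetD)

definition arrays_of_kind :: "nat set \<Rightarrow> nat set" where "arrays_of_kind T = {nm a j k |a j k. a \<in> T}"
definition regs_of_kind :: "nat set \<Rightarrow> nat set" where "regs_of_kind T = {rg a j |a j. a \<in> T}"

lemma nm_in_arrays_of_kind [simp]: "nm a j k \<in> arrays_of_kind T \<longleftrightarrow> a \<in> T" "0 \<notin> arrays_of_kind T"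
  by (auto simp: arrays_of_kind_def)

lemma rg_in_regs_of_kind [simp]: "rg a j \<in> regs_of_kind T \<longleftrightarrow> a \<in> T"
  by (auto simp: regs_of_kind_def)

abbreviation cell :: "nat \<Rightarrow> nat \<Rightarrow> exp" where
  "cell j k \<equiv> Fetch 0 (Plus (Reg (RX j)) (Const k))"

abbreviation "aHEAD \<equiv> nm 0"
abbreviation "aNEXT \<equiv> nm 1"
abbreviation "aCNT \<equiv> nm 2"
abbreviation "aCST j \<equiv> nm 3 j 0"
abbreviation "aSEL j \<equiv> nm 4 j 0"
abbreviation "aHV j \<equiv> nm 5 j 0"
abbreviation "aHN j \<equiv> nm 6 j 0"
abbreviation "aBASE j \<equiv> nm 7 j 0"
abbreviation "aTAB j \<equiv> nm 8 j 0"

text \<open>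
  Relation \<open>j\<close> holds blocks \<open>j\<close> and \<open>j + 1\<close> modulo 3 in its columns 0, 1 and 2, 3; column 4 is private.
  Column \<open>k < 4\<close> of relation \<open>j\<close> is also column \<open>nb_col k\<close> of relation \<open>nb_rel j k\<close>.
\<close>

definition nb_rel :: "nat \<Rightarrow> nat \<Rightarrow> nat" where
  "nb_rel j k = (if k < 2 then (j + 2) mod 3 else (j + 1) mod 3)"
definition nb_col :: "nat \<Rightarrow> nat" where
  "nb_col k = (if k < 2 then k + 2 else k - 2)"

text \<open>Values index the unbounded arrays directly, so rows that agree in a column are collected
  without sorting or hashing.\<close>

abbreviation chain_body :: "nat \<Rightarrow> nat \<Rightarrow> program" where
  "chain_body j k \<equiv>
     Seq (Store (aNEXT j k) (Reg (RX j)) (Fetch (aHEAD j k) (cell j k)))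
     (Seq (Store (aHEAD j k) (cell j k) (Reg (RX j)))
          (Store (aCNT j k) (cell j k) (Plus (Fetch (aCNT j k) (cell j k)) (Const 1))))"

definition chain_pass :: "nat \<Rightarrow> nat \<Rightarrow> program" where
  "chain_pass j k = for_rows j (chain_body j k)"

text \<open>Whether a column has been selected is read from \<open>aSEL\<close> and not from
  \<open>aCST\<close>, because 0 is a possible cost.\<close>

abbreviation sel_body :: "nat \<Rightarrow> nat \<Rightarrow> program" where
  "sel_body j k \<equiv>
     Cond (Conj (Neg (Equal (Fetch (aSEL j) (Reg (RX j))) (Const 0)))
                 (Neg (Less (Fetch (aCNT (nb_rel j k) (nb_col k)) (cell j k)) (Fetch (aCST j) (Reg (RX j))))))
       Skip
       (Seq (Store (aCST j) (Reg (RX j)) (Fetch (aCNT (nb_rel j k) (nb_col k)) (cell j k)))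
            (Store (aSEL j) (Reg (RX j)) (Const (Suc k))))"

text \<open>
  The array \<open>aSEL\<close> holds the selected column plus one, since 0 marks a row not yet treated.
\<close>

definition sel_pass :: "nat \<Rightarrow> nat \<Rightarrow> program" where
  "sel_pass j k = for_rows j (sel_body j k)"

abbreviation heavy_body :: "nat \<Rightarrow> program" where
  "heavy_body j \<equiv>
     Cond (Conj (Neg (Equal (Fetch (aHV j) (cell j 4)) (Const 0)))
                 (Neg (Less (Fetch (aCST j) (Fetch (aHV j) (cell j 4))) (Fetch (aCST j) (Reg (RX j))))))
       Skip
       (Store (aHV j) (cell j 4) (Reg (RX j)))"

definition heavy_pass :: "nat \<Rightarrow> program" where
  "heavy_pass j = for_rows j (heavy_body j)"

text \<open>A row is heavy iff it is the one recorded for its private value, which allows at most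
  one heavy row per value, also among rows of equal cost.\<close>

abbreviation heavy_test :: "nat \<Rightarrow> test" where
  "heavy_test j \<equiv> Equal (Fetch (aHV j) (cell j 4)) (Reg (RX j))"

abbreviation hlist_body :: "nat \<Rightarrow> program" where
  "hlist_body j \<equiv>
     Cond (heavy_test j)
       (Seq (Store (aHN j) (Reg (RX j)) (Reg (RHH j))) (Assign (RHH j) (Reg (RX j))))
       Skip"

definition hlist_pass :: "nat \<Rightarrow> program" where
  "hlist_pass j = for_rows j (hlist_body j)"

text \<open>A sum of all keys serves instead of their maximum. Its size is harmless, since arrays
  are unbounded and an access has unit cost.\<close>

definition key_bound_pass :: "nat \<Rightarrow> program" where
  "key_bound_pass j = for_rows j (Assign RK (Plus (Reg RK) (Plus (cell j 0) (cell j 2))))"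

abbreviation tab_body :: "nat \<Rightarrow> program" where
  "tab_body j \<equiv>
     Seq (Cond (Equal (Fetch (aBASE j) (cell j 0)) (Const 0))
             (Seq (Store (aBASE j) (cell j 0) (Reg RNX)) (Assign RNX (Plus (Reg RNX) (Reg RK))))
             Skip)
          (Store (aTAB j) (Plus (Fetch (aBASE j) (cell j 0)) (cell j 2)) (Reg (RX j)))"

text \<open>
  A two-dimensional table without multiplication: each value of column 0 gets its own block of \<open>K\<close>
  cells, where \<open>K\<close> exceeds all values used as keys.  The cells below \<open>K\<close> stay 0, so that a value without a block
  (base 0) yields no row.
\<close>

definition tab_pass :: "nat \<Rightarrow> program" where
  "tab_pass j = for_rows j (tab_body j)"

section \<open>Rows as addresses, and a generic pass over the rows of a relation\<close>

locale layout =
  fixes inp st n :: "nat \<Rightarrow> nat"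
  assumes st_pos: "st j > 0"
begin

definition rows_upto :: "nat \<Rightarrow> nat \<Rightarrow> nat set" where
  "rows_upto j m = (\<lambda>i. st j + 5 * i) ` {..<m}"

definition rows :: "nat \<Rightarrow> nat set" where "rows j = rows_upto j (n j)"

lemma rows_upto_0 [simp]: "rows_upto j 0 = {}"
  by (simp add: rows_upto_def)

lemma rows_upto_Suc: "rows_upto j (Suc i) = insert (st j + 5 * i) (rows_upto j i)"
  by (auto simp: rows_upto_def lessThan_Suc)

lemma rows_upto_less: "p \<in> rows_upto j i \<Longrightarrow> p < st j + 5 * i"
  by (auto simp: rows_upto_def)

lemma rows_upto_pos: "p \<in> rows_upto j i \<Longrightarrow> 0 < p"
  using st_pos by (auto simp: rows_upto_def)

lemma finite_rows_upto [simp]: "finite (rows_upto j i)"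
  by (simp add: rows_upto_def)

lemma finite_rows [simp]: "finite (rows j)"
  by (simp add: rows_def)

lemma rows_pos: "p \<in> rows j \<Longrightarrow> 0 < p"
  by (auto simp: rows_def dest: rows_upto_pos)

lemma rows_upto_rows: "i < n j \<Longrightarrow> st j + 5 * i \<in> rows j" "i \<le> n j \<Longrightarrow> p \<in> rows_upto j i \<Longrightarrow> p \<in> rows j"
  by (auto simp: rows_upto_def rows_def)

lemma card_rows: "card (rows j) = n j"
  unfolding rows_def rows_upto_def by (subst card_image) (auto intro: inj_onI)

lemma sum_rows: "(\<Sum>i<n j. f (st j + 5 * i)) = (\<Sum>p\<in>rows j. f p)"
  unfolding rows_def rows_upto_def by (subst sum.reindex) (auto intro: inj_onI)

definition layout_ok :: "state \<Rightarrow> bool" where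
  "layout_ok s \<longleftrightarrow> arrays s 0 = inp \<and>
     (\<forall>j<3. regs s (RST j) = st j \<and> regs s (REN j) = st j + 5 * n j)"

lemma layout_ok_unchanged: "layout_ok s \<Longrightarrow> unchanged A R s s' \<Longrightarrow> 0 \<notin> A \<Longrightarrow> (\<And>j. RST j \<notin> R) \<Longrightarrow> (\<And>j. REN j \<notin> R) \<Longrightarrow> layout_ok s'"
  by (simp add: layout_ok_def unchanged_def)

text \<open>The shell of all preprocessing loops. The frame \<open>unchanged A R\<close> preserves
  the input and the row bounds, so each pass has to maintain only its own progress predicate
  \<open>P\<close>.\<close>

lemma pass:
  assumes "layout_ok s" "j < 3" "0 \<notin> A" "R \<inter> regs_of_kind {1,2} = {}" "RX j \<in> R"
    and inv0: "P 0 s"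
    and stable: "\<And>i s v. P i s \<Longrightarrow> P i (s\<lparr>regs := (regs s)(RX j := v)\<rparr>)"
    and body: "\<And>i t s'. i < n j \<Longrightarrow> P i s' \<Longrightarrow> unchanged A R s s' \<Longrightarrow> regs s' (RX j) = st j + 5 * i \<Longrightarrow>
       arrays s' 0 = inp \<Longrightarrow> st j + 5 * i \<in> rows j \<Longrightarrow> st j + 5 * i \<notin> rows_upto j i \<Longrightarrow>
       wp body (\<lambda>t' s''. t' \<le> t + f (st j + 5 * i) \<and> P (Suc i) s'' \<and> unchanged A R s' s'' \<and>
          regs s'' (RX j) = st j + 5 * i) t s'"
  shows "wp (for_rows j body) (\<lambda>t' s'. t' \<le> t + 6 + (\<Sum>p\<in>rows j. f p + 8) \<and> P (n j) s' \<and> unchanged A R s s') t s"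
proof -
  have layout_ok': "layout_ok s'" if "unchanged A R s s'" for s'
    using layout_ok_unchanged[OF assms(1) that] assms(3,4) by (auto simp: regs_of_kind_def)
  have "wp (for_rows j body) (\<lambda>t' s'. t' \<le> t + 6 + (\<Sum>i<n j. f (st j + 5 * i) + 8) \<and>
      (P (n j) s' \<and> unchanged A R s s')) t s"
  proof (rule wp_for_rows[where a = "st j" and m = "n j" and Inv = "\<lambda>i s'. P i s' \<and> unchanged A R s s'"])
    fix i t s' assume *: "i < n j" "P i s' \<and> unchanged A R s s'" "regs s' (RX j) = st j + 5 * i"
    show "wp body (\<lambda>t' s''. t' \<le> t + f (st j + 5 * i) \<and> (P (Suc i) s'' \<and> unchanged A R s s'') \<and>
              regs s'' (RX j) = st j + 5 * i) t s'"
    proof (rule wp_mono[OF body[where s' = s' and i = i]])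
      show "st j + 5 * i \<notin> rows_upto j i" by (auto dest: rows_upto_less)
    qed (use * layout_ok' assms(2) in \<open>auto simp: layout_ok_def rows_upto_rows intro: unchanged_trans\<close>)
  next
    fix i s' v assume "P i s' \<and> unchanged A R s s'"
    then show "P i (s'\<lparr>regs := (regs s')(RX j := v)\<rparr>) \<and> unchanged A R s (s'\<lparr>regs := (regs s')(RX j := v)\<rparr>)"
      using stable assms(5) by (auto simp: unchanged_def)
  qed (use assms(1,2) inv0 layout_ok' in \<open>auto simp: layout_ok_def unchanged_refl\<close>)
  then show ?thesis by (simp only: sum_rows[of "\<lambda>p. f p + 8" j])
qed

section \<open>Linked lists of the rows that agree in a column\<close>

definition col_rows :: "nat \<Rightarrow> nat \<Rightarrow> nat \<Rightarrow> nat set" where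
  "col_rows j k v = {p \<in> rows j. inp (p + k) = v}"

definition chained :: "state \<Rightarrow> nat \<Rightarrow> nat \<Rightarrow> bool" where
  "chained s j k \<longleftrightarrow> (\<forall>v. arrays s (aHEAD j k) v = max_or_0 (col_rows j k v) \<and> arrays s (aCNT j k) v = card (col_rows j k v)) \<and>
     (\<forall>p\<in>rows j. arrays s (aNEXT j k) p = max_or_0 {q \<in> col_rows j k (inp (p + k)). q < p})"

lemma max_or_0_insert_above: "finite S \<Longrightarrow> (\<And>q. q \<in> S \<Longrightarrow> q < p) \<Longrightarrow> max_or_0 (insert p S) = p"
  by (intro Max_eqI) (auto intro: less_imp_le)

text \<open>Rows arrive by increasing address and are pushed at the front, so the head is the
  maximum of its list and each link leads to the next smaller member.\<close>

lemma wp_chain_pass: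
  assumes "layout_ok s" "j < 3" "\<And>v. arrays s (aHEAD j k) v = 0" "\<And>v. arrays s (aCNT j k) v = 0"
  shows "wp (chain_pass j k) (\<lambda>t' s'. t' \<le> t + 6 + 40 * n j \<and> chained s' j k \<and>
     unchanged {aHEAD j k, aNEXT j k, aCNT j k} {RX j} s s') t s"
proof -
  define S where "S i v = {p \<in> rows_upto j i. inp (p + k) = v}" for i v
  have S0: "S 0 v = {}" for v by (simp add: S_def)
  have SS: "S (Suc i) v = (if inp (st j + 5 * i + k) = v then insert (st j + 5 * i) (S i v) else S i v)" for i v
    by (auto simp: S_def rows_upto_Suc)
  have fS [simp]: "finite (S i v)" for i v by (simp add: S_def)
  have lS: "q < st j + 5 * i" if "q \<in> S i v" for q i v
    using that by (auto simp: S_def dest: rows_upto_less)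
  define P where "P i s \<longleftrightarrow> (\<forall>v. arrays s (aHEAD j k) v = max_or_0 (S i v) \<and> arrays s (aCNT j k) v = card (S i v)) \<and>
     (\<forall>p\<in>rows_upto j i. arrays s (aNEXT j k) p = max_or_0 {q \<in> S i (inp (p + k)). q < p})" for i and s :: state
  have "wp (chain_pass j k) (\<lambda>t' s'. t' \<le> t + 6 + (\<Sum>p\<in>rows j. 32 + 8) \<and> P (n j) s' \<and>
     unchanged {aHEAD j k, aNEXT j k, aCNT j k} {RX j} s s') t s"
    unfolding chain_pass_def
  proof (rule pass)
    fix i t s'
    assume i: "i < n j" "P i s'" "regs s' (RX j) = st j + 5 * i" "arrays s' 0 = inp"
    define p where "p = st j + 5 * i"
    have p: "q < p" if "q \<in> S i v" for q v using that lS by (auto simp: p_def)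
    have p': "q < p" if "q \<in> rows_upto j i" for q using that rows_upto_less by (auto simp: p_def)
    have m: "max_or_0 (insert p (S i v)) = p" for v
      using p by (intro max_or_0_insert_above) auto
    have c: "card (insert p (S i v)) = Suc (card (S i v))" for v
      using p by (subst card_insert_disjoint) auto
    have e1: "{q. (q = p \<or> q \<in> S i v) \<and> q < p} = S i v" for v using p by auto
    have e2: "{q. (q = p \<or> q \<in> S i v) \<and> q < x} = {q \<in> S i v. q < x}" if "x \<in> rows_upto j i" for v x
      using p'[OF that] by auto
    show "wp (chain_body j k)
       (\<lambda>t' s''. t' \<le> t + 32 \<and> P (Suc i) s'' \<and> unchanged {aHEAD j k, aNEXT j k, aCNT j k} {RX j} s' s'' \<and>
          regs s'' (RX j) = st j + 5 * i) t s'"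
      using i unfolding P_def SS rows_upto_Suc p_def[symmetric]
      by (auto simp: unchanged_def m c e1 e2 dest: p')
  qed (use assms in \<open>auto simp: P_def S0 regs_of_kind_def\<close>)
  moreover have "P (n j) s' = chained s' j k" for s'
    by (simp add: P_def chained_def S_def col_rows_def rows_def)
  ultimately show ?thesis by (simp add: card_rows mult.commute)
qed

section \<open>Choice of the cheapest shared column of a row\<close>

definition nb_count :: "nat \<Rightarrow> nat \<Rightarrow> nat \<Rightarrow> nat" where
  "nb_count j k p = card (col_rows (nb_rel j k) (nb_col k) (inp (p + k)))"

text \<open>Here \<open>m\<close> is the number of columns already compared, so that the same
  predicate describes the state between the passes for single columns.\<close>

definition selected :: "state \<Rightarrow> nat \<Rightarrow> nat \<Rightarrow> nat \<Rightarrow> bool" where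
  "selected s j m p \<longleftrightarrow> (if m = 0 then arrays s (aSEL j) p = 0 else
     (\<exists>l<m. arrays s (aSEL j) p = Suc l \<and> arrays s (aCST j) p = nb_count j l p \<and> (\<forall>k<m. nb_count j l p \<le> nb_count j k p)))"

lemma selected_cong: "arrays s' (aSEL j) p = arrays s (aSEL j) p \<Longrightarrow> arrays s' (aCST j) p = arrays s (aCST j) p \<Longrightarrow>
    selected s' j m p = selected s j m p"
  by (simp add: selected_def)

lemma wp_sel_pass:
  assumes "layout_ok s" "j < 3" "chained s (nb_rel j k) (nb_col k)" "\<And>p. p \<in> rows j \<Longrightarrow> selected s j k p"
  shows "wp (sel_pass j k) (\<lambda>t' s'. t' \<le> t + 6 + 40 * n j \<and> (\<forall>p\<in>rows j. selected s' j (Suc k) p) \<and>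
     unchanged {aSEL j, aCST j} {RX j} s s') t s"
proof -
  define P where "P i s \<longleftrightarrow> (\<forall>p\<in>rows j. selected s j (if p \<in> rows_upto j i then Suc k else k) p)" for i and s :: state
  have "wp (sel_pass j k) (\<lambda>t' s'. t' \<le> t + 6 + (\<Sum>p\<in>rows j. 32 + 8) \<and> P (n j) s' \<and>
     unchanged {aSEL j, aCST j} {RX j} s s') t s"
    unfolding sel_pass_def
  proof (rule pass)
    fix i t s'
    assume i: "i < n j" "P i s'" "regs s' (RX j) = st j + 5 * i" "arrays s' 0 = inp"
      "unchanged {aSEL j, aCST j} {RX j} s s'" "st j + 5 * i \<in> rows j" "st j + 5 * i \<notin> rows_upto j i"
    define p where "p = st j + 5 * i"
    have c: "arrays s' (aCNT (nb_rel j k) (nb_col k)) (inp (p + k)) = nb_count j k p"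
      using assms(3) i(5) by (auto simp: chained_def unchanged_def nb_count_def)
    have sp: "selected s' j k p" using i by (auto simp: P_def p_def)
    let ?keep = "arrays s' (aSEL j) p \<noteq> 0 \<and> \<not> nb_count j k p < arrays s' (aCST j) p"
    have 1: "P (Suc i) s'" if ?keep
    proof -
      have "selected s' j (Suc k) p"
        using sp that by (auto simp: selected_def less_Suc_eq split: if_splits)
      then show ?thesis using i(2) by (auto simp: P_def rows_upto_Suc p_def)
    qed
    have 2: "P (Suc i) (s'\<lparr>arrays := (arrays s')
       (aCST j := (arrays s' (aCST j))(p := nb_count j k p),
        aSEL j := (arrays s' (aSEL j))(p := Suc k))\<rparr>)" (is "P _ ?s") if "\<not> ?keep"
    proof -
      have "selected ?s j (Suc k) p"
      proof (cases "k = 0")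
        case False
        then show ?thesis using sp that by (auto simp: selected_def less_Suc_eq intro!: exI[of _ k])
      qed (auto simp: selected_def)
      moreover have "selected ?s j m q = selected s' j m q" if "q \<noteq> p" for m q
        using that by (intro selected_cong) auto
      moreover have "selected s' j (if q \<in> rows_upto j i then Suc k else k) q" if "q \<in> rows j" for q
        using i(2) that by (simp add: P_def)
      ultimately have "selected ?s j (if q \<in> insert p (rows_upto j i) then Suc k else k) q" if "q \<in> rows j" for q
        using that by (cases "q = p") auto
      then show ?thesis unfolding P_def rows_upto_Suc p_def[symmetric] by blast
    qed
    show "wp (sel_body j k)
       (\<lambda>t' s''. t' \<le> t + 32 \<and> P (Suc i) s'' \<and> unchanged {aSEL j, aCST j} {RX j} s' s'' \<and>
          regs s'' (RX j) = st j + 5 * i) t s'"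
      using 1 2 i(3,4) c unfolding p_def[symmetric]
      by (auto simp: unchanged_def)
  qed (use assms in \<open>auto simp: P_def regs_of_kind_def selected_def\<close>)
  moreover have "P (n j) s' = (\<forall>p\<in>rows j. selected s' j (Suc k) p)" for s'
    by (simp add: P_def rows_def)
  ultimately show ?thesis by (simp add: card_rows mult.commute)
qed

section \<open>Heavy rows: the most expensive row for each private value\<close>

definition heavy_found :: "state \<Rightarrow> nat \<Rightarrow> bool" where
  "heavy_found s j \<longleftrightarrow> (\<forall>p\<in>rows j. arrays s (aHV j) (inp (p + 4)) \<in> col_rows j 4 (inp (p + 4)) \<and>
     arrays s (aCST j) p \<le> arrays s (aCST j) (arrays s (aHV j) (inp (p + 4))))"

lemma wp_heavy_pass:
  assumes "layout_ok s" "j < 3" "\<And>v. arrays s (aHV j) v = 0"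
  shows "wp (heavy_pass j) (\<lambda>t' s'. t' \<le> t + 6 + 40 * n j \<and> heavy_found s' j \<and>
     unchanged {aHV j} {RX j} s s') t s"
proof -
  define P where "P i s \<longleftrightarrow> (\<forall>g. (\<forall>p\<in>rows_upto j i. inp (p + 4) \<noteq> g) \<longrightarrow> arrays s (aHV j) g = 0) \<and>
    (\<forall>p\<in>rows_upto j i. arrays s (aHV j) (inp (p + 4)) \<in> rows_upto j i \<and>
       inp (arrays s (aHV j) (inp (p + 4)) + 4) = inp (p + 4) \<and>
     arrays s (aCST j) p \<le> arrays s (aCST j) (arrays s (aHV j) (inp (p + 4))))" for i and s :: state
  have "wp (heavy_pass j) (\<lambda>t' s'. t' \<le> t + 6 + (\<Sum>p\<in>rows j. 32 + 8) \<and> P (n j) s' \<and>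
     unchanged {aHV j} {RX j} s s') t s"
    unfolding heavy_pass_def
  proof (rule pass)
    fix i t s'
    assume i: "i < n j" "P i s'" "regs s' (RX j) = st j + 5 * i" "arrays s' 0 = inp"
    define p where "p = st j + 5 * i"
    let ?g = "inp (p + 4)"
    have A: "arrays s' (aHV j) g = 0" if "\<And>q. q \<in> rows_upto j i \<Longrightarrow> inp (q + 4) \<noteq> g" for g
      using i(2) that unfolding P_def by simp
    have B: "arrays s' (aHV j) (inp (q + 4)) \<in> rows_upto j i \<and>
       inp (arrays s' (aHV j) (inp (q + 4)) + 4) = inp (q + 4) \<and>
       arrays s' (aCST j) q \<le> arrays s' (aCST j) (arrays s' (aHV j) (inp (q + 4)))" if "q \<in> rows_upto j i" for q
      using i(2) that unfolding P_def by simp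
    let ?keep = "arrays s' (aHV j) ?g \<noteq> 0 \<and> \<not> arrays s' (aCST j) (arrays s' (aHV j) ?g) < arrays s' (aCST j) p"
    have 1: "P (Suc i) s'" if keep: ?keep
    proof -
      obtain q where q: "q \<in> rows_upto j i" "inp (q + 4) = ?g"
        using A[of ?g] keep by blast
      have "arrays s' (aHV j) ?g \<in> rows_upto j i" "inp (arrays s' (aHV j) ?g + 4) = ?g"
        using B[OF q(1)] unfolding q(2) by simp_all
      then show ?thesis using i(2) keep unfolding P_def rows_upto_Suc p_def[symmetric]
        by auto
    qed
    have 2: "P (Suc i) (s'\<lparr>arrays := (arrays s')(aHV j := (arrays s' (aHV j))(?g := p))\<rparr>)" (is "P _ ?s") if k: "\<not> ?keep"
    proof -
      have "arrays s' (aCST j) q \<le> arrays s' (aCST j) p" if q: "q \<in> rows_upto j i" "inp (q + 4) = ?g" for q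
      proof -
        have "arrays s' (aHV j) ?g \<in> rows_upto j i" "arrays s' (aCST j) q \<le> arrays s' (aCST j) (arrays s' (aHV j) ?g)"
          using B[OF q(1)] unfolding q(2) by simp_all
        \<comment> \<open>The recorded entry is the address of a row and hence nonzero, so it must
          have been the cost comparison that failed.\<close>
        then show ?thesis using k rows_upto_pos[of "arrays s' (aHV j) ?g" j i] by auto
      qed
      then show ?thesis using i(2) unfolding P_def rows_upto_Suc p_def[symmetric] by auto
    qed
    show "wp (heavy_body j)
       (\<lambda>t' s''. t' \<le> t + 32 \<and> P (Suc i) s'' \<and> unchanged {aHV j} {RX j} s' s'' \<and>
          regs s'' (RX j) = st j + 5 * i) t s'"
      using 1 2 i(3,4) unfolding p_def[symmetric]
      by (auto simp: unchanged_def)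
  qed (use assms in \<open>auto simp: P_def regs_of_kind_def\<close>)
  moreover have "P (n j) s' \<Longrightarrow> heavy_found s' j" for s'
    by (auto simp: P_def heavy_found_def rows_def col_rows_def)
  ultimately show ?thesis by (auto simp: card_rows mult.commute elim!: wp_mono)
qed

definition heavy_rows :: "state \<Rightarrow> nat \<Rightarrow> nat set" where
  "heavy_rows s j = {p \<in> rows j. arrays s (aHV j) (inp (p + 4)) = p}"

definition heavy_listed :: "state \<Rightarrow> nat \<Rightarrow> bool" where
  "heavy_listed s j \<longleftrightarrow> regs s (RHH j) = max_or_0 (heavy_rows s j) \<and>
     (\<forall>p\<in>heavy_rows s j. arrays s (aHN j) p = max_or_0 {q \<in> heavy_rows s j. q < p})"

lemma wp_hlist_pass:
  assumes "layout_ok s" "j < 3" "regs s (RHH j) = 0"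
  shows "wp (hlist_pass j) (\<lambda>t' s'. t' \<le> t + 6 + 40 * n j \<and> heavy_listed s' j \<and>
     unchanged {aHN j} {RX j, RHH j} s s') t s"
proof -
  define S where "S i = {p \<in> rows_upto j i. arrays s (aHV j) (inp (p + 4)) = p}" for i
  have S0: "S 0 = {}" by (simp add: S_def)
  have SS: "S (Suc i) = (if arrays s (aHV j) (inp (st j + 5 * i + 4)) = st j + 5 * i then insert (st j + 5 * i) (S i) else S i)" for i
    by (auto simp: S_def rows_upto_Suc)
  have fS [simp]: "finite (S i)" for i by (simp add: S_def)
  have lS: "q < st j + 5 * i" if "q \<in> S i" for q i
    using that by (auto simp: S_def dest: rows_upto_less)
  define P where "P i s \<longleftrightarrow> regs s (RHH j) = max_or_0 (S i) \<and>
     (\<forall>p\<in>S i. arrays s (aHN j) p = max_or_0 {q \<in> S i. q < p})" for i and s :: state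
  have "wp (hlist_pass j) (\<lambda>t' s'. t' \<le> t + 6 + (\<Sum>p\<in>rows j. 32 + 8) \<and> P (n j) s' \<and>
     unchanged {aHN j} {RX j, RHH j} s s') t s"
    unfolding hlist_pass_def
  proof (rule pass)
    fix i t s'
    assume i: "i < n j" "P i s'" "regs s' (RX j) = st j + 5 * i" "arrays s' 0 = inp"
      "unchanged {aHN j} {RX j, RHH j} s s'"
    define p where "p = st j + 5 * i"
    have heavy: "arrays s' (aHV j) = arrays s (aHV j)" using i(5) by (simp add: unchanged_def)
    have p: "q < p" if "q \<in> S i" for q using that lS by (auto simp: p_def)
    have m: "max_or_0 (insert p (S i)) = p"
      using p by (intro max_or_0_insert_above) auto
    have e1: "{q. (q = p \<or> q \<in> S i) \<and> q < p} = S i" using p by auto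
    have e2: "{q. (q = p \<or> q \<in> S i) \<and> q < x} = {q \<in> S i. q < x}" if "x \<in> S i" for x
      using p[OF that] by auto
    show "wp (hlist_body j)
       (\<lambda>t' s''. t' \<le> t + 32 \<and> P (Suc i) s'' \<and> unchanged {aHN j} {RX j, RHH j} s' s'' \<and>
          regs s'' (RX j) = st j + 5 * i) t s'"
      using i unfolding P_def SS p_def[symmetric]
      by (auto simp: unchanged_def heavy m e1 e2 dest: p)
  qed (use assms in \<open>auto simp: P_def S0 regs_of_kind_def\<close>)
  moreover have "P (n j) s' = heavy_listed s' j" if "unchanged {aHN j} {RX j, RHH j} s s'" for s'
    using that by (simp add: P_def heavy_listed_def S_def heavy_rows_def rows_def unchanged_def)
  ultimately show ?thesis by (auto simp: card_rows mult.commute elim!: wp_mono)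
qed

section \<open>The lookup table for columns 0 and 2\<close>

lemma wp_key_pass:
  assumes "layout_ok s" "j < 3"
  shows "wp (key_bound_pass j) (\<lambda>t' s'. t' \<le> t + 6 + 40 * n j \<and> regs s RK \<le> regs s' RK \<and>
     (\<forall>p\<in>rows j. inp p + regs s RK \<le> regs s' RK \<and> inp (p + 2) + regs s RK \<le> regs s' RK) \<and>
     unchanged {} {RX j, RK} s s') t s"
proof -
  \<comment> \<open>The initial value stays on the left-hand sides: once it is positive, every key
    is strictly below the final value.\<close>
  define P where "P i s' \<longleftrightarrow> regs s RK \<le> regs s' RK \<and>
     (\<forall>p\<in>rows_upto j i. inp p + regs s RK \<le> regs s' RK \<and> inp (p + 2) + regs s RK \<le> regs s' RK)" for i and s' :: state
  have "wp (key_bound_pass j) (\<lambda>t' s'. t' \<le> t + 6 + (\<Sum>p\<in>rows j. 32 + 8) \<and> P (n j) s' \<and>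
     unchanged {} {RX j, RK} s s') t s"
    unfolding key_bound_pass_def
    by (rule pass) (use assms in \<open>auto simp: P_def regs_of_kind_def rows_upto_Suc unchanged_def\<close>)
  then show ?thesis
    by (rule wp_mono) (simp add: P_def card_rows mult.commute rows_def[symmetric])
qed

text \<open>The maximum names the row written last; under the key constraint the set has at most one
  element.\<close>

definition lookup_ok :: "state \<Rightarrow> nat \<Rightarrow> nat \<Rightarrow> bool" where
  "lookup_ok s K j \<longleftrightarrow> (\<forall>x y. y < K \<longrightarrow> arrays s (aTAB j) (arrays s (aBASE j) x + y) =
      max_or_0 {p \<in> rows j. inp p = x \<and> inp (p + 2) = y})"

lemma wp_tab_pass:
  assumes "layout_ok s" "j < 3" "\<And>v. arrays s (aBASE j) v = 0" "\<And>v. arrays s (aTAB j) v = 0"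
    and K: "regs s RK = K" "K > 0" "K \<le> regs s RNX" "\<And>p. p \<in> rows j \<Longrightarrow> inp (p + 2) < K"
  shows "wp (tab_pass j) (\<lambda>t' s'. t' \<le> t + 6 + 60 * n j \<and> lookup_ok s' K j \<and> regs s RNX \<le> regs s' RNX \<and>
     unchanged {aBASE j, aTAB j} {RX j, RNX} s s') t s"
proof -
  define S where "S i x y = {p \<in> rows_upto j i. inp p = x \<and> inp (p + 2) = y}" for i x y
  have SS: "S (Suc i) x y = (if inp (st j + 5 * i) = x \<and> inp (st j + 5 * i + 2) = y then insert (st j + 5 * i) (S i x y) else S i x y)" for i x y
    by (auto simp: S_def rows_upto_Suc)
  have fS [simp]: "finite (S i x y)" for i x y by (simp add: S_def)
  have lS: "q < st j + 5 * i" if "q \<in> S i x y" for q i x y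
    using that by (auto simp: S_def dest: rows_upto_less)
  \<comment> \<open>\<open>N\<close> is the next free cell, \<open>B\<close> the bases and
    \<open>T\<close> the table. The blocks are disjoint intervals of length \<open>K\<close> between
    \<open>K\<close> and \<open>N\<close>, and the cells outside this range have never been
    written.\<close>
  define PP where "PP i N B T \<longleftrightarrow> regs s RNX \<le> N \<and> (\<forall>x. B x \<noteq> 0 \<longrightarrow> K \<le> B x \<and> B x + K \<le> N) \<and>
      (\<forall>x x'. x \<noteq> x' \<longrightarrow> B x \<noteq> 0 \<longrightarrow> B x' \<noteq> 0 \<longrightarrow> B x + K \<le> B x' \<or> B x' + K \<le> B x) \<and>
      (\<forall>z. z < K \<or> N \<le> z \<longrightarrow> T z = 0) \<and>
      (\<forall>x y. y < K \<longrightarrow> B x \<noteq> 0 \<longrightarrow> T (B x + y) = max_or_0 (S i x y)) \<and>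
      (\<forall>x. B x = 0 \<longrightarrow> (\<forall>p\<in>rows_upto j i. inp p \<noteq> x))" for i N B T
  define P where "P i s' \<longleftrightarrow> PP i (regs s' RNX) (arrays s' (aBASE j)) (arrays s' (aTAB j))" for i and s' :: state
  have upd: "PP (Suc i) N B (T(B (inp p) + inp (p + 2) := p))"
    if PP: "PP i N B T" and p: "p = st j + 5 * i" "p \<in> rows j" and B: "B (inp p) \<noteq> 0" for i N B T p
  proof -
    have y: "inp (p + 2) < K" using K(4) p(2) .
    have m: "max_or_0 (insert p (S i x y)) = p" for x y
      using lS[of _ i x y] by (intro max_or_0_insert_above) (auto simp: p(1))
    \<comment> \<open>Blocks are disjoint, so a write cannot hit the cell of a different value in
      column 0.\<close>
    have ne: "B x + y \<noteq> B (inp p) + inp (p + 2)" if "y < K" "B x \<noteq> 0" "x \<noteq> inp p" for x y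
    proof -
      have "B x + K \<le> B (inp p) \<or> B (inp p) + K \<le> B x"
        using PP B that unfolding PP_def by blast
      then show ?thesis using y that by linarith
    qed
    have "K \<le> B (inp p)" "B (inp p) + K \<le> N" using PP B unfolding PP_def by auto
    moreover have "(T(B (inp p) + inp (p + 2) := p)) (B x + y) = max_or_0 (S (Suc i) x y)"
      if "y < K" "B x \<noteq> 0" for x y
    proof (cases "x = inp p \<and> y = inp (p + 2)")
      case True
      then show ?thesis unfolding SS p(1)[symmetric] by (simp add: m del: Max_insert)
    next
      case False
      then have "B x + y \<noteq> B (inp p) + inp (p + 2)" using ne that by (cases "x = inp p") auto
      moreover have "S (Suc i) x y = S i x y" using False unfolding SS p(1)[symmetric] by auto
      ultimately show ?thesis using PP that unfolding PP_def by simp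
    qed
    moreover have "(T(B (inp p) + inp (p + 2) := p)) z = 0" if "z < K \<or> N \<le> z" for z
    proof -
      have "z \<noteq> B (inp p) + inp (p + 2)"
        using that y \<open>K \<le> B (inp p)\<close> \<open>B (inp p) + K \<le> N\<close> by linarith
      then show ?thesis using PP that unfolding PP_def by auto
    qed
    ultimately show ?thesis using PP B unfolding PP_def rows_upto_Suc p(1)[symmetric]
      by auto
  qed
  \<comment> \<open>Opening a block leaves the number of treated rows alone: a value with base 0 has
    not occurred so far, and the fresh zero cells already represent its empty entries.\<close>
  have alloc: "PP i (N + K) (B(x := N)) T" if PP: "PP i N B T" and B: "B x = 0" for i N B T x
  proof -
    have "\<forall>p\<in>rows_upto j i. inp p \<noteq> x" using PP B unfolding PP_def by simp
    then have "S i x y = {}" for y unfolding S_def by blast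
    moreover have "K \<le> N" "0 < N" using K PP unfolding PP_def by simp_all
    ultimately have e: "T (N + y) = max_or_0 (S i x y)" for y
      using PP unfolding PP_def by simp
    note PP' = PP[unfolded PP_def]
    show ?thesis unfolding PP_def
    proof (intro conjI allI impI)
      fix x1 x2 assume *: "x1 \<noteq> x2" "(B(x := N)) x1 \<noteq> 0" "(B(x := N)) x2 \<noteq> 0"
      have le: "B y + K \<le> N" if "B y \<noteq> 0" for y using PP' that by simp
      consider "x1 = x" | "x2 = x" | "x1 \<noteq> x" "x2 \<noteq> x" by blast
      then show "(B(x := N)) x1 + K \<le> (B(x := N)) x2 \<or> (B(x := N)) x2 + K \<le> (B(x := N)) x1"
      proof cases
        case 3
        then show ?thesis using PP' * by simp
      qed (use * le in auto)
    next
      fix x1 assume "(B(x := N)) x1 \<noteq> 0"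
      then have "K \<le> B x1 \<and> B x1 + K \<le> N" if "x1 \<noteq> x" using PP' that by simp
      with \<open>K \<le> N\<close> show "K \<le> (B(x := N)) x1" "(B(x := N)) x1 + K \<le> N + K"
        by (cases "x1 = x"; auto)+
    next
      fix z assume "z < K \<or> N + K \<le> z"
      then show "T z = 0" using PP' by auto
    next
      fix x1 y assume *: "y < K" "(B(x := N)) x1 \<noteq> 0"
      then show "T ((B(x := N)) x1 + y) = max_or_0 (S i x1 y)"
        using PP' e by (cases "x1 = x") (simp_all del: Max_insert)
    next
      fix x1 assume *: "(B(x := N)) x1 = 0"
      then have "x1 \<noteq> x" using \<open>0 < N\<close> by auto
      with * show "\<forall>p\<in>rows_upto j i. inp p \<noteq> x1" using PP' by simp
    qed (use PP' in simp)
  qed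
  have upd_alloc: "PP (Suc i) (N + K) (B(inp p := N)) (T(N + inp (p + 2) := p))"
    if "PP i N B T" "p = st j + 5 * i" "p \<in> rows j" "B (inp p) = 0" "0 < N" for i N B T p
    using upd[OF alloc[OF that(1,4)] that(2,3)] that(5) by simp
  have "wp (tab_pass j) (\<lambda>t' s'. t' \<le> t + 6 + (\<Sum>p\<in>rows j. 50 + 8) \<and> P (n j) s' \<and>
     unchanged {aBASE j, aTAB j} {RX j, RNX} s s') t s"
    unfolding tab_pass_def
  proof (rule pass)
    fix i t s'
    assume i: "i < n j" "P i s'" "regs s' (RX j) = st j + 5 * i" "arrays s' 0 = inp" "st j + 5 * i \<in> rows j"
      "unchanged {aBASE j, aTAB j} {RX j, RNX} s s'"
    define p where "p = st j + 5 * i"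
    have K': "regs s' RK = K" using i(6) K(1) by (simp add: unchanged_def)
    have "0 < regs s' RNX" using K i(2) unfolding P_def PP_def by auto
    then show "wp (tab_body j)
       (\<lambda>t' s''. t' \<le> t + 50 \<and> P (Suc i) s'' \<and> unchanged {aBASE j, aTAB j} {RX j, RNX} s' s'' \<and>
          regs s'' (RX j) = st j + 5 * i) t s'"
      using i(2-5) upd[OF _ p_def] upd_alloc[OF _ p_def] K' unfolding P_def p_def[symmetric]
      by (auto simp: unchanged_def)
  qed (use assms in \<open>auto simp: P_def PP_def regs_of_kind_def S_def\<close>)
  moreover have "lookup_ok s' K j \<and> regs s RNX \<le> regs s' RNX" if P: "P (n j) s'" for s'
  proof -
    have "arrays s' (aTAB j) (arrays s' (aBASE j) x + y) =
      max_or_0 {p \<in> rows j. inp p = x \<and> inp (p + 2) = y}" if "y < K" for x y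
    proof (cases "arrays s' (aBASE j) x = 0")
      case True
      then have "{p \<in> rows j. inp p = x \<and> inp (p + 2) = y} = {}"
        using P unfolding P_def PP_def rows_def by blast
      moreover have "arrays s' (aTAB j) y = 0" using P that unfolding P_def PP_def by simp
      ultimately show ?thesis using True by (simp only: add_0) simp
    next
      case False
      then show ?thesis using P that unfolding P_def PP_def S_def rows_def by blast
    qed
    then show ?thesis using P by (auto simp: lookup_ok_def P_def PP_def)
  qed
  ultimately show ?thesis by (auto simp: card_rows mult.commute elim!: wp_mono)
qed

end

section \<open>Enumerating the triangles\<close>

text \<open>This avoids duplicates: a triangle is reported only for its first relation with a light
  row, or in the final pass if all its rows are heavy.\<close>

primrec earlier_heavy :: "nat \<Rightarrow> test" where
  "earlier_heavy 0 = Equal (Const 0) (Const 0)"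
| "earlier_heavy (Suc m) = Conj (earlier_heavy m) (heavy_test m)"

text \<open>The variables in increasing order: two blocks are read from relation 0, the third from
  columns 2 and 3 of relation 1, and the private ones come last.\<close>

definition emit :: program where
  "emit = Seq (Emit (cell 0 0)) (Seq (Emit (cell 0 1)) (Seq (Emit (cell 0 2)) (Seq (Emit (cell 0 3))
     (Seq (Emit (cell 1 2)) (Seq (Emit (cell 1 3)) (Seq (Emit (cell 0 4)) (Seq (Emit (cell 1 4))
     (Emit (cell 2 4)))))))))"

text \<open>The lookup already fixes columns 0 and 2 of the third row, so only its columns 1 and 3
  are compared; address 0 means that there is no such row. The test \<open>F\<close> comes after the
  lookup because it may inspect the third row.\<close>

definition check_pair :: "nat \<Rightarrow> test \<Rightarrow> program" where
  "check_pair i F = (let i1 = (i + 1) mod 3; i2 = (i + 2) mod 3 in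
     Cond (Conj (Equal (cell i 2) (cell i1 0)) (Equal (cell i 3) (cell i1 1)))
       (Seq (Assign (RX i2) (Fetch (aTAB i2) (Plus (Fetch (aBASE i2) (cell i1 2)) (cell i 0))))
            (Cond (Conj (Neg (Equal (Reg (RX i2)) (Const 0)))
                    (Conj (Equal (cell i2 1) (cell i1 3)) (Conj (Equal (cell i2 3) (cell i 1)) F)))
               emit Skip))
       Skip)"

text \<open>Columns 0 and 1 are shared with the cyclically preceding relation, columns 2 and 3 with
  the following one; this decides which of the two comes first in the pair to be checked.\<close>

abbreviation enum_body :: "nat \<Rightarrow> nat \<Rightarrow> program" where
  "enum_body j k \<equiv>
     Cond (Conj (Neg (heavy_test j)) (Equal (Fetch (aSEL j) (Reg (RX j))) (Const (Suc k))))
        (Seq (Assign (RX (nb_rel j k)) (Fetch (aHEAD (nb_rel j k) (nb_col k)) (cell j k)))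
             (chain_loop (aNEXT (nb_rel j k) (nb_col k)) (RX (nb_rel j k))
                (check_pair (if k < 2 then nb_rel j k else j) (earlier_heavy j))))
        Skip"

definition enum_pass :: "nat \<Rightarrow> nat \<Rightarrow> program" where
  "enum_pass j k = for_rows j (enum_body j k)"

definition final_pass :: program where
  "final_pass =
     Seq (Assign (RX 0) (Reg (RHH 0)))
         (chain_loop (aHN 0) (RX 0)
            (Seq (Assign (RX 1) (Reg (RHH 1)))
                 (chain_loop (aHN 1) (RX 1) (check_pair 0 (earlier_heavy 3)))))"

lemma earlier_heavy_cost: "test_cost (earlier_heavy m) = 3 + 8 * m"
  by (induction m) auto

lemma earlier_heavy_val: "test_val (earlier_heavy m) s \<longleftrightarrow> (\<forall>j<m. arrays s (aHV j) (arrays s 0 (regs s (RX j) + 4)) = regs s (RX j))"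
  by (induction m) (auto simp: less_Suc_eq)

lemma all_less_3: "(\<forall>j<3. P j) \<longleftrightarrow> P 0 \<and> P 1 \<and> P (2::nat)"
  by (auto simp: less_Suc_eq numeral_3_eq_3 numeral_2_eq_2)

lemma less_3: "(i::nat) < 3 \<longleftrightarrow> i = 0 \<or> i = 1 \<or> i = 2"
  by auto

section \<open>Triangles of rows and their output\<close>

context layout
begin

definition agree :: "nat \<Rightarrow> nat \<Rightarrow> bool" where
  "agree x y \<longleftrightarrow> inp (x + 2) = inp y \<and> inp (x + 3) = inp (y + 1)"

text \<open>
  A triangle is given by the addresses of its three rows, padded with zeros to a function on all numbers.
\<close>

definition triangles :: "(nat \<Rightarrow> nat) set" where
  "triangles = {\<tau>. (\<forall>j<3. \<tau> j \<in> rows j \<and> agree (\<tau> j) (\<tau> ((j + 1) mod 3))) \<and> (\<forall>j\<ge>3. \<tau> j = 0)}"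

definition output_row :: "(nat \<Rightarrow> nat) \<Rightarrow> nat list" where
  "output_row \<tau> = map (\<lambda>(j, k). inp (\<tau> j + k))
     [(0,0), (0,1), (0,2), (0,3), (1,2), (1,3), (0,4), (1,4), (2,4)]"

definition has_output :: "state \<Rightarrow> (nat \<Rightarrow> nat) set \<Rightarrow> bool" where
  "has_output s D \<longleftrightarrow> (\<exists>ts. distinct ts \<and> set ts = D \<and> out s = concat (map output_row ts))"

lemma output_row_cong: "(\<And>j. j < 3 \<Longrightarrow> \<sigma> j = \<tau> j) \<Longrightarrow> output_row \<sigma> = output_row \<tau>"
  by (simp add: output_row_def)

lemma has_output_cong: "has_output s D \<Longrightarrow> out s' = out s \<Longrightarrow> has_output s' D"
  by (simp add: has_output_def)

lemma has_output_insert: "has_output s D \<Longrightarrow> \<tau> \<notin> D \<Longrightarrow> out s' = out s @ output_row \<tau> \<Longrightarrow> has_output s' (insert \<tau> D)"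
  unfolding has_output_def
proof (elim exE conjE)
  fix ts assume "\<tau> \<notin> D" "out s' = out s @ output_row \<tau>" "distinct ts" "set ts = D" "out s = concat (map output_row ts)"
  then show "\<exists>ts. distinct ts \<and> set ts = insert \<tau> D \<and> out s' = concat (map output_row ts)"
    by (intro exI[of _ "ts @ [\<tau>]"]) auto
qed

text \<open>Triangles are invariant under rotation of the three relations, so a single treatment
  covers all pairs of consecutive relations.\<close>

lemma triangles_iff:
  assumes "i < 3"
  shows "\<tau> \<in> triangles \<longleftrightarrow> \<tau> i \<in> rows i \<and> \<tau> ((i + 1) mod 3) \<in> rows ((i + 1) mod 3) \<and> \<tau> ((i + 2) mod 3) \<in> rows ((i + 2) mod 3) \<and>
     agree (\<tau> i) (\<tau> ((i + 1) mod 3)) \<and> agree (\<tau> ((i + 1) mod 3)) (\<tau> ((i + 2) mod 3)) \<and>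
     agree (\<tau> ((i + 2) mod 3)) (\<tau> i) \<and> (\<forall>j\<ge>3. \<tau> j = 0)"
proof -
  have eq: "((0::nat) + 1) mod 3 = 1" "((0::nat) + 2) mod 3 = 2" "((1::nat) + 1) mod 3 = 2" "((1::nat) + 2) mod 3 = 0"
    "((2::nat) + 1) mod 3 = 0" "((2::nat) + 2) mod 3 = 1" by simp_all
  show ?thesis
    using assms[unfolded less_3] unfolding triangles_def mem_Collect_eq all_less_3
    by (elim disjE; hypsubst; unfold eq; iprover)
qed

lemma rotation_cases: "i < 3 \<Longrightarrow> j < 3 \<Longrightarrow> j = i \<or> j = (i + 1) mod 3 \<or> j = (i + 2) mod (3::nat)"
  unfolding less_3 by (elim disjE) simp_all

lemma wp_emit:
  assumes "arrays s 0 = inp"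
  shows "wp emit Q t s \<longleftrightarrow> Q (t + 45) (s\<lparr>out := out s @ output_row (\<lambda>j. regs s (RX j))\<rparr>)"
  using assms by (simp add: emit_def output_row_def numeral_eq_Suc)

end

text \<open>\<open>s0\<close> is the state between preprocessing and enumeration. The enumeration
  writes no array, so all facts about the tables are stated once, for \<open>s0\<close>.\<close>

locale tables = layout +
  fixes s0 :: state and K :: nat
  assumes layout_ok: "layout_ok s0"
    and lookup_ok: "j < 3 \<Longrightarrow> lookup_ok s0 K j"
    and below_K: "j < 3 \<Longrightarrow> p \<in> rows j \<Longrightarrow> inp p < K"
    and key: "j < 3 \<Longrightarrow> p \<in> rows j \<Longrightarrow> q \<in> rows j \<Longrightarrow> inp p = inp q \<Longrightarrow> inp (p + 2) = inp (q + 2) \<Longrightarrow> p = q"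
    and chained: "j < 3 \<Longrightarrow> k < 4 \<Longrightarrow> chained s0 j k"
    and SEL: "j < 3 \<Longrightarrow> p \<in> rows j \<Longrightarrow> selected s0 j 4 p"
    and heavy_found: "j < 3 \<Longrightarrow> heavy_found s0 j"
    and heavy_listed: "j < 2 \<Longrightarrow> heavy_listed s0 j"
    and out0: "out s0 = []"
begin

definition heavy :: "nat \<Rightarrow> nat \<Rightarrow> bool" where
  "heavy j p \<longleftrightarrow> arrays s0 (aHV j) (inp (p + 4)) = p"

definition good :: "state \<Rightarrow> bool" where
  "good s \<longleftrightarrow> arrays s = arrays s0 \<and> (\<forall>r. (\<forall>j. r \<noteq> RX j) \<longrightarrow> regs s r = regs s0 r)"

text \<open>By the key on columns 0 and 2, two rows lie in at most one triangle, so \<open>N\<close>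
  is empty or a singleton and constant time suffices.\<close>

lemma wp_check_pair:
  assumes i: "i < 3" and s: "good s"
    and x: "regs s (RX i) = x" "x \<in> rows i"
    and y: "regs s (RX ((i + 1) mod 3)) = y" "y \<in> rows ((i + 1) mod 3)"
    and D: "has_output s D" "D \<inter> N = {}"
    and m: "m \<le> 3"
    and N: "N = {\<tau> \<in> triangles. \<tau> i = x \<and> \<tau> ((i + 1) mod 3) = y \<and> (\<forall>j<m. heavy j (\<tau> j))}"
  shows "wp (check_pair i (earlier_heavy m)) (\<lambda>t' s'. t' \<le> t + 200 \<and> has_output s' (D \<union> N) \<and> good s' \<and>
     regs s' (RX i) = x \<and> regs s' (RX ((i + 1) mod 3)) = y) t s"
proof -
  define i1 i2 where "i1 = (i + 1) mod 3" and "i2 = (i + 2) mod 3"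
  have ne: "i1 \<noteq> i" "i2 \<noteq> i" "i2 \<noteq> i1" "i \<noteq> i1" "i \<noteq> i2" "i1 \<noteq> i2" "i1 < 3" "i2 < 3"
    using i unfolding less_3 by (auto simp: i1_def i2_def simp flip: numeral_2_eq_2)
  have arr: "arrays s = arrays s0" "arrays s0 0 = inp" using s layout_ok by (auto simp: good_def layout_ok_def)
  note triangles = triangles_iff[OF i, folded i1_def i2_def]
  define W where "W = {p \<in> rows i2. inp p = inp (y + 2) \<and> inp (p + 2) = inp x}"
  define w where "w = arrays s0 (aTAB i2) (arrays s0 (aBASE i2) (inp (y + 2)) + inp x)"
  have w_eq: "arrays s0 (aTAB i2) (arrays s0 (aBASE i2) (inp (Suc (Suc y))) + inp x) = w"
    by (simp add: w_def)
  have w: "w = max_or_0 W" unfolding w_def W_def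
    using lookup_ok[OF ne(8)] below_K[OF i x(2)] by (simp add: lookup_ok_def)
  have uniq: "p = q" if "p \<in> W" "q \<in> W" for p q using key[OF ne(8)] that by (auto simp: W_def)
  have fin: "finite W" by (simp add: W_def)
  have wW: "w \<in> W" if "w \<noteq> 0" using w that fin by (metis Max_in finite_insert insertE insert_not_empty)
  have ww: "w = p" if "p \<in> W" for p
  proof -
    have "W = {p}" using uniq that by blast
    then show ?thesis by (simp add: w)
  qed
  \<comment> \<open>The only candidate for a member of \<open>N\<close>; it is a triangle exactly
    under the conditions that the program tests.\<close>
  define \<tau> where "\<tau> j = (if j = i then x else if j = i1 then y else if j = i2 then w else 0)" for j
  have tau: "\<tau> i = x" "\<tau> i1 = y" "\<tau> i2 = w" using ne by (auto simp: \<tau>_def)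
  have tau0: "\<forall>j\<ge>3. \<tau> j = 0" using ne i by (auto simp: \<tau>_def)
  let ?c = "agree x y \<and> w \<noteq> 0 \<and> inp (w + 1) = inp (y + 3) \<and> inp (w + 3) = inp (x + 1) \<and> (\<forall>j<m. heavy j (\<tau> j))"
  have Ne: "N = (if ?c then {\<tau>} else {})"
  proof -
    have 1: "\<sigma> = \<tau> \<and> ?c" if "\<sigma> \<in> N" for \<sigma>
    proof -
      have \<sigma>: "\<sigma> \<in> triangles" "\<sigma> i = x" "\<sigma> i1 = y" "\<forall>j<m. heavy j (\<sigma> j)" using that by (auto simp: N i1_def)
      then have *: "\<sigma> i2 \<in> W" "agree x y" "agree y (\<sigma> i2)" "agree (\<sigma> i2) x"
        by (auto simp: triangles W_def agree_def)
      then have "w = \<sigma> i2" using ww by simp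
      moreover have "w \<noteq> 0" using * \<open>w = \<sigma> i2\<close> by (auto simp: W_def dest: rows_pos)
      moreover have "\<sigma> = \<tau>"
      proof
        fix j
        have "j \<ge> 3 \<or> j = i \<or> j = i1 \<or> j = i2"
          using rotation_cases[OF i, of j] unfolding i1_def i2_def by linarith
        then show "\<sigma> j = \<tau> j" using \<sigma> tau tau0 \<open>w = \<sigma> i2\<close> by (auto simp: triangles)
      qed
      ultimately show ?thesis using * \<sigma>(4) by (auto simp: agree_def)
    qed
    have 2: "\<tau> \<in> N" if ?c
    proof -
      have "\<tau> \<in> triangles" unfolding triangles using that tau tau0 wW x y
        by (auto simp: W_def agree_def i1_def)
      then show ?thesis using that tau by (auto simp: N i1_def)
    qed
    show ?thesis using 1 2 by auto
  qed
  have tau_regs: "((regs s)(RX i2 := w)) (RX j) = \<tau> j" if "j < 3" for j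
  proof -
    have "j = i \<or> j = i1 \<or> j = i2"
      using rotation_cases[OF i that] unfolding i1_def i2_def .
    then show ?thesis using x y ne by (auto simp: \<tau>_def i1_def)
  qed
  have output_row: "output_row (\<lambda>j. ((regs s)(RX i2 := w)) (RX j)) = output_row \<tau>"
    by (intro output_row_cong tau_regs)
  have F: "(\<forall>j<m. arrays s0 (aHV j) (inp (((regs s)(RX i2 := w)) (RX j) + 4)) = ((regs s)(RX i2 := w)) (RX j)) \<longleftrightarrow>
      (\<forall>j<m. heavy j (\<tau> j))"
    using m tau_regs by (simp add: heavy_def)
  let ?s = "s\<lparr>regs := (regs s)(RX i2 := w)\<rparr>"
  let ?P = "\<lambda>t' s'. t' \<le> t + 200 \<and> has_output s' (D \<union> N) \<and> good s' \<and> regs s' (RX i) = x \<and> regs s' (RX i1) = y"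
  have g: "good ?s" using s by (auto simp: good_def)
  have x1: "regs s (RX i) = x" "regs s (RX i1) = y" using x y by (auto simp: i1_def)
  have cost: "test_cost (earlier_heavy m) \<le> 27" using m by (simp add: earlier_heavy_cost)
  have output_row': "wp emit ?P t' ?s" if ?c "t' \<le> t + 100" for t'
  proof -
    have "has_output (?s\<lparr>out := out ?s @ output_row (\<lambda>j. regs ?s (RX j))\<rparr>) (insert \<tau> D)"
      using D Ne that by (intro has_output_insert[of s]) (auto simp: output_row simp del: fun_upd_apply)
    then show ?thesis using that Ne arr g x1 ne by (subst wp_emit) (auto simp: good_def)
  qed
  have sk: "has_output s (D \<union> N) \<and> has_output ?s (D \<union> N)" if "\<not> ?c"
    using that Ne D by (auto intro: has_output_cong)
  show ?thesis
  proof (cases "agree x y")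
    case True
    have "wp (check_pair i (earlier_heavy m)) ?P t s"
      unfolding check_pair_def Let_def i1_def[symmetric] i2_def[symmetric]
      using True x1 arr ne output_row' sk g cost F
      by (simp add: agree_def w_eq earlier_heavy_val)
    then show ?thesis by (simp add: i1_def)
  next
    case False
    have "wp (check_pair i (earlier_heavy m)) ?P t s"
      unfolding check_pair_def Let_def i1_def[symmetric] i2_def[symmetric]
      using False x1 arr ne s sk
      by (auto simp: agree_def)
    then show ?thesis by (simp add: i1_def)
  qed
qed

lemma good_upd: "good s \<Longrightarrow> good (s\<lparr>regs := (regs s)(RX j := v)\<rparr>)"
  by (simp add: good_def)

lemma good_layout_ok: "good s \<Longrightarrow> layout_ok s"
  using layout_ok by (simp add: good_def layout_ok_def)

text \<open>\<open>E\<close> collects the triangles whose first light row lies in relation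
  \<open>j\<close> and has selected column \<open>k\<close>. A row of the traversed list costs 200
  for the check of the pair and 8 for the traversal.\<close>

lemma wp_enum_pass:
  assumes j: "j < 3" "k < 4" and s: "good s" and D: "has_output s D" "D \<inter> E = {}"
    and E: "E = {\<tau> \<in> triangles. (\<forall>i<j. heavy i (\<tau> i)) \<and> \<not> heavy j (\<tau> j) \<and> arrays s0 (aSEL j) (\<tau> j) = Suc k}"
  shows "wp (enum_pass j k) (\<lambda>t' s'. t' \<le> t + 6 + (\<Sum>p\<in>rows j. 40 +
      (if \<not> heavy j p \<and> arrays s0 (aSEL j) p = Suc k then 208 * nb_count j k p else 0)) \<and>
     has_output s' (D \<union> E) \<and> good s') t s"
proof -
  define j' k' where "j' = nb_rel j k" and "k' = nb_col k"
  define i where "i = (if k < 2 then j' else j)"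
  define o' where "o' = (if k < 2 then j else j')"
  define c where "c p \<longleftrightarrow> \<not> heavy j p \<and> arrays s0 (aSEL j) p = Suc k" for p
  have j': "j' < 3" "k' < 4" "j' \<noteq> j" "i < 3" and o': "o' = (i + 1) mod 3"
    using j unfolding less_3 j'_def nb_rel_def k'_def nb_col_def i_def o'_def by auto
  have inp0: "arrays s0 0 = inp" using layout_ok by (simp add: layout_ok_def)
  define Inv where "Inv i s' \<longleftrightarrow> good s' \<and> has_output s' (D \<union> {\<tau> \<in> E. \<tau> j \<in> rows_upto j i})" for i s'
  have "wp (enum_pass j k) (\<lambda>t' s'. t' \<le> t + 6 + (\<Sum>i<n j. 32 +
      (if c (st j + 5 * i) then 208 * nb_count j k (st j + 5 * i) else 0) + 8) \<and> Inv (n j) s') t s"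
    unfolding enum_pass_def
  proof (rule wp_for_rows)
    fix l t s' assume l: "l < n j" "Inv l s'" "regs s' (RX j) = st j + 5 * l"
    define p where "p = st j + 5 * l"
    have p: "p \<in> rows j" "p \<notin> rows_upto j l" using l by (auto simp: p_def rows_upto_rows dest: rows_upto_less)
    have g: "good s'" "has_output s' (D \<union> {\<tau> \<in> E. \<tau> j \<in> rows_upto j l})" using l(2) by (auto simp: Inv_def)
    have arr: "arrays s' = arrays s0" using g by (simp add: good_def)
    have split: "D \<union> {\<tau> \<in> E. \<tau> j \<in> rows_upto j (Suc l)} = D \<union> {\<tau> \<in> E. \<tau> j \<in> rows_upto j l} \<union> {\<tau> \<in> E. \<tau> j = p}"
      by (auto simp: rows_upto_Suc p_def)
    define S where "S = col_rows j' k' (inp (p + k))"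
    have cS: "nb_count j k p = card S" by (simp add: nb_count_def S_def j'_def k'_def)
    define G where "G C = {\<tau> \<in> triangles. (\<forall>i<j. heavy i (\<tau> i)) \<and> \<tau> j = p \<and> \<tau> j' \<in> C}" for C
    define s1 where "s1 = s'\<lparr>regs := (regs s')(RX j' := max_or_0 S)\<rparr>"
    have loop: "wp (chain_loop (aNEXT j' k') (RX j') (check_pair i (earlier_heavy j)))
       (\<lambda>t' s''. t' \<le> t1 + 5 + (\<Sum>q\<in>S. 200 + 8) \<and> Inv (Suc l) s'' \<and> regs s'' (RX j) = p) t1 s1"
      if c: "c p" for t1
    proof (rule wp_mono, rule wp_chain_loop[where S = S and f = "\<lambda>_. 200" and
          Inv = "\<lambda>C s''. good s'' \<and> regs s'' (RX j) = p \<and> has_output s'' (D \<union> {\<tau> \<in> E. \<tau> j \<in> rows_upto j l} \<union> G C)"])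
      show "finite S" "0 \<notin> S" by (auto simp: S_def col_rows_def dest: rows_pos)
      show "regs s1 (RX j') = max_or_0 S" by (simp add: s1_def)
      show "good s1 \<and> regs s1 (RX j) = p \<and> has_output s1 (D \<union> {\<tau> \<in> E. \<tau> j \<in> rows_upto j l} \<union> G {})"
        using g l(3) j' by (auto simp: s1_def good_upd G_def p_def intro: has_output_cong)
    next
      fix C s'' v
      assume *: "good s'' \<and> regs s'' (RX j) = p \<and> has_output s'' (D \<union> {\<tau> \<in> E. \<tau> j \<in> rows_upto j l} \<union> G C)"
      then show "good (s''\<lparr>regs := (regs s'')(RX j' := v)\<rparr>) \<and>
          regs (s''\<lparr>regs := (regs s'')(RX j' := v)\<rparr>) (RX j) = p \<and>
          has_output (s''\<lparr>regs := (regs s'')(RX j' := v)\<rparr>) (D \<union> {\<tau> \<in> E. \<tau> j \<in> rows_upto j l} \<union> G C)"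
        using j' by (auto simp: good_upd intro: has_output_cong)
      fix q assume "q \<in> S"
      then show "arrays s'' (aNEXT j' k') q = max_or_0 {r \<in> S. r < q}"
        using chained[OF j'(1,2)] * by (auto simp: S_def chained_def good_def col_rows_def)
    next
      fix q C t2 s2
      assume q: "q \<in> S" "q \<notin> C" "C \<subseteq> S"
        and *: "good s2 \<and> regs s2 (RX j) = p \<and> has_output s2 (D \<union> {\<tau> \<in> E. \<tau> j \<in> rows_upto j l} \<union> G C)"
        and r: "regs s2 (RX j') = q"
      define x where "x = (if k < 2 then q else p)"
      define y where "y = (if k < 2 then p else q)"
      have q': "q \<in> rows j'" using q by (auto simp: S_def col_rows_def)
      have N: "{\<tau> \<in> triangles. \<tau> i = x \<and> \<tau> ((i + 1) mod 3) = y \<and> (\<forall>i<j. heavy i (\<tau> i))} =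
         {\<tau> \<in> triangles. \<tau> j = p \<and> \<tau> j' = q \<and> (\<forall>i<j. heavy i (\<tau> i))}"
        unfolding o'[symmetric] by (auto simp: i_def o'_def x_def y_def)
      have G: "G (insert q C) = G C \<union> {\<tau> \<in> triangles. \<tau> j = p \<and> \<tau> j' = q \<and> (\<forall>i<j. heavy i (\<tau> i))}"
        by (auto simp: G_def)
      have disj: "(D \<union> {\<tau> \<in> E. \<tau> j \<in> rows_upto j l} \<union> G C) \<inter>
          {\<tau> \<in> triangles. \<tau> j = p \<and> \<tau> j' = q \<and> (\<forall>i<j. heavy i (\<tau> i))} = {}"
        using D(2) p(2) q(2) c by (auto simp: E G_def c_def)
      have "wp (check_pair i (earlier_heavy j)) (\<lambda>t' s'. t' \<le> t2 + 200 \<and>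
          has_output s' (D \<union> {\<tau> \<in> E. \<tau> j \<in> rows_upto j l} \<union> G C \<union>
             {\<tau> \<in> triangles. \<tau> i = x \<and> \<tau> ((i + 1) mod 3) = y \<and> (\<forall>i<j. heavy i (\<tau> i))}) \<and> good s' \<and>
          regs s' (RX i) = x \<and> regs s' (RX ((i + 1) mod 3)) = y) t2 s2"
      proof (rule wp_check_pair[OF j'(4)])
        show "regs s2 (RX i) = x" "x \<in> rows i" "regs s2 (RX ((i + 1) mod 3)) = y" "y \<in> rows ((i + 1) mod 3)"
          unfolding o'[symmetric] using * r p q' by (auto simp: i_def o'_def x_def y_def)
        show "(D \<union> {\<tau> \<in> E. \<tau> j \<in> rows_upto j l} \<union> G C) \<inter>
            {\<tau> \<in> triangles. \<tau> i = x \<and> \<tau> ((i + 1) mod 3) = y \<and> (\<forall>i<j. heavy i (\<tau> i))} = {}"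
          unfolding N by (rule disj)
      qed (use * j in auto)
      then show "wp (check_pair i (earlier_heavy j)) (\<lambda>t' s''. t' \<le> t2 + 200 \<and>
          (good s'' \<and> regs s'' (RX j) = p \<and> has_output s'' (D \<union> {\<tau> \<in> E. \<tau> j \<in> rows_upto j l} \<union> G (insert q C))) \<and>
          regs s'' (RX j') = q) t2 s2"
        unfolding N unfolding o'[symmetric]
        by (rule wp_mono) (auto simp: G Un_assoc i_def o'_def x_def y_def split: if_splits)
    next
      fix t' s2
      assume *: "t' \<le> t1 + 5 + (\<Sum>q\<in>S. 200 + 8) \<and>
         good s2 \<and> regs s2 (RX j) = p \<and> has_output s2 (D \<union> {\<tau> \<in> E. \<tau> j \<in> rows_upto j l} \<union> G S)"
      \<comment> \<open>Agreement in a block includes agreement in column \<open>k\<close>, so the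
        list of \<open>p\<close> meets every triangle through \<open>p\<close>.\<close>
      have "\<tau> j' \<in> S" if "\<tau> \<in> triangles" "\<tau> j = p" for \<tau>
      proof -
        have "\<tau> j' \<in> rows j'" using that j' by (auto simp: triangles_def)
        moreover have "agree (\<tau> i) (\<tau> o')" using that j'(4) o' by (auto simp: triangles_def)
        moreover have "k = 0 \<or> k = 1 \<or> k = 2 \<or> k = 3" using j(2) by auto
        ultimately show ?thesis using that unfolding S_def col_rows_def k'_def nb_col_def agree_def i_def o'_def
          by (auto simp: numeral_3_eq_3)
      qed
      then have "G S = {\<tau> \<in> E. \<tau> j = p}" using c by (auto simp: G_def E c_def)
      then show "t' \<le> t1 + 5 + (\<Sum>q\<in>S. 200 + 8) \<and> Inv (Suc l) s2 \<and> regs s2 (RX j) = p"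
        using * by (simp add: Inv_def split)
    qed
    have no: "{\<tau> \<in> E. \<tau> j = p} = {}" if "\<not> c p" using that by (auto simp: E c_def)
    have hd: "arrays s0 (aHEAD j' k') (inp (p + k)) = max_or_0 S"
      using chained[OF j'(1,2)] by (simp add: chained_def S_def)
    let ?P = "\<lambda>t' s''. t' \<le> t + (32 + (if c p then 208 * nb_count j k p else 0)) \<and> Inv (Suc l) s'' \<and> regs s'' (RX j) = p"
    show "wp (enum_body j k) (\<lambda>t' s''. t' \<le> t + (32 + (if c (st j + 5 * l) then 208 * nb_count j k (st j + 5 * l) else 0)) \<and>
           Inv (Suc l) s'' \<and> regs s'' (RX j) = st j + 5 * l) t s'"
    proof (cases "c p")
      case True
      have "wp (chain_loop (aNEXT j' k') (RX j') (check_pair i (earlier_heavy j))) ?P t1 s1" if "t1 \<le> t + 20" for t1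
        by (rule wp_mono[OF loop[OF True]]) (use True cS that in auto)
      then show ?thesis
        unfolding p_def[symmetric] j'_def[symmetric] k'_def[symmetric] i_def[symmetric]
        using True l(3) arr inp0 hd by (simp add: c_def heavy_def p_def s1_def)
    next
      case False
      have "Inv (Suc l) s'" using g unfolding Inv_def split no[OF False] by simp
      then show ?thesis
        unfolding p_def[symmetric] j'_def[symmetric] k'_def[symmetric] i_def[symmetric]
        using False l(3) arr inp0 by (auto simp: c_def heavy_def p_def)
    qed
  next
    show "regs s (RST j) = st j" using good_layout_ok[OF s] j by (simp add: layout_ok_def)
    show "Inv 0 s" using s D by (simp add: Inv_def)
    show "Inv i (s'\<lparr>regs := (regs s')(RX j := v)\<rparr>)" if "Inv i s'" for i s' v
      using that by (auto simp: Inv_def good_upd intro: has_output_cong)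
    show "regs s' (REN j) = st j + 5 * n j" if "Inv i s'" for i s'
      using that good_layout_ok j by (simp add: Inv_def layout_ok_def)
  qed
  then show ?thesis
  proof (rule wp_mono)
    fix t' s' assume *: "t' \<le> t + 6 + (\<Sum>i<n j. 32 +
      (if c (st j + 5 * i) then 208 * nb_count j k (st j + 5 * i) else 0) + 8) \<and> Inv (n j) s'"
    have "{\<tau> \<in> E. \<tau> j \<in> rows_upto j (n j)} = E" using j by (auto simp: E triangles_def rows_def)
    moreover have "(\<Sum>i<n j. 32 + (if c (st j + 5 * i) then 208 * nb_count j k (st j + 5 * i) else 0) + 8) =
       (\<Sum>p\<in>rows j. 40 + (if \<not> heavy j p \<and> arrays s0 (aSEL j) p = Suc k then 208 * nb_count j k p else 0))"
      unfolding sum_rows[of "\<lambda>p. 32 + (if c p then 208 * nb_count j k p else 0) + 8"] by (simp add: c_def)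
    ultimately show "t' \<le> t + 6 + (\<Sum>p\<in>rows j. 40 +
      (if \<not> heavy j p \<and> arrays s0 (aSEL j) p = Suc k then 208 * nb_count j k p else 0)) \<and>
     has_output s' (D \<union> E) \<and> good s'" using * by (simp add: Inv_def)
  qed
qed

lemma wp_final_pass:
  assumes s: "good s" and D: "has_output s D" "D \<inter> E = {}"
    and E: "E = {\<tau> \<in> triangles. \<forall>i<3. heavy i (\<tau> i)}"
  shows "wp final_pass (\<lambda>t' s'. t' \<le> t + 10 + 20 * card (heavy_rows s0 0) + 208 * card (heavy_rows s0 0) * card (heavy_rows s0 1) \<and>
     has_output s' (D \<union> E)) t s"
proof -
  define S0 S1 where "S0 = heavy_rows s0 0" and "S1 = heavy_rows s0 1"
  have S: "finite S0" "0 \<notin> S0" "finite S1" "0 \<notin> S1"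
    by (auto simp: S0_def S1_def heavy_rows_def dest: rows_pos)
  have heavy: "p \<in> S0 \<longleftrightarrow> p \<in> rows 0 \<and> heavy 0 p" "p \<in> S1 \<longleftrightarrow> p \<in> rows 1 \<and> heavy 1 p" for p
    by (auto simp: S0_def S1_def heavy_rows_def heavy_def)
  define G where "G C = {\<tau> \<in> E. \<tau> 0 \<in> C}" for C
  define H where "H p C = {\<tau> \<in> E. \<tau> 0 = p \<and> \<tau> 1 \<in> C}" for p C
  have hh: "regs s' (RHH 0) = max_or_0 S0" "regs s' (RHH 1) = max_or_0 S1" if "good s'" for s'
    using heavy_listed[of 0] heavy_listed[of 1] that by (simp_all add: heavy_listed_def S0_def S1_def good_def)
  have hn: "q \<in> S0 \<Longrightarrow> arrays s' (aHN 0) q = max_or_0 {r \<in> S0. r < q}"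
      "q \<in> S1 \<Longrightarrow> arrays s' (aHN 1) q = max_or_0 {r \<in> S1. r < q}" if "good s'" for s' q
    using heavy_listed[of 0] heavy_listed[of 1] that by (simp_all add: heavy_listed_def S0_def S1_def good_def)
  have E1: "\<tau> 0 \<in> S0" "\<tau> 1 \<in> S1" if "\<tau> \<in> E" for \<tau>
    using that unfolding heavy E triangles_def by auto
  let ?I = "\<lambda>C s'. good s' \<and> has_output s' (D \<union> G C)"
  have "wp (chain_loop (aHN 0) (RX 0)
            (Seq (Assign (RX 1) (Reg (RHH 1)))
                 (chain_loop (aHN 1) (RX 1) (check_pair 0 (earlier_heavy 3)))))
     (\<lambda>t' s'. t' \<le> t + 2 + 5 + (\<Sum>q\<in>S0. (7 + 208 * card S1) + 8) \<and> ?I S0 s')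
     (t + 2) (s\<lparr>regs := (regs s)(RX 0 := max_or_0 S0)\<rparr>)"
  proof (rule wp_chain_loop)
    show "?I {} (s\<lparr>regs := (regs s)(RX 0 := max_or_0 S0)\<rparr>)"
      using s D by (auto simp: good_upd G_def intro: has_output_cong)
  next
    fix p C t1 s1
    assume p: "p \<in> S0" "p \<notin> C" "C \<subseteq> S0" "?I C s1" "regs s1 (RX 0) = p"
    let ?J = "\<lambda>C' s'. good s' \<and> has_output s' (D \<union> G C \<union> H p C') \<and> regs s' (RX 0) = p"
    have "wp (chain_loop (aHN 1) (RX 1) (check_pair 0 (earlier_heavy 3)))
      (\<lambda>t' s'. t' \<le> t1 + 2 + 5 + (\<Sum>q\<in>S1. 200 + 8) \<and> ?J S1 s')
      (t1 + 2) (s1\<lparr>regs := (regs s1)(RX 1 := max_or_0 S1)\<rparr>)"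
    proof (rule wp_chain_loop)
      show "?J {} (s1\<lparr>regs := (regs s1)(RX 1 := max_or_0 S1)\<rparr>)"
        using p by (auto simp: good_upd H_def intro: has_output_cong)
    next
      fix q C' t2 s2
      assume q: "q \<in> S1" "q \<notin> C'" "C' \<subseteq> S1" "?J C' s2" "regs s2 (RX 1) = q"
      have N: "{\<tau> \<in> triangles. \<tau> 0 = p \<and> \<tau> ((0 + 1) mod 3) = q \<and> (\<forall>j<3. heavy j (\<tau> j))} =
          {\<tau> \<in> E. \<tau> 0 = p \<and> \<tau> 1 = q}" by (auto simp: E)
      have H: "H p (insert q C') = H p C' \<union> {\<tau> \<in> E. \<tau> 0 = p \<and> \<tau> 1 = q}" by (auto simp: H_def)
      have "wp (check_pair 0 (earlier_heavy 3)) (\<lambda>t' s'. t' \<le> t2 + 200 \<and>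
          has_output s' (D \<union> G C \<union> H p C' \<union> {\<tau> \<in> triangles. \<tau> 0 = p \<and> \<tau> ((0 + 1) mod 3) = q \<and> (\<forall>j<3. heavy j (\<tau> j))}) \<and>
          good s' \<and> regs s' (RX 0) = p \<and> regs s' (RX ((0 + 1) mod 3)) = q) t2 s2"
      proof (rule wp_check_pair)
        show "(D \<union> G C \<union> H p C') \<inter>
           {\<tau> \<in> triangles. \<tau> 0 = p \<and> \<tau> ((0 + 1) mod 3) = q \<and> (\<forall>j<3. heavy j (\<tau> j))} = {}"
          unfolding N using D(2) p(2) q(2) by (auto simp: G_def H_def)
      qed (use p q heavy in auto)
      then show "wp (check_pair 0 (earlier_heavy 3)) (\<lambda>t' s'. t' \<le> t2 + 200 \<and> ?J (insert q C') s' \<and> regs s' (RX 1) = q) t2 s2"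
        unfolding N by (rule wp_mono) (auto simp: H Un_assoc)
    qed (use S hn p in \<open>auto simp: good_upd intro: has_output_cong\<close>)
    moreover have "G (insert p C) = G C \<union> H p S1" using E1 by (auto simp: G_def H_def)
    ultimately have "wp (chain_loop (aHN 1) (RX 1) (check_pair 0 (earlier_heavy 3)))
      (\<lambda>t' s'. t' \<le> t1 + (7 + 208 * card S1) \<and> ?I (insert p C) s' \<and> regs s' (RX 0) = p)
      (t1 + 2) (s1\<lparr>regs := (regs s1)(RX 1 := max_or_0 S1)\<rparr>)"
      by (auto elim!: wp_mono simp: Un_assoc)
    then show "wp (Seq (Assign (RX 1) (Reg (RHH 1))) (chain_loop (aHN 1) (RX 1) (check_pair 0 (earlier_heavy 3))))
      (\<lambda>t' s'. t' \<le> t1 + (7 + 208 * card S1) \<and> ?I (insert p C) s' \<and> regs s' (RX 0) = p) t1 s1"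
      using hh(2) p by simp
  qed (use S hn in \<open>auto simp: good_upd intro: has_output_cong\<close>)
  moreover have "G S0 = E" using E1 by (auto simp: G_def)
  ultimately show ?thesis
    unfolding final_pass_def using hh(1)[OF s]
    by (auto elim!: wp_mono simp: S0_def S1_def algebra_simps)
qed

end

section \<open>The complete program and its phases\<close>

definition setup_layout :: program where
  "setup_layout = Seq (Assign (RST 0) (Const 20)) (rep 3 (\<lambda>j.
     let e = Fetch 0 (Minus (Reg (RST j)) (Const 1)) in
     Seq (Assign (REN j) (Plus (Reg (RST j)) (Plus e (Plus e (Plus e (Plus e e))))))
         (Assign (RST (Suc j)) (Plus (Reg (REN j)) (Const 1)))))"

definition enum_all :: program where
  "enum_all = Seq (rep 3 (\<lambda>j. rep 4 (enum_pass j))) final_pass"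

text \<open>\<open>RK\<close> starts at 1 so that the final bound is strict. The tables are
  allocated from \<open>RK\<close> upwards, which keeps the cells below it empty.\<close>

definition join_program :: program where
  "join_program = Seq setup_layout (Seq (Assign RK (Const 1)) (Seq (rep 3 key_bound_pass)
     (Seq (Assign RNX (Reg RK)) (Seq (rep 3 tab_pass) (Seq (rep 3 (\<lambda>j. rep 4 (chain_pass j)))
     (Seq (rep 3 (\<lambda>j. rep 4 (sel_pass j))) (Seq (rep 3 heavy_pass) (Seq (rep 2 hlist_pass)
     enum_all))))))))"

lemma sum_3: "(\<Sum>i<3. f i) = f 0 + f 1 + f (2::nat)"
  by (simp add: eval_nat_numeral)

context layout
begin

text \<open>Only the four shared columns compete: the private column leads to no neighbouring
  relation.\<close>

definition cost :: "nat \<Rightarrow> nat \<Rightarrow> nat" where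
  "cost j p = Min ((\<lambda>k. nb_count j k p) ` {..<4})"

lemma selected_cost:
  assumes "selected s j 4 p"
  obtains l where "l < 4" "arrays s (aSEL j) p = Suc l" "arrays s (aCST j) p = cost j p" "cost j p = nb_count j l p"
proof -
  obtain l where l: "l < 4" "arrays s (aSEL j) p = Suc l" "arrays s (aCST j) p = nb_count j l p" "\<forall>k<4. nb_count j l p \<le> nb_count j k p"
    using assms by (auto simp: selected_def)
  have "cost j p = nb_count j l p" unfolding cost_def using l by (intro Min_eqI) auto
  with l that show ?thesis by auto
qed

end

context tables
begin

text \<open>The triangles are split by their first light row and its selected column. Each light row
  is thus charged for one list only, the one of length \<open>cost j p\<close>.\<close>

lemma wp_enum_all:
  "wp enum_all (\<lambda>t' s'. t' \<le> t + 200 + 180 * (n 0 + n 1 + n 2) +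
     208 * (\<Sum>j<3. \<Sum>p\<in>{p \<in> rows j. \<not> heavy j p}. cost j p) +
     208 * card {p \<in> rows 0. heavy 0 p} * card {p \<in> rows 1. heavy 1 p} \<and> has_output s' triangles) t s0"
proof -
  define E where "E j = {\<tau> \<in> triangles. (\<forall>i<j. heavy i (\<tau> i)) \<and> \<not> heavy j (\<tau> j)}" for j
  \<comment> \<open>The lower end is 1 because \<open>aSEL\<close> holds the column plus one; with
    \<open>k = 4\<close> nothing is excluded.\<close>
  define F where "F j k = {\<tau> \<in> E j. arrays s0 (aSEL j) (\<tau> j) \<in> {1..k}}" for j k
  define c where "c j = (\<Sum>p\<in>{p \<in> rows j. \<not> heavy j p}. cost j p)" for j
  have FE: "F j 4 = E j" if "j < 3" for j
  proof -
    have "arrays s0 (aSEL j) (\<tau> j) \<in> {1..4}" if "\<tau> \<in> E j" for \<tau>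
    proof -
      have "\<tau> j \<in> rows j" using that \<open>j < 3\<close> by (auto simp: E_def triangles_def)
      from SEL[OF \<open>j < 3\<close> this] show ?thesis by (auto simp: selected_def)
    qed
    then show ?thesis by (auto simp: F_def)
  qed
  have pass_j: "wp (rep 4 (enum_pass j))
      (\<lambda>t' s'. t' \<le> t + (25 + 160 * n j + 208 * c j) \<and> good s' \<and> has_output s' (\<Union>i<Suc j. E i)) t s"
    if j: "j < 3" and s: "good s" "has_output s (\<Union>i<j. E i)" for j t s
  proof -
    define d where "d k = 6 + (\<Sum>p\<in>rows j. 40 +
      (if \<not> heavy j p \<and> arrays s0 (aSEL j) p = Suc k then 208 * nb_count j k p else 0))" for k
    have "wp (rep 4 (enum_pass j))
      (\<lambda>t' s'. t' \<le> t + 1 + (\<Sum>k<4. d k) \<and> (good s' \<and> has_output s' ((\<Union>i<j. E i) \<union> F j 4))) t s"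
    proof (rule wp_rep)
      show "good s \<and> has_output s ((\<Union>i<j. E i) \<union> F j 0)" using s by (simp add: F_def)
    next
      fix k t s assume *: "k < 4" "good s \<and> has_output s ((\<Union>i<j. E i) \<union> F j k)"
      have "wp (enum_pass j k) (\<lambda>t' s'. t' \<le> t + 6 + (\<Sum>p\<in>rows j. 40 +
      (if \<not> heavy j p \<and> arrays s0 (aSEL j) p = Suc k then 208 * nb_count j k p else 0)) \<and>
        has_output s' ((\<Union>i<j. E i) \<union> F j k \<union> {\<tau> \<in> triangles. (\<forall>i<j. heavy i (\<tau> i)) \<and> \<not> heavy j (\<tau> j) \<and> arrays s0 (aSEL j) (\<tau> j) = Suc k}) \<and>
        good s') t s"
        by (rule wp_enum_pass) (use * j in \<open>auto simp: E_def F_def\<close>)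
      moreover have "(\<Union>i<j. E i) \<union> F j k \<union> {\<tau> \<in> triangles. (\<forall>i<j. heavy i (\<tau> i)) \<and> \<not> heavy j (\<tau> j) \<and> arrays s0 (aSEL j) (\<tau> j) = Suc k}
        = (\<Union>i<j. E i) \<union> F j (Suc k)"
        by (auto simp: F_def E_def)
      ultimately show "wp (enum_pass j k) (\<lambda>t' s'. t' \<le> t + d k \<and> (good s' \<and> has_output s' ((\<Union>i<j. E i) \<union> F j (Suc k)))) t s"
        unfolding d_def by (auto elim!: wp_mono)
    qed
    moreover have "(\<Union>i<j. E i) \<union> F j 4 = (\<Union>i<Suc j. E i)"
      unfolding FE[OF j] by (auto simp: less_Suc_eq)
    moreover have "(\<Sum>k<4. d k) = 24 + 160 * n j + 208 * c j"
    proof -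
      have 1: "(\<Sum>k<4. if \<not> heavy j p \<and> arrays s0 (aSEL j) p = Suc k then 208 * nb_count j k p else 0) =
          (if \<not> heavy j p then 208 * cost j p else 0)" if p: "p \<in> rows j" for p
      proof -
        obtain l where l: "l < 4" "arrays s0 (aSEL j) p = Suc l" "cost j p = nb_count j l p"
          using selected_cost[OF SEL[OF j p]] by metis
        have "(\<Sum>k<4. if \<not> heavy j p \<and> arrays s0 (aSEL j) p = Suc k then 208 * nb_count j k p else 0) =
            (\<Sum>k<4. if k = l then (if \<not> heavy j p then 208 * cost j p else 0) else 0)"
          by (rule sum.cong) (auto simp: l)
        then show ?thesis using l(1) by simp
      qed
      have "(\<Sum>k<4. d k) = 24 + (\<Sum>k<4. \<Sum>p\<in>rows j. 40 +
         (if \<not> heavy j p \<and> arrays s0 (aSEL j) p = Suc k then 208 * nb_count j k p else 0))"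
        by (simp add: d_def sum.distrib)
      also have "\<dots> = 24 + (\<Sum>p\<in>rows j. \<Sum>k<4. 40 +
         (if \<not> heavy j p \<and> arrays s0 (aSEL j) p = Suc k then 208 * nb_count j k p else 0))"
        by (subst sum.swap) simp
      also have "\<dots> = 24 + (\<Sum>p\<in>rows j. 160 + (if \<not> heavy j p then 208 * cost j p else 0))"
        using 1 by (simp add: sum.distrib)
      also have "\<dots> = 24 + 160 * n j + 208 * c j"
        by (simp add: sum.distrib card_rows c_def sum_distrib_left sum.inter_filter if_distrib[of "(*) 208"] cong: if_cong)
      finally show ?thesis .
    qed
    ultimately show ?thesis by (auto elim!: wp_mono)
  qed
  have "wp (rep 3 (\<lambda>j. rep 4 (enum_pass j)))
      (\<lambda>t' s'. t' \<le> t + 1 + (\<Sum>j<3. 25 + 160 * n j + 208 * c j) \<and> (good s' \<and> has_output s' (\<Union>i<3. E i))) t s0"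
  proof (rule wp_rep)
    show "good s0 \<and> has_output s0 (\<Union>i<0. E i)" by (simp add: good_def has_output_def out0)
  qed (use pass_j in blast)
  then show ?thesis
    unfolding enum_all_def wp_Seq
  proof (rule wp_mono)
    fix t1 s1
    assume 1: "t1 \<le> t + 1 + (\<Sum>j<3. 25 + 160 * n j + 208 * c j) \<and> (good s1 \<and> has_output s1 (\<Union>i<3. E i))"
    have heavy_rows: "heavy_rows s0 j = {p \<in> rows j. heavy j p}" for j by (auto simp: heavy_rows_def heavy_def)
    have triangles: "(\<Union>i<3. E i) \<union> {\<tau> \<in> triangles. \<forall>i<3. heavy i (\<tau> i)} = triangles"
    proof -
      have "\<exists>i<3. \<tau> \<in> E i" if "\<tau> \<in> triangles" "\<exists>i<3. \<not> heavy i (\<tau> i)" for \<tau>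
      proof -
        \<comment> \<open>The least relation with a light row decides in which pass the triangle is
          found.\<close>
        define i where "i = (LEAST i. \<not> heavy i (\<tau> i))"
        have "\<not> heavy i (\<tau> i)" "\<forall>j<i. heavy j (\<tau> j)" using that(2) unfolding i_def
          by (metis LeastI, metis not_less_Least)
        moreover have "i < 3" using that(2) Least_le[of "\<lambda>i. \<not> heavy i (\<tau> i)"] unfolding i_def by fastforce
        ultimately show ?thesis using that(1) by (auto simp: E_def)
      qed
      then show ?thesis by (auto simp: E_def)
    qed
    have disj: "(\<Union>i<3. E i) \<inter> {\<tau> \<in> triangles. \<forall>i<3. heavy i (\<tau> i)} = {}"
      by (auto simp: E_def)
    have "card (heavy_rows s0 0) \<le> card (rows 0)" by (rule card_mono) (auto simp: heavy_rows_def)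
    then have "card (heavy_rows s0 0) \<le> n 0" by (simp add: card_rows)
    then show "wp final_pass (\<lambda>t' s'. t' \<le> t + 200 + 180 * (n 0 + n 1 + n 2) +
     208 * (\<Sum>j<3. \<Sum>p\<in>{p \<in> rows j. \<not> heavy j p}. cost j p) +
     208 * card {p \<in> rows 0. heavy 0 p} * card {p \<in> rows 1. heavy 1 p} \<and> has_output s' triangles) t1 s1"
      using 1 disj
      by (intro wp_mono[OF wp_final_pass[of s1 "\<Union>i<3. E i" _ t1]])
         (auto simp: triangles heavy_rows sum_3 c_def)
  qed
qed

end

context layout
begin

text \<open>\<open>T\<close> contains the kinds of arrays on whose initial zeros later passes still
  rely; it shrinks from phase to phase.\<close>

definition unwritten :: "nat set \<Rightarrow> state \<Rightarrow> bool" where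
  "unwritten T s \<longleftrightarrow> (\<forall>a\<in>T. \<forall>j k v. arrays s (nm a j k) v = 0)"

definition prepared :: "nat set \<Rightarrow> state \<Rightarrow> bool" where
  "prepared T s \<longleftrightarrow> layout_ok s \<and> out s = [] \<and> unwritten T s \<and> (\<forall>j. regs s (RHH j) = 0)"

lemma prepared_unchanged:
  assumes "prepared T s" "unchanged A R s s'" "A \<inter> arrays_of_kind T = {}" "0 \<notin> A" "R \<inter> regs_of_kind {1,2,3} = {}" "T' \<subseteq> T"
  shows "prepared T' s'"
proof -
  have R: "rg a j \<notin> R" if "a \<in> {1,2,3}" for a j
  proof -
    have "rg a j \<in> regs_of_kind {1,2,3}" unfolding rg_in_regs_of_kind by (rule that)
    then show ?thesis using assms(5) by blast
  qed
  have "layout_ok s'"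
  proof (rule layout_ok_unchanged[OF _ assms(2,4)])
    show "layout_ok s" using assms(1) by (simp add: prepared_def)
  qed (rule R, simp)+
  moreover have "arrays s' (nm a j k) v = 0" if "a \<in> T'" for a j k v
  proof -
    have "nm a j k \<in> arrays_of_kind T" using assms(6) that by auto
    then have "nm a j k \<notin> A" using assms(3) by blast
    then show ?thesis using assms(1,2,6) that by (auto simp: prepared_def unwritten_def unchanged_def)
  qed
  moreover have "regs s' (RHH j) = 0" for j
  proof -
    have "RHH j \<notin> R" by (rule R) simp
    then show ?thesis using assms(1,2) by (auto simp: prepared_def unchanged_def)
  qed
  ultimately show ?thesis using assms(1,2) by (auto simp: prepared_def unwritten_def unchanged_def)
qed

lemma lookup_ok_unchanged: "lookup_ok s K j \<Longrightarrow> unchanged A R s s' \<Longrightarrow> aTAB j \<notin> A \<Longrightarrow> aBASE j \<notin> A \<Longrightarrow> lookup_ok s' K j"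
  by (simp add: lookup_ok_def unchanged_def)

lemma chained_unchanged: "chained s j k \<Longrightarrow> unchanged A R s s' \<Longrightarrow> aHEAD j k \<notin> A \<Longrightarrow> aNEXT j k \<notin> A \<Longrightarrow> aCNT j k \<notin> A \<Longrightarrow> chained s' j k"
  by (simp add: chained_def unchanged_def)

lemma selected_unchanged: "selected s j m p \<Longrightarrow> unchanged A R s s' \<Longrightarrow> aSEL j \<notin> A \<Longrightarrow> aCST j \<notin> A \<Longrightarrow> selected s' j m p"
  by (simp add: selected_def unchanged_def)

lemma heavy_found_unchanged: "heavy_found s j \<Longrightarrow> unchanged A R s s' \<Longrightarrow> aHV j \<notin> A \<Longrightarrow> aCST j \<notin> A \<Longrightarrow> heavy_found s' j"
  by (simp add: heavy_found_def unchanged_def)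

lemma heavy_listed_unchanged: "heavy_listed s j \<Longrightarrow> unchanged A R s s' \<Longrightarrow> aHV j \<notin> A \<Longrightarrow> aHN j \<notin> A \<Longrightarrow> RHH j \<notin> R \<Longrightarrow> heavy_listed s' j"
  by (simp add: heavy_listed_def unchanged_def heavy_rows_def)

text \<open>The encoded query fills 1 + 3 * 6 = 19 cells and cell 19 is the first row count, so rows
  start at 20. Each row count lies just before its rows; adding it five times replaces a
  multiplication.\<close>

lemma wp_setup:
  assumes s: "arrays s 0 = inp" "\<And>a i. a \<noteq> 0 \<Longrightarrow> arrays s a i = 0" "\<And>r. regs s r = 0" "out s = []"
    and st: "st 0 = 20" "\<And>j. j < 3 \<Longrightarrow> st (Suc j) = st j + 5 * n j + 1" "\<And>j. j < 3 \<Longrightarrow> inp (st j - 1) = n j"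
  shows "wp setup_layout (\<lambda>t' s'. t' \<le> t + 200 \<and> prepared UNIV s') t s"
proof -
  have "wp (rep 3 (\<lambda>j.
     let e = Fetch 0 (Minus (Reg (RST j)) (Const 1)) in
     Seq (Assign (REN j) (Plus (Reg (RST j)) (Plus e (Plus e (Plus e (Plus e e))))))
         (Assign (RST (Suc j)) (Plus (Reg (REN j)) (Const 1)))))
    (\<lambda>t' s'. t' \<le> (t + 2) + 1 + (\<Sum>i<(3::nat). 50) \<and>
      (arrays s' = arrays s \<and> out s' = [] \<and> (\<forall>j. regs s' (RHH j) = 0) \<and>
       (\<forall>j\<le>3. regs s' (RST j) = st j) \<and> (\<forall>j<3. regs s' (REN j) = st j + 5 * n j))) (t + 2)
     (s\<lparr>regs := (regs s)(RST 0 := 20)\<rparr>)"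
  proof (rule wp_rep[where I = "\<lambda>i s'. arrays s' = arrays s \<and> out s' = [] \<and> (\<forall>j. regs s' (RHH j) = 0) \<and>
       (\<forall>j\<le>i. regs s' (RST j) = st j) \<and> (\<forall>j<i. regs s' (REN j) = st j + 5 * n j)"])
    fix i t1 and s1 :: state assume i: "i < 3" and *: "arrays s1 = arrays s \<and> out s1 = [] \<and> (\<forall>j. regs s1 (RHH j) = 0) \<and>
       (\<forall>j\<le>i. regs s1 (RST j) = st j) \<and> (\<forall>j<i. regs s1 (REN j) = st j + 5 * n j)"
    show "wp (let e = Fetch 0 (Minus (Reg (RST i)) (Const 1)) in
     Seq (Assign (REN i) (Plus (Reg (RST i)) (Plus e (Plus e (Plus e (Plus e e))))))
         (Assign (RST (Suc i)) (Plus (Reg (REN i)) (Const 1))))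
       (\<lambda>t' s'. t' \<le> t1 + 50 \<and> (arrays s' = arrays s \<and> out s' = [] \<and> (\<forall>j. regs s' (RHH j) = 0) \<and>
       (\<forall>j\<le>Suc i. regs s' (RST j) = st j) \<and> (\<forall>j<Suc i. regs s' (REN j) = st j + 5 * n j))) t1 s1"
      using * i s st(2)[OF i] st(3)[OF i] by (auto simp: Let_def le_Suc_eq less_Suc_eq)
  qed (use s st in auto)
  moreover have "arrays s (nm a j k) v = 0" for a j k v
    by (rule s(2)) simp
  ultimately show ?thesis unfolding setup_layout_def using s(1,3,4)
    by (auto elim!: wp_mono simp: prepared_def unwritten_def layout_ok_def)
qed

text \<open>\<open>h j\<close> sends a private value to its heavy row. It occurs in the time bound
  because the cost still depends on which rows are skipped; the bound becomes uniform only when the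
  partition is brought in.\<close>

definition join_program_post :: "nat \<Rightarrow> nat \<Rightarrow> state \<Rightarrow> bool" where
  "join_program_post t t' s' \<longleftrightarrow> (\<exists>h :: nat \<Rightarrow> nat \<Rightarrow> nat.
     (\<forall>j<3. \<forall>p\<in>rows j. h j (inp (p + 4)) \<in> col_rows j 4 (inp (p + 4)) \<and> cost j p \<le> cost j (h j (inp (p + 4)))) \<and>
     t' \<le> t + 2000 * (n 0 + n 1 + n 2 + 1) +
     208 * (\<Sum>j<3. \<Sum>p\<in>{p \<in> rows j. h j (inp (p + 4)) \<noteq> p}. cost j p) +
     208 * card {p \<in> rows 0. h 0 (inp (p + 4)) = p} * card {p \<in> rows 1. h 1 (inp (p + 4)) = p} \<and>
     has_output s' triangles)"

lemma wp_join_program: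
  assumes s: "arrays s 0 = inp" "\<And>a i. a \<noteq> 0 \<Longrightarrow> arrays s a i = 0" "\<And>r. regs s r = 0" "out s = []"
    and st: "st 0 = 20" "\<And>j. j < 3 \<Longrightarrow> st (Suc j) = st j + 5 * n j + 1" "\<And>j. j < 3 \<Longrightarrow> inp (st j - 1) = n j"
    and key: "\<And>j p q. j < 3 \<Longrightarrow> p \<in> rows j \<Longrightarrow> q \<in> rows j \<Longrightarrow> inp p = inp q \<Longrightarrow>
       inp (p + 2) = inp (q + 2) \<Longrightarrow> p = q"
  shows "wp join_program (join_program_post t) t s"
proof -
  let ?Q = "join_program_post t"
  let ?N = "n 0 + n 1 + n 2"
  have S: "(\<Sum>i<3. c + d * n i) \<le> 3 * c + d * ?N" for c d :: nat
    by (simp add: sum_3 algebra_simps)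
  \<comment> \<open>\<open>P2\<close> to \<open>P6\<close> are the results of the successive phases;
    later phases write other arrays and so preserve what they still have to pass on.\<close>
  define P2 where "P2 K s \<longleftrightarrow> regs s RK = K \<and> 0 < K \<and> (\<forall>j<3. \<forall>p\<in>rows j. inp p < K \<and> inp (p + 2) < K)" for K and s :: state
  define P3 where "P3 K s \<longleftrightarrow> (\<forall>j<3. lookup_ok s K j)" for K and s :: state
  define P4 where "P4 s \<longleftrightarrow> (\<forall>j<3. \<forall>k<4. chained s j k)" for s :: state
  define P5 where "P5 s \<longleftrightarrow> (\<forall>j<3. \<forall>p\<in>rows j. selected s j 4 p)" for s :: state
  define P6 where "P6 s \<longleftrightarrow> (\<forall>j<3. heavy_found s j)" for s :: state
  have key_phase: "wp (rep 3 key_bound_pass) (\<lambda>t' s'. t' \<le> t + (19 + 40 * ?N) \<and>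
      (\<exists>K. prepared UNIV s' \<and> P2 K s')) t s" if c: "prepared UNIV s" "regs s RK = 1" for t s
  proof -
    let ?I = "\<lambda>i s'. prepared UNIV s' \<and> 0 < regs s' RK \<and>
        (\<forall>j<i. \<forall>p\<in>rows j. inp p < regs s' RK \<and> inp (p + 2) < regs s' RK)"
    have "wp (rep 3 key_bound_pass) (\<lambda>t' s'. t' \<le> t + 1 + (\<Sum>i<3. 6 + 40 * n i) \<and> ?I 3 s') t s"
    proof (rule wp_rep[where I = "\<lambda>i s'. ?I i s'"])
      fix i t1 s1
      assume i: "i < 3" "?I i s1"
      show "wp (key_bound_pass i) (\<lambda>t' s'. t' \<le> t1 + (6 + 40 * n i) \<and> ?I (Suc i) s') t1 s1"
      proof (rule wp_mono[OF wp_key_pass])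
        fix t2 s2
        assume *: "t2 \<le> t1 + 6 + 40 * n i \<and> regs s1 RK \<le> regs s2 RK \<and>
           (\<forall>p\<in>rows i. inp p + regs s1 RK \<le> regs s2 RK \<and> inp (p + 2) + regs s1 RK \<le> regs s2 RK) \<and>
           unchanged {} {RX i, RK} s1 s2"
        then have "prepared UNIV s2" using i(2) by (auto intro: prepared_unchanged[of UNIV s1 "{}" "{RX i, RK}"])
        moreover have "inp p < regs s2 RK \<and> inp (p + 2) < regs s2 RK" if "j < Suc i" "p \<in> rows j" for j p
        proof (cases "j = i")
          case True
          then show ?thesis using * i(2) that(2) by (metis add_gr_0 less_add_same_cancel1 less_le_trans)
        next
          case False
          then have "j < i" using that by simp
          then have "inp p < regs s1 RK \<and> inp (p + 2) < regs s1 RK" using i(2) that(2) by blast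
          then show ?thesis using * by auto
        qed
        ultimately show "t2 \<le> t1 + (6 + 40 * n i) \<and> ?I (Suc i) s2" using * i by auto
      qed (use i in \<open>auto simp: prepared_def\<close>)
    qed (use c in auto)
    then show ?thesis by (rule wp_mono) (use S[of 6 40] in \<open>auto simp: P2_def\<close>)
  qed
  have tab_phase: "wp (rep 3 tab_pass) (\<lambda>t' s'. t' \<le> t + (19 + 60 * ?N) \<and>
      prepared {0,2,4,5} s' \<and> P3 K s') t s" if c: "prepared UNIV s" "P2 K s" "regs s RNX = K" for t s K
  proof -
    let ?I = "\<lambda>i s'. prepared {0,2,4,5} s' \<and> P2 K s' \<and> K \<le> regs s' RNX \<and> (\<forall>j<i. lookup_ok s' K j) \<and>
       (\<forall>j\<ge>i. \<forall>v. arrays s' (aBASE j) v = 0 \<and> arrays s' (aTAB j) v = 0)"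
    have "wp (rep 3 tab_pass) (\<lambda>t' s'. t' \<le> t + 1 + (\<Sum>i<3. 6 + 60 * n i) \<and>
      ?I 3 s') t s"
    proof (rule wp_rep[where I = "\<lambda>i s'. ?I i s'"])
      fix i t1 s1
      assume i: "i < 3" "?I i s1"
      show "wp (tab_pass i) (\<lambda>t' s'. t' \<le> t1 + (6 + 60 * n i) \<and> ?I (Suc i) s') t1 s1"
      proof (rule wp_mono[OF wp_tab_pass[where K = K]])
        fix t2 s2
        assume *: "t2 \<le> t1 + 6 + 60 * n i \<and> lookup_ok s2 K i \<and> regs s1 RNX \<le> regs s2 RNX \<and>
           unchanged {aBASE i, aTAB i} {RX i, RNX} s1 s2"
        then have u: "unchanged {aBASE i, aTAB i} {RX i, RNX} s1 s2" by simp
        have "prepared {0,2,4,5} s2" using i(2) u by (auto intro: prepared_unchanged[of "{0,2,4,5}" s1 _ _ s2])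
        moreover have "lookup_ok s2 K j" if "j < Suc i" for j
          using that * i(2) lookup_ok_unchanged[OF _ u, of K j] by (cases "j = i") auto
        moreover have "P2 K s2" using i(2) u by (auto simp: P2_def unchanged_def)
        moreover have "arrays s2 (aBASE j) v = 0 \<and> arrays s2 (aTAB j) v = 0" if "j \<ge> Suc i" for j v
          using i(2) u that by (auto simp: unchanged_def)
        ultimately show "t2 \<le> t1 + (6 + 60 * n i) \<and> ?I (Suc i) s2" using * i by auto
      qed (use i in \<open>auto simp: prepared_def P2_def\<close>)
    qed (use c in \<open>auto simp: prepared_def unwritten_def\<close>)
    then show ?thesis by (rule wp_mono) (use S[of 6 60] in \<open>auto simp: P3_def\<close>)
  qed
  have chain_phase: "wp (rep 3 (\<lambda>j. rep 4 (chain_pass j))) (\<lambda>t' s'. t' \<le> t + (76 + 160 * ?N) \<and>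
      prepared {4,5} s' \<and> P3 K s' \<and> P4 s') t s" if c: "prepared {0,2,4,5} s" "P3 K s" for t s K
  proof -
    let ?J = "\<lambda>j k s'. prepared {4,5} s' \<and> P3 K s' \<and> (\<forall>j' k'. (j' < j \<and> k' < 4 \<or> j' = j \<and> k' < k) \<longrightarrow> chained s' j' k') \<and>
       (\<forall>j' k' v. (j' > j \<or> j' = j \<and> k' \<ge> k) \<longrightarrow> arrays s' (aHEAD j' k') v = 0 \<and> arrays s' (aCNT j' k') v = 0)"
    let ?I = "\<lambda>j s'. ?J j 0 s'"
    have "wp (rep 3 (\<lambda>j. rep 4 (chain_pass j))) (\<lambda>t' s'. t' \<le> t + 1 + (\<Sum>i<3. 25 + 160 * n i) \<and> ?I 3 s') t s"
    proof (rule wp_rep)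
      fix j t1 s1 assume j: "j < 3" "?I j s1"
      have "wp (rep 4 (chain_pass j)) (\<lambda>t' s'. t' \<le> t1 + 1 + (\<Sum>i<(4::nat). 6 + 40 * n j) \<and> ?J j 4 s') t1 s1"
      proof (rule wp_rep[where I = "\<lambda>k s'. ?J j k s'"])
        fix k t2 s2 assume k: "k < 4" "?J j k s2"
        show "wp (chain_pass j k) (\<lambda>t' s'. t' \<le> t2 + (6 + 40 * n j) \<and> ?J j (Suc k) s') t2 s2"
        proof (rule wp_mono[OF wp_chain_pass])
          fix t3 s3
          assume *: "t3 \<le> t2 + 6 + 40 * n j \<and> chained s3 j k \<and> unchanged {aHEAD j k, aNEXT j k, aCNT j k} {RX j} s2 s3"
          then have u: "unchanged {aHEAD j k, aNEXT j k, aCNT j k} {RX j} s2 s3" by simp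
          have 1: "prepared {4,5} s3" using k(2) u by (auto intro: prepared_unchanged[of "{4,5}" s2 _ _ s3])
          have 2: "P3 K s3" using k(2) lookup_ok_unchanged[OF _ u] by (auto simp: P3_def)
          have 3: "chained s3 j' k'" if "j' < j \<and> k' < 4 \<or> j' = j \<and> k' < Suc k" for j' k'
          proof (cases "j' = j \<and> k' = k")
            case False
            then have "chained s2 j' k'" using that k(2) by (auto simp: less_Suc_eq)
            then show ?thesis using False by (intro chained_unchanged[OF _ u]) auto
          qed (use * in auto)
          have 4: "arrays s3 (aHEAD j' k') v = 0 \<and> arrays s3 (aCNT j' k') v = 0"
            if "j' > j \<or> j' = j \<and> k' \<ge> Suc k" for j' k' v
            using that k(2) u by (auto simp: unchanged_def)
          show "t3 \<le> t2 + (6 + 40 * n j) \<and> ?J j (Suc k) s3"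
            using * 1 2 3 4 by simp
        qed (use k j in \<open>auto simp: prepared_def\<close>)
      qed (use j in auto)
      then show "wp (rep 4 (chain_pass j)) (\<lambda>t' s'. t' \<le> t1 + (25 + 160 * n j) \<and> ?I (Suc j) s') t1 s1"
        by (rule wp_mono) (auto simp: less_Suc_eq)
    qed (use c in \<open>auto simp: prepared_def unwritten_def\<close>)
    then show ?thesis by (rule wp_mono) (use S[of 25 160] in \<open>auto simp: P4_def\<close>)
  qed
  have sel_phase: "wp (rep 3 (\<lambda>j. rep 4 (sel_pass j))) (\<lambda>t' s'. t' \<le> t + (76 + 160 * ?N) \<and>
      prepared {5} s' \<and> P3 K s' \<and> P4 s' \<and> P5 s') t s" if c: "prepared {4,5} s" "P3 K s" "P4 s" for t s K
  proof -
    let ?J = "\<lambda>j k s'. prepared {5} s' \<and> P3 K s' \<and> P4 s' \<and> (\<forall>j'. \<forall>p\<in>rows j'. (j' < j \<longrightarrow> selected s' j' 4 p) \<and>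
       (j' = j \<longrightarrow> selected s' j' k p) \<and> (j' > j \<longrightarrow> selected s' j' 0 p))"
    let ?I = "\<lambda>j s'. ?J j 0 s'"
    have "wp (rep 3 (\<lambda>j. rep 4 (sel_pass j))) (\<lambda>t' s'. t' \<le> t + 1 + (\<Sum>i<3. 25 + 160 * n i) \<and> ?I 3 s') t s"
    proof (rule wp_rep)
      fix j t1 s1 assume j: "j < 3" "?I j s1"
      have "wp (rep 4 (sel_pass j)) (\<lambda>t' s'. t' \<le> t1 + 1 + (\<Sum>i<(4::nat). 6 + 40 * n j) \<and> ?J j 4 s') t1 s1"
      proof (rule wp_rep[where I = "\<lambda>k s'. ?J j k s'"])
        fix k t2 s2 assume k: "k < 4" "?J j k s2"
        have nn: "nb_rel j k < 3" "nb_col k < 4" using k by (auto simp: nb_rel_def nb_col_def)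
        show "wp (sel_pass j k) (\<lambda>t' s'. t' \<le> t2 + (6 + 40 * n j) \<and> ?J j (Suc k) s') t2 s2"
        proof (rule wp_mono[OF wp_sel_pass])
          fix t3 s3
          assume *: "t3 \<le> t2 + 6 + 40 * n j \<and> (\<forall>p\<in>rows j. selected s3 j (Suc k) p) \<and> unchanged {aSEL j, aCST j} {RX j} s2 s3"
          then have u: "unchanged {aSEL j, aCST j} {RX j} s2 s3" by simp
          have 1: "prepared {5} s3" using k(2) u by (auto intro: prepared_unchanged[of "{5}" s2 _ _ s3])
          have 2: "P3 K s3" "P4 s3" using k(2) lookup_ok_unchanged[OF _ u] chained_unchanged[OF _ u] by (auto simp: P3_def P4_def)
          have 3: "(j' < j \<longrightarrow> selected s3 j' 4 p) \<and>
              (j' = j \<longrightarrow> selected s3 j' (Suc k) p) \<and> (j' > j \<longrightarrow> selected s3 j' 0 p)" if "p \<in> rows j'" for j' p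
            using that k(2) * selected_unchanged[OF _ u] by auto
          show "t3 \<le> t2 + (6 + 40 * n j) \<and> ?J j (Suc k) s3"
            using * 1 2 3 by simp
        qed (use k j nn in \<open>auto simp: prepared_def P4_def\<close>)
      qed (use j in auto)
      then show "wp (rep 4 (sel_pass j)) (\<lambda>t' s'. t' \<le> t1 + (25 + 160 * n j) \<and> ?I (Suc j) s') t1 s1"
        by (rule wp_mono) (auto simp: less_Suc_eq)
    qed (use c in \<open>auto simp: prepared_def unwritten_def selected_def\<close>)
    then show ?thesis by (rule wp_mono) (use S[of 25 160] in \<open>auto simp: P5_def\<close>)
  qed
  have heavy_phase: "wp (rep 3 heavy_pass) (\<lambda>t' s'. t' \<le> t + (19 + 40 * ?N) \<and>
      prepared {} s' \<and> P3 K s' \<and> P4 s' \<and> P5 s' \<and> P6 s') t s" if c: "prepared {5} s" "P3 K s" "P4 s" "P5 s" for t s K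
  proof -
    let ?I = "\<lambda>i s'. prepared {} s' \<and> P3 K s' \<and> P4 s' \<and> P5 s' \<and> (\<forall>j<i. heavy_found s' j) \<and>
       (\<forall>j\<ge>i. \<forall>v. arrays s' (aHV j) v = 0)"
    have "wp (rep 3 heavy_pass) (\<lambda>t' s'. t' \<le> t + 1 + (\<Sum>i<3. 6 + 40 * n i) \<and> ?I 3 s') t s"
    proof (rule wp_rep)
      fix i t1 s1 assume i: "i < 3" "?I i s1"
      show "wp (heavy_pass i) (\<lambda>t' s'. t' \<le> t1 + (6 + 40 * n i) \<and> ?I (Suc i) s') t1 s1"
      proof (rule wp_mono[OF wp_heavy_pass])
        fix t2 s2
        assume *: "t2 \<le> t1 + 6 + 40 * n i \<and> heavy_found s2 i \<and> unchanged {aHV i} {RX i} s1 s2"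
        then have u: "unchanged {aHV i} {RX i} s1 s2" by simp
        have 1: "prepared {} s2" using i(2) u by (auto intro: prepared_unchanged[of "{}" s1 _ _ s2])
        have 2: "P3 K s2" "P4 s2" "P5 s2" using i(2) lookup_ok_unchanged[OF _ u] chained_unchanged[OF _ u] selected_unchanged[OF _ u]
          by (auto simp: P3_def P4_def P5_def)
        have 3: "heavy_found s2 j" if "j < Suc i" for j
          using that * i(2) heavy_found_unchanged[OF _ u, of j] by (cases "j = i") auto
        have 4: "arrays s2 (aHV j) v = 0" if "j \<ge> Suc i" for j v
          using i(2) u that by (auto simp: unchanged_def)
        show "t2 \<le> t1 + (6 + 40 * n i) \<and> ?I (Suc i) s2" using * 1 2 3 4 by simp
      qed (use i in \<open>auto simp: prepared_def\<close>)
    qed (use c in \<open>auto simp: prepared_def unwritten_def\<close>)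
    then show ?thesis by (rule wp_mono) (use S[of 6 40] in \<open>auto simp: P6_def\<close>)
  qed
  have hlist_phase: "wp (rep 2 hlist_pass) (\<lambda>t' s'. t' \<le> t + (13 + 40 * ?N) \<and>
      (layout_ok s' \<and> out s' = []) \<and> P3 K s' \<and> P4 s' \<and> P5 s' \<and> P6 s' \<and> (\<forall>j<2. heavy_listed s' j)) t s"
    if c: "prepared {} s" "P3 K s" "P4 s" "P5 s" "P6 s" for t s K
  proof -
    let ?I = "\<lambda>i s'. (layout_ok s' \<and> out s' = []) \<and> P3 K s' \<and> P4 s' \<and> P5 s' \<and> P6 s' \<and> (\<forall>j<i. heavy_listed s' j) \<and>
       (\<forall>j\<ge>i. regs s' (RHH j) = 0)"
    have "wp (rep 2 hlist_pass) (\<lambda>t' s'. t' \<le> t + 1 + (\<Sum>i<2. 6 + 40 * n i) \<and> ?I 2 s') t s"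
    proof (rule wp_rep)
      fix i t1 s1 assume i: "i < 2" "?I i s1"
      show "wp (hlist_pass i) (\<lambda>t' s'. t' \<le> t1 + (6 + 40 * n i) \<and> ?I (Suc i) s') t1 s1"
      proof (rule wp_mono[OF wp_hlist_pass])
        fix t2 s2
        assume *: "t2 \<le> t1 + 6 + 40 * n i \<and> heavy_listed s2 i \<and> unchanged {aHN i} {RX i, RHH i} s1 s2"
        then have u: "unchanged {aHN i} {RX i, RHH i} s1 s2" by simp
        have 1: "layout_ok s2 \<and> out s2 = []" using i(2) u layout_ok_unchanged[OF _ u] by (auto simp: unchanged_def)
        have 2: "P3 K s2" "P4 s2" "P5 s2" "P6 s2"
          using i(2) lookup_ok_unchanged[OF _ u] chained_unchanged[OF _ u] selected_unchanged[OF _ u] heavy_found_unchanged[OF _ u]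
          by (auto simp: P3_def P4_def P5_def P6_def)
        have 3: "heavy_listed s2 j" if "j < Suc i" for j
          using that * i(2) heavy_listed_unchanged[OF _ u, of j] by (cases "j = i") auto
        have 4: "regs s2 (RHH j) = 0" if "j \<ge> Suc i" for j
          using i(2) u that by (auto simp: unchanged_def)
        show "t2 \<le> t1 + (6 + 40 * n i) \<and> ?I (Suc i) s2" using * 1 2 3 4 by simp
      qed (use i in auto)
    qed (use c in \<open>auto simp: prepared_def\<close>)
    then show ?thesis by (rule wp_mono) (auto simp: numeral_2_eq_2)
  qed
  have enum_phase: "wp enum_all ?Q t1 s1"
    if c: "layout_ok s1" "out s1 = []" "P3 K s1" "P4 s1" "P5 s1" "P6 s1" "\<forall>j<2. heavy_listed s1 j" and P2: "P2 K s2"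
      and t1: "t1 \<le> t + 700 + 500 * ?N" for t1 s1 s2 K
  proof -
    interpret tables inp st n s1 K
    proof
      show "inp p < K" if "j < 3" "p \<in> rows j" for j p using P2 that by (auto simp: P2_def)
    qed (use c key in \<open>auto simp: P3_def P4_def P5_def P6_def\<close>)
    show ?thesis
    proof (rule wp_mono[OF wp_enum_all])
      fix t' s'
      assume *: "t' \<le> t1 + 200 + 180 * ?N + 208 * (\<Sum>j<3. \<Sum>p\<in>{p \<in> rows j. \<not> heavy j p}. cost j p) +
         208 * card {p \<in> rows 0. heavy 0 p} * card {p \<in> rows 1. heavy 1 p} \<and> has_output s' triangles"
      have "arrays s1 (aHV j) (inp (p + 4)) \<in> col_rows j 4 (inp (p + 4)) \<and>
         cost j p \<le> cost j (arrays s1 (aHV j) (inp (p + 4)))" if "j < 3" "p \<in> rows j" for j p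
      proof -
        let ?q = "arrays s1 (aHV j) (inp (p + 4))"
        have q: "?q \<in> col_rows j 4 (inp (p + 4))" "arrays s1 (aCST j) p \<le> arrays s1 (aCST j) ?q"
          using heavy_found[OF that(1)] that(2) by (auto simp: heavy_found_def)
        then have "?q \<in> rows j" by (simp add: col_rows_def)
        then show ?thesis using q selected_cost[OF SEL[OF that]] selected_cost[OF SEL[OF that(1) \<open>?q \<in> rows j\<close>]]
          by metis
      qed
      then show "?Q t' s'"
        using * t1 unfolding heavy_def join_program_post_def by (intro exI[of _ "\<lambda>j. arrays s1 (aHV j)"]) auto
    qed
  qed
  show ?thesis unfolding join_program_def wp_Seq
  proof (rule wp_mono[OF wp_setup[OF s st]]; (elim conjE)?)
    fix t1 s1 assume 1: "t1 \<le> t + 200" "prepared UNIV s1"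
    have c1: "prepared UNIV (s1\<lparr>regs := (regs s1)(RK := 1)\<rparr>)"
      using 1 by (auto simp: prepared_def layout_ok_def unwritten_def)
    show "wp (Assign RK (Const 1)) (wp (rep 3 key_bound_pass) (wp (Assign RNX (Reg RK)) (wp (rep 3 tab_pass)
       (wp (rep 3 (\<lambda>j. rep 4 (chain_pass j))) (wp (rep 3 (\<lambda>j. rep 4 (sel_pass j)))
       (wp (rep 3 heavy_pass) (wp (rep 2 hlist_pass) (wp enum_all ?Q)))))))) t1 s1"
      unfolding wp_Assign
    proof (rule wp_mono[OF key_phase], goal_cases)
      case 1
      then show ?case using c1 by simp
    next
      case 2
      then show ?case by simp
    next
      case (3 t2 s2)
      then obtain K where 2: "t2 \<le> t + 300 + 40 * ?N" "prepared UNIV s2" "P2 K s2" using 1 by auto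
      have c2: "prepared UNIV (s2\<lparr>regs := (regs s2)(RNX := K)\<rparr>)" "P2 K (s2\<lparr>regs := (regs s2)(RNX := K)\<rparr>)"
        using 2 by (auto simp: prepared_def layout_ok_def unwritten_def P2_def)
      have RK: "exp_val (Reg RK) s2 = K" using 2 by (simp add: P2_def)
      show ?case unfolding RK
      proof (rule wp_mono[OF tab_phase[OF c2]], goal_cases)
        case (2 t3 s3)
        then have 3: "t3 \<le> t + 330 + 100 * ?N" "prepared {0,2,4,5} s3" "P3 K s3" using \<open>t2 \<le> _\<close> by auto
        show ?case
        proof (rule wp_mono[OF chain_phase[OF 3(2,3)]])
          fix t4 s4 assume "t4 \<le> t3 + (76 + 160 * ?N) \<and> prepared {4,5} s4 \<and> P3 K s4 \<and> P4 s4"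
          with 3 have 4: "t4 \<le> t + 410 + 260 * ?N" "prepared {4,5} s4" "P3 K s4" "P4 s4" by auto
          show "wp (rep 3 (\<lambda>j. rep 4 (sel_pass j)))
             (wp (rep 3 heavy_pass) (wp (rep 2 hlist_pass) (wp enum_all ?Q))) t4 s4"
          proof (rule wp_mono[OF sel_phase[OF 4(2-4)]])
            fix t5 s5 assume "t5 \<le> t4 + (76 + 160 * ?N) \<and> prepared {5} s5 \<and> P3 K s5 \<and> P4 s5 \<and> P5 s5"
            with 4 have 5: "t5 \<le> t + 490 + 420 * ?N" "prepared {5} s5" "P3 K s5" "P4 s5" "P5 s5" by auto
            show "wp (rep 3 heavy_pass) (wp (rep 2 hlist_pass) (wp enum_all ?Q)) t5 s5"
            proof (rule wp_mono[OF heavy_phase[OF 5(2-5)]])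
              fix t6 s6 assume "t6 \<le> t5 + (19 + 40 * ?N) \<and> prepared {} s6 \<and> P3 K s6 \<and> P4 s6 \<and> P5 s6 \<and> P6 s6"
              with 5 have 6: "t6 \<le> t + 510 + 460 * ?N" "prepared {} s6" "P3 K s6" "P4 s6" "P5 s6" "P6 s6" by auto
              show "wp (rep 2 hlist_pass) (wp enum_all ?Q) t6 s6"
              proof (rule wp_mono[OF hlist_phase[OF 6(2-6)]])
                fix t7 s7 assume "t7 \<le> t6 + (13 + 40 * ?N) \<and> (layout_ok s7 \<and> out s7 = []) \<and> P3 K s7 \<and> P4 s7 \<and> P5 s7 \<and> P6 s7 \<and>
                   (\<forall>j<2. heavy_listed s7 j)"
                with 6 have 7: "t7 \<le> t + 700 + 500 * ?N" "layout_ok s7" "out s7 = []" "P3 K s7" "P4 s7" "P5 s7" "P6 s7"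
                   "\<forall>j<2. heavy_listed s7 j" by auto
                show "wp enum_all ?Q t7 s7" by (rule enum_phase[OF 7(2-8) \<open>P2 K s2\<close> 7(1)])
              qed
            qed
          qed
        qed
      qed simp
    qed
  qed
qed

end

section \<open>The query and its constraints\<close>

lemma card_le_1_iff: "finite A \<Longrightarrow> card A \<le> 1 \<longleftrightarrow> (\<forall>x\<in>A. \<forall>y\<in>A. x = y)"
  by (metis card_le_Suc0_iff_eq One_nat_def)

text \<open>Infinitely many assignments may compete in the \<open>Max\<close>, but their values are
  bounded by \<open>card R\<close> and so form a finite set; the constant assignment 0 shows that it
  is nonempty.\<close>

lemma degree_le_iff:
  assumes "finite R"
  shows "degree R X Y \<le> d \<longleftrightarrow> (\<forall>x. dom x = X \<longrightarrow> card (project Y (select X x R)) \<le> d)"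
proof -
  let ?A = "(\<lambda>x. card (project Y (select X x R))) ` {x. dom x = X}"
  have "?A \<subseteq> {..card R}"
  proof
    fix c assume "c \<in> ?A"
    then obtain x where "c = card (project Y (select X x R))" by auto
    also have "\<dots> \<le> card (select X x R)"
      unfolding project_def by (rule card_image_le) (simp add: select_def assms)
    also have "\<dots> \<le> card R" by (rule card_mono) (auto simp: select_def assms)
    finally show "c \<in> {..card R}" by simp
  qed
  then have "finite ?A" by (rule finite_subset) simp
  moreover have "dom (\<lambda>x. if x \<in> X then Some 0 else None :: nat option) = X"
    by (auto split: if_splits)
  then have "?A \<noteq> {}" by blast
  ultimately show ?thesis unfolding degree_def by (subst Max_le_iff) auto
qed

lemma restrict_self: "t |` dom t = t"
  by (rule ext) (auto simp: restrict_map_def dom_def)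

lemma project_id: "\<forall>t\<in>R. dom t = Y \<Longrightarrow> project Y R = R"
proof -
  assume "\<forall>t\<in>R. dom t = Y"
  then have "t |` Y = t" if "t \<in> R" for t using restrict_self[of t] that by simp
  then show ?thesis by (simp add: project_def)
qed

lemma degree_empty:
  assumes "finite R"
  shows "degree R {} Y \<le> d \<longleftrightarrow> card (project Y R) \<le> d"
proof -
  have "select {} Map.empty R = R" by (auto simp: select_def)
  then show ?thesis by (simp add: degree_le_iff[OF assms])
qed

text \<open>Degree at most 1 onto the whole schema says that \<open>X\<close> is a key.\<close>

lemma degree_one_iff:
  assumes "finite R" "\<forall>t\<in>R. dom t = Y" "X \<subseteq> Y"
  shows "degree R X Y \<le> 1 \<longleftrightarrow> (\<forall>t\<in>R. \<forall>t'\<in>R. t |` X = t' |` X \<longrightarrow> t = t')"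
proof -
  have p: "project Y (select X x R) = select X x R" for x
    using assms(2) by (intro project_id) (auto simp: select_def)
  have f: "finite (select X x R)" for x using assms(1) by (simp add: select_def)
  have d: "dom (t |` X) = X" if "t \<in> R" for t using assms(2,3) that by auto
  have "(\<forall>x. dom x = X \<longrightarrow> (\<forall>t\<in>select X x R. \<forall>t'\<in>select X x R. t = t')) \<longleftrightarrow>
      (\<forall>t\<in>R. \<forall>t'\<in>R. t |` X = t' |` X \<longrightarrow> t = t')"
  proof (intro iffI ballI allI impI)
    fix t t' assume "\<forall>x. dom x = X \<longrightarrow> (\<forall>t\<in>select X x R. \<forall>t'\<in>select X x R. t = t')"
      and *: "t \<in> R" "t' \<in> R" "t |` X = t' |` X"
    then have "\<forall>u\<in>select X (t |` X) R. \<forall>u'\<in>select X (t |` X) R. u = u'"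
      using d[OF *(1)] by blast
    then show "t = t'" using * by (simp add: select_def)
  qed (auto simp: select_def)
  then show ?thesis
    unfolding degree_le_iff[OF assms(1)] p card_le_1_iff[OF f] .
qed

lemma satisfies_single: "satisfies I (PConstraint j {X} Y d) \<longleftrightarrow> degree (I ! j) X Y \<le> d"
  unfolding satisfies_def by (auto simp: disjoint_family_on_def intro: exI[of _ "\<lambda>_. I ! j"])

definition schema :: "nat \<Rightarrow> nat list" where
  "schema j = [2 * j, 2 * j + 1, 2 * ((j + 1) mod 3), 2 * ((j + 1) mod 3) + 1, 6 + j]"

definition Q3 :: query where
  "Q3 = [schema 0, schema 1, schema 2]"

text \<open>The factor 6 makes room for the disjoint union of six databases. In each of them the two
  big relations have n^3 * n rows, whereas the third has n * n rows with distinct private values: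
  hence n^4 and n^2. The third constraint is the key used for lookups.\<close>

definition constraints :: "nat \<Rightarrow> nat \<Rightarrow> pconstraint set" where
  "constraints n j =
     {PConstraint j {{}} (set (schema j)) (6 * n ^ 4),
      PConstraint j {{}} {6 + j} (6 * n ^ 2),
      PConstraint j {{2 * j, 2 * ((j + 1) mod 3)}} (set (schema j)) 1,
      PConstraint j ((\<lambda>x. {x}) ` set (schema j)) (set (schema j)) 1}"

definition PC3 :: "nat \<Rightarrow> pconstraint set" where
  "PC3 n = (\<Union>j<3. constraints n j)"

lemma Q3_nth: "j < 3 \<Longrightarrow> Q3 ! j = schema j"
  unfolding less_3 by (auto simp: Q3_def)

lemma length_Q3 [simp]: "length Q3 = 3"
  by (simp add: Q3_def)

lemma distinct_schema: "j < 3 \<Longrightarrow> distinct (schema j)"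
  unfolding less_3 by (auto simp: schema_def)

lemma query_vars_Q3: "query_vars Q3 = {..<9}"
  by (auto simp: query_vars_def Q3_def schema_def)

definition wf_rel :: "nat \<Rightarrow> relation \<Rightarrow> bool" where
  "wf_rel j R \<longleftrightarrow> finite R \<and> (\<forall>t\<in>R. dom t = set (schema j))"

definition degree_bounds :: "nat \<Rightarrow> nat \<Rightarrow> relation \<Rightarrow> bool" where
  "degree_bounds n j R \<longleftrightarrow> card R \<le> 6 * n ^ 4 \<and> card ((\<lambda>t. t (6 + j)) ` R) \<le> 6 * n ^ 2 \<and>
     (\<forall>t\<in>R. \<forall>t'\<in>R. t (2 * j) = t' (2 * j) \<longrightarrow>
        t (2 * ((j + 1) mod 3)) = t' (2 * ((j + 1) mod 3)) \<longrightarrow> t = t')"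

text \<open>The partition is encoded by the function that sends a tuple to the key variable of its
  part.\<close>

definition partitioned :: "nat \<Rightarrow> relation \<Rightarrow> bool" where
  "partitioned j R \<longleftrightarrow> (\<exists>f. \<forall>t\<in>R. f t \<in> set (schema j) \<and>
     (\<forall>t'\<in>R. f t' = f t \<longrightarrow> t' (f t) = t (f t) \<longrightarrow> t' = t))"

lemma is_database_iff: "is_database Q3 I \<longleftrightarrow> length I = 3 \<and> (\<forall>j<3. wf_rel j (I ! j))"
  by (auto simp: is_database_def list_all2_conv_all_nth Q3_nth wf_rel_def)

lemma restrict_eq_iff: "t |` X = t' |` X \<longleftrightarrow> (\<forall>x\<in>X. t x = t' x)"
  by (auto simp: restrict_map_def fun_eq_iff)

lemma satisfies_card:
  assumes "wf_rel j (I ! j)"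
  shows "satisfies I (PConstraint j {{}} (set (schema j)) d) \<longleftrightarrow> card (I ! j) \<le> d"
  using assms unfolding wf_rel_def by (simp add: satisfies_single degree_empty project_id)

lemma satisfies_column:
  assumes "wf_rel j (I ! j)"
  shows "satisfies I (PConstraint j {{}} {x} d) \<longleftrightarrow> card ((\<lambda>t. t x) ` (I ! j)) \<le> d"
proof -
  have fin: "finite (I ! j)" using assms by (simp add: wf_rel_def)
  have "(\<lambda>v. if v = None then Map.empty else [x \<mapsto> the v]) ` ((\<lambda>t. t x) ` (I ! j)) = project {x} (I ! j)"
    unfolding image_image project_def
    by (rule image_cong) (auto simp: restrict_map_def fun_eq_iff)
  moreover have "inj (\<lambda>v :: nat option. if v = None then Map.empty else [x \<mapsto> the v])"
    by (rule injI) (auto simp: fun_eq_iff split: if_splits)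
  ultimately have "card (project {x} (I ! j)) = card ((\<lambda>t. t x) ` (I ! j))"
    using card_image[OF inj_on_subset[OF _ subset_UNIV], of "\<lambda>v. if v = None then Map.empty else [x \<mapsto> the v]"
        "(\<lambda>t. t x) ` (I ! j)"] by simp
  then show ?thesis using fin by (simp add: satisfies_single degree_empty)
qed

lemma satisfies_fd:
  assumes "wf_rel j (I ! j)" "X \<subseteq> set (schema j)"
  shows "satisfies I (PConstraint j {X} (set (schema j)) 1) \<longleftrightarrow>
    (\<forall>t\<in>I ! j. \<forall>t'\<in>I ! j. (\<forall>x\<in>X. t x = t' x) \<longrightarrow> t = t')"
  unfolding satisfies_single
  by (subst degree_one_iff) (use assms in \<open>auto simp: wf_rel_def restrict_eq_iff\<close>)

lemma satisfies_key:
  assumes "wf_rel j (I ! j)"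
  shows "satisfies I (PConstraint j {{2 * j, 2 * ((j + 1) mod 3)}} (set (schema j)) 1) \<longleftrightarrow>
    (\<forall>t\<in>I ! j. \<forall>t'\<in>I ! j. t (2 * j) = t' (2 * j) \<longrightarrow>
        t (2 * ((j + 1) mod 3)) = t' (2 * ((j + 1) mod 3)) \<longrightarrow> t = t')"
  by (subst satisfies_fd[OF assms]) (auto simp: schema_def)

lemma satisfies_partitioned:
  assumes "wf_rel j (I ! j)"
  shows "satisfies I (PConstraint j ((\<lambda>x. {x}) ` set (schema j)) (set (schema j)) 1) \<longleftrightarrow> partitioned j (I ! j)"
proof
  assume "satisfies I (PConstraint j ((\<lambda>x. {x}) ` set (schema j)) (set (schema j)) 1)"
  then obtain P where P: "(\<Union>x\<in>set (schema j). P {x}) = I ! j"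
      "\<And>x. x \<in> set (schema j) \<Longrightarrow> degree (P {x}) {x} (set (schema j)) \<le> 1"
    unfolding satisfies_def by auto
  define f where "f t = (SOME x. x \<in> set (schema j) \<and> t \<in> P {x})" for t
  have f: "f t \<in> set (schema j) \<and> t \<in> P {f t}" if "t \<in> I ! j" for t
    unfolding f_def by (rule someI_ex) (use P(1) that in auto)
  have sub: "P {x} \<subseteq> I ! j" if "x \<in> set (schema j)" for x using P(1) that by auto
  have "t' = t" if t: "t \<in> I ! j" "t' \<in> I ! j" "f t' = f t" "t' (f t) = t (f t)" for t t'
  proof -
    have s: "P {f t} \<subseteq> I ! j" "{f t} \<subseteq> set (schema j)" using sub f[OF t(1)] by simp_all
    have "finite (P {f t})" using finite_subset[OF s(1)] assms by (simp add: wf_rel_def)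
    moreover have "\<forall>u\<in>P {f t}. dom u = set (schema j)"
    proof
      fix u assume "u \<in> P {f t}"
      then have "u \<in> I ! j" using s(1) by (rule rev_subsetD)
      then show "dom u = set (schema j)" using assms by (simp add: wf_rel_def)
    qed
    ultimately have "finite (P {f t})" "\<forall>u\<in>P {f t}. dom u = set (schema j)" "{f t} \<subseteq> set (schema j)"
      using s(2) by simp_all
    then have "\<forall>u\<in>P {f t}. \<forall>u'\<in>P {f t}. u |` {f t} = u' |` {f t} \<longrightarrow> u = u'"
      using degree_one_iff P(2)[of "f t"] f[OF t(1)] by simp
    moreover have "t \<in> P {f t}" "t' \<in> P {f t}" using f[OF t(1)] f[OF t(2)] t(3) by simp_all
    moreover have "t' |` {f t} = t |` {f t}" using t(4) by (simp add: restrict_eq_iff)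
    ultimately show ?thesis by blast
  qed
  then show "partitioned j (I ! j)" unfolding partitioned_def using f by (intro exI[of _ f]) auto
next
  assume "partitioned j (I ! j)"
  then obtain f where f: "\<And>t. t \<in> I ! j \<Longrightarrow> f t \<in> set (schema j)"
    "\<And>t t'. t \<in> I ! j \<Longrightarrow> t' \<in> I ! j \<Longrightarrow> f t' = f t \<Longrightarrow> t' (f t) = t (f t) \<Longrightarrow> t' = t"
    unfolding partitioned_def by blast
  define P where "P X = {t \<in> I ! j. {f t} = X}" for X
  have "degree (P {x}) {x} (set (schema j)) \<le> 1" if "x \<in> set (schema j)" for x
    by (subst degree_one_iff) (use assms that f in \<open>auto simp: P_def wf_rel_def restrict_eq_iff\<close>)
  then show "satisfies I (PConstraint j ((\<lambda>x. {x}) ` set (schema j)) (set (schema j)) 1)"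
    unfolding satisfies_def using f(1)
    by (intro exI[of _ P]) (auto simp: P_def disjoint_family_on_def)
qed

lemma schema_subset: "2 * j \<in> set (schema j)" "2 * ((j + 1) mod 3) \<in> set (schema j)" "6 + j \<in> set (schema j)"
  by (simp_all add: schema_def)

lemma models_PC3:
  "I \<in> models Q3 (PC3 n) \<longleftrightarrow> length I = 3 \<and> (\<forall>j<3. wf_rel j (I ! j) \<and> degree_bounds n j (I ! j) \<and> partitioned j (I ! j))"
proof -
  have "(\<forall>c\<in>constraints n j. satisfies I c) \<longleftrightarrow> degree_bounds n j (I ! j) \<and> partitioned j (I ! j)"
    if "wf_rel j (I ! j)" for j
    unfolding constraints_def degree_bounds_def
    by (simp only: ball_simps satisfies_card[OF that] satisfies_column[OF that] satisfies_key[OF that]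
        satisfies_partitioned[OF that] conj_assoc simp_thms)
  then show ?thesis
    unfolding models_def PC3_def mem_Collect_eq is_database_iff by blast
qed

lemma degree_constraints_PC3:
  "degree_constraints (PC3 n) = (\<Union>j<3. {PConstraint j {{}} (set (schema j)) (6 * n ^ 4),
      PConstraint j {{}} {6 + j} (6 * n ^ 2),
      PConstraint j {{2 * j, 2 * ((j + 1) mod 3)}} (set (schema j)) 1})"
proof -
  \<comment> \<open>A schema has distinct variables, so the partition constraint has several sources
    and is no degree constraint.\<close>
  have "\<nexists>X. (\<lambda>x. {x}) ` set (schema j) = {X}" for j
    by (auto simp: schema_def doubleton_eq_iff)
  then show ?thesis
    by (auto simp: degree_constraints_def PC3_def constraints_def)
qed

lemma models_DC3:
  "I \<in> models Q3 (degree_constraints (PC3 n)) \<longleftrightarrow>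
     length I = 3 \<and> (\<forall>j<3. wf_rel j (I ! j) \<and> degree_bounds n j (I ! j))"
proof -
  have "(\<forall>c\<in>{PConstraint j {{}} (set (schema j)) (6 * n ^ 4),
      PConstraint j {{}} {6 + j} (6 * n ^ 2),
      PConstraint j {{2 * j, 2 * ((j + 1) mod 3)}} (set (schema j)) 1}. satisfies I c) \<longleftrightarrow> degree_bounds n j (I ! j)"
    if "wf_rel j (I ! j)" for j
    unfolding degree_bounds_def
    by (simp only: ball_simps satisfies_card[OF that] satisfies_column[OF that] satisfies_key[OF that]
        conj_assoc simp_thms)
  then show ?thesis
    unfolding models_def degree_constraints_PC3 mem_Collect_eq is_database_iff by blast
qed

lemma answer_Q3:
  assumes "length I = 3"
  shows "t \<in> answer Q3 I \<longleftrightarrow> dom t = {..<9} \<and> (\<forall>j<3. t |` set (schema j) \<in> I ! j)"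
proof -
  have "\<Union> (set (map set Q3)) = {..<9}" using query_vars_Q3 by (simp add: query_vars_def)
  then show ?thesis by (simp add: answer_def natural_join_def Q3_nth)
qed

lemma dom_union_schema: "{..<9} = (\<Union>j<3. set (schema j))"
proof -
  have "{..<3::nat} = {0, 1, 2}" by auto
  then show ?thesis using query_vars_Q3 by (simp add: query_vars_def Q3_def Un_assoc)
qed

lemma card_answer_le:
  assumes "length I = 3" "\<forall>j<3. finite (I ! j)"
  shows "finite (answer Q3 I) \<and> card (answer Q3 I) \<le> card (I ! 0) * (card (I ! 1) * card (I ! 2))"
proof -
  let ?f = "\<lambda>t. (t |` set (schema 0), t |` set (schema 1), t |` set (schema 2))"
  let ?R = "I ! 0 \<times> I ! 1 \<times> I ! 2"
  have "inj_on ?f (answer Q3 I)"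
  proof (rule inj_onI)
    fix t u assume "t \<in> answer Q3 I" "u \<in> answer Q3 I" "?f t = ?f u"
    then have d: "dom t = {..<9}" "dom u = {..<9}" and "\<And>j. j < 3 \<Longrightarrow> t |` set (schema j) = u |` set (schema j)"
      by (auto simp: answer_Q3[OF assms(1)] less_3)
    then have e: "t x = u x" if "j < 3" "x \<in> set (schema j)" for j x
      using that unfolding restrict_eq_iff by blast
    have "t x = u x" if "x < 9" for x
    proof -
      have "x \<in> (\<Union>j<3. set (schema j))" using that dom_union_schema by blast
      then show ?thesis using e by blast
    qed
    moreover have "t x = u x" if "\<not> x < 9" for x using d that by (metis domIff lessThan_iff)
    ultimately show "t = u" by blast
  qed
  moreover have "?f ` answer Q3 I \<subseteq> ?R" by (auto simp: answer_Q3[OF assms(1)])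
  moreover have "finite ?R" using assms(2) by simp
  ultimately have "finite (answer Q3 I)" "card (answer Q3 I) \<le> card ?R"
    using inj_on_finite[of ?f "answer Q3 I" ?R] card_inj_on_le[of ?f "answer Q3 I" ?R] by simp_all
  then show ?thesis by (simp add: card_cartesian_product)
qed

text \<open>The crude product bound serves only to make the set bounded, without which the supremum
  in \<open>nat\<close> would say nothing.\<close>

lemma comb_bound_ge:
  assumes "I \<in> models Q3 (degree_constraints (PC3 n))"
  shows "card (answer Q3 I) \<le> comb_bound Q3 (degree_constraints (PC3 n))"
  unfolding comb_bound_def
proof (rule cSUP_upper[OF assms bdd_aboveI])
  fix x assume "x \<in> (\<lambda>I. card (answer Q3 I)) ` models Q3 (degree_constraints (PC3 n))"
  then obtain I where I: "I \<in> models Q3 (degree_constraints (PC3 n))" "x = card (answer Q3 I)" by auto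
  then have "\<forall>j<3. finite (I ! j) \<and> card (I ! j) \<le> 6 * n ^ 4" "length I = 3"
    by (auto simp: models_DC3 wf_rel_def degree_bounds_def)
  then have "card (answer Q3 I) \<le> card (I ! 0) * (card (I ! 1) * card (I ! 2))"
      "card (I ! 0) * (card (I ! 1) * card (I ! 2)) \<le> 6 * n ^ 4 * (6 * n ^ 4 * (6 * n ^ 4))"
    using card_answer_le by (simp, intro mult_le_mono) (auto simp: less_3)
  then show "x \<le> 6 * n ^ 4 * (6 * n ^ 4 * (6 * n ^ 4))" using I(2) by simp
qed

lemma wf_Q3: "wf_query Q3"
  using distinct_schema by (auto simp: wf_query_def Q3_def)

lemma wf_PC3: "c \<in> PC3 n \<Longrightarrow> wf_constraint Q3 c"
  by (auto simp: PC3_def constraints_def wf_constraint_def Q3_nth schema_subset) (auto simp: schema_def)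

lemma covered_PC3: "covered Q3 (PC3 n)"
  unfolding covered_def query_vars_Q3 dom_union_schema
proof
  fix z assume "z \<in> (\<Union>j<3. set (schema j))"
  then obtain j where "j < 3" "z \<in> set (schema j)" by auto
  then show "\<exists>c\<in>PC3 n. is_cardinality_constraint Q3 c \<and> z \<in> target c"
    by (intro bexI[of _ "PConstraint j {{}} (set (schema j)) (6 * n ^ 4)"])
       (auto simp: is_cardinality_constraint_def Q3_nth PC3_def constraints_def)
qed

section \<open>Running time under the constraints\<close>

lemma length_schema [simp]: "length (schema j) = 5"
  by (simp add: schema_def)

context layout
begin

lemma sum_card_col_rows_le:
  assumes "finite P" and inj: "\<And>p q. p \<in> P \<Longrightarrow> q \<in> P \<Longrightarrow> inp (p + k) = inp (q + k) \<Longrightarrow> p = q"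
  shows "(\<Sum>p\<in>P. nb_count j k p) \<le> n (nb_rel j k)"
proof -
  have "(\<Sum>p\<in>P. nb_count j k p) = card (\<Union>p\<in>P. col_rows (nb_rel j k) (nb_col k) (inp (p + k)))"
    unfolding nb_count_def using assms by (subst card_UN_disjoint) (auto simp: col_rows_def)
  also have "\<dots> \<le> card (rows (nb_rel j k))"
    by (rule card_mono) (auto simp: col_rows_def)
  finally show ?thesis by (simp add: card_rows)
qed

text \<open>
  A light row that relies on the private column is exchanged for the heavy row with the same
  private value, which is at least as expensive and relies on a shared column.
\<close>

lemma light_cost_le:
  assumes j: "j < 3" and B: "\<And>j. j < 3 \<Longrightarrow> n j \<le> B"
    and src: "\<And>p. p \<in> rows j \<Longrightarrow> src p < (5::nat)"
    and inj: "\<And>p q. p \<in> rows j \<Longrightarrow> q \<in> rows j \<Longrightarrow> src q = src p \<Longrightarrow>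
      inp (q + src p) = inp (p + src p) \<Longrightarrow> q = p"
    and h: "\<And>p. p \<in> rows j \<Longrightarrow> h (inp (p + 4)) \<in> col_rows j 4 (inp (p + 4)) \<and> cost j p \<le> cost j (h (inp (p + 4)))"
  shows "(\<Sum>p\<in>{p \<in> rows j. h (inp (p + 4)) \<noteq> p}. cost j p) \<le> 4 * B"
proof -
  let ?L = "{p \<in> rows j. h (inp (p + 4)) \<noteq> p}"
  \<comment> \<open>\<open>?A\<close> and \<open>?B\<close> are the light rows relying on the
    private and on a shared column; \<open>?C\<close> are the heavy rows relying on a shared
    column.\<close>
  let ?A = "{p \<in> ?L. src p = 4}" and ?B = "{p \<in> rows j. src p \<noteq> 4 \<and> h (inp (p + 4)) \<noteq> p}"
    and ?C = "{p \<in> rows j. src p \<noteq> 4 \<and> h (inp (p + 4)) = p}"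
  let ?f = "\<lambda>p. h (inp (p + 4))"
  have hf: "?f p \<in> rows j" "inp (?f p + 4) = inp (p + 4)" if "p \<in> rows j" for p
    using h[OF that] by (auto simp: col_rows_def)
  \<comment> \<open>The private column is a key among the rows that rely on it, so they have
    different heavy rows.\<close>
  have "inj_on ?f ?A"
  proof (rule inj_onI)
    fix p q assume *: "p \<in> ?A" "q \<in> ?A" "?f p = ?f q"
    then have pq: "p \<in> rows j" "q \<in> rows j" "src p = 4" "src q = 4" by simp_all
    have "inp (q + 4) = inp (?f q + 4)" by (rule hf(2)[OF pq(2), symmetric])
    also have "\<dots> = inp (?f p + 4)" by (simp only: *(3))
    also have "\<dots> = inp (p + 4)" by (rule hf(2)[OF pq(1)])
    finally show "p = q" using inj[OF pq(1,2)] pq(3,4) by simp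
  qed
  have "?f ` ?A \<subseteq> ?C"
  proof
    fix q assume "q \<in> ?f ` ?A"
    then obtain p where p: "p \<in> rows j" "?f p \<noteq> p" "src p = 4" "q = ?f p" by auto
    have q: "q \<in> rows j" "inp (q + 4) = inp (p + 4)" using hf[OF p(1)] p(4) by auto
    \<comment> \<open>Otherwise \<open>p\<close> and its heavy row would be two rows with the same
      private value in the part where that column is a key.\<close>
    have "src q \<noteq> 4" using inj[OF p(1) q(1)] p q by auto
    moreover have "?f q = q" using p(4) q(2) by simp
    ultimately show "q \<in> ?C" using q(1) by simp
  qed
  have 1: "(\<Sum>p\<in>?L. cost j p) = (\<Sum>p\<in>?A. cost j p) + (\<Sum>p\<in>?B. cost j p)"
    by (subst sum.union_disjoint[symmetric]) (auto intro!: sum.cong)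
  have "(\<Sum>p\<in>?A. cost j p) \<le> (\<Sum>p\<in>?A. cost j (?f p))"
    using h by (intro sum_mono) auto
  also have "(\<Sum>p\<in>?A. cost j (?f p)) = (\<Sum>q\<in>?f ` ?A. cost j q)"
    using sum.reindex[OF \<open>inj_on ?f ?A\<close>, of "cost j"] by (simp add: comp_def)
  also have "(\<Sum>q\<in>?f ` ?A. cost j q) \<le> (\<Sum>q\<in>?C. cost j q)"
    using \<open>?f ` ?A \<subseteq> ?C\<close> by (intro sum_mono2) auto
  finally have 2: "(\<Sum>p\<in>?A. cost j p) \<le> (\<Sum>q\<in>?C. cost j q)" .
  have 3: "(\<Sum>q\<in>?C. cost j q) + (\<Sum>p\<in>?B. cost j p) = (\<Sum>p\<in>{p \<in> rows j. src p \<noteq> 4}. cost j p)"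
    by (subst sum.union_disjoint[symmetric]) (auto intro!: sum.cong)
  \<comment> \<open>After the exchange only rows relying on shared columns are charged; their four
    parts pay at most the size of a neighbouring relation each.\<close>
  have "(\<Sum>p\<in>?L. cost j p) \<le> (\<Sum>p\<in>{p \<in> rows j. src p \<noteq> 4}. cost j p)"
    using 1 2 3 by linarith
  also have "\<dots> = (\<Sum>p\<in>(\<Union>k<4. {p \<in> rows j. src p = k}). cost j p)"
  proof (rule sum.cong)
    have "src p < 4 \<longleftrightarrow> src p \<noteq> 4" if "p \<in> rows j" for p using src[OF that] by auto
    then show "{p \<in> rows j. src p \<noteq> 4} = (\<Union>k<4. {p \<in> rows j. src p = k})" by auto
  qed simp
  also have "\<dots> = (\<Sum>k<4. \<Sum>p\<in>{p \<in> rows j. src p = k}. cost j p)"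
    by (subst sum.UNION_disjoint) auto
  also have "\<dots> \<le> (\<Sum>k<(4::nat). B)"
  proof (rule sum_mono)
    fix k :: nat assume "k \<in> {..<4}"
    then have k: "k < 4" by simp
    have "(\<Sum>p\<in>{p \<in> rows j. src p = k}. cost j p) \<le> (\<Sum>p\<in>{p \<in> rows j. src p = k}. nb_count j k p)"
      using k by (intro sum_mono) (auto simp: cost_def intro!: Min_le)
    also have "\<dots> \<le> n (nb_rel j k)"
      by (rule sum_card_col_rows_le) (use inj in auto)
    also have "\<dots> \<le> B" using B[of "nb_rel j k"] k by (simp add: nb_rel_def)
    finally show "(\<Sum>p\<in>{p \<in> rows j. src p = k}. cost j p) \<le> B" .
  qed
  finally show ?thesis by simp
qed

lemma heavy_count_le:
  "card {p \<in> rows j. h (inp (p + 4)) = p} \<le> card ((\<lambda>p. inp (p + 4)) ` rows j)"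
proof (rule card_inj_on_le)
  show "inj_on (\<lambda>p. inp (p + 4)) {p \<in> rows j. h (inp (p + 4)) = p}"
  proof (rule inj_onI)
    fix p q assume *: "p \<in> {p \<in> rows j. h (inp (p + 4)) = p}" "q \<in> {p \<in> rows j. h (inp (p + 4)) = p}"
      "inp (p + 4) = inp (q + 4)"
    then have "h (inp (p + 4)) = p" "h (inp (q + 4)) = q" by simp_all
    with *(3) show "p = q" by metis
  qed
qed auto

end

section \<open>From triangles of addresses to tuples of the answer\<close>

locale presented = layout +
  fixes I :: database and row_tuple :: "nat \<Rightarrow> nat \<Rightarrow> tuple"
  assumes len: "length I = 3"
    and wf: "j < 3 \<Longrightarrow> wf_rel j (I ! j)"
    and bij: "j < 3 \<Longrightarrow> bij_betw (row_tuple j) (rows j) (I ! j)"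
    and row_tuple: "j < 3 \<Longrightarrow> p \<in> rows j \<Longrightarrow> k < 5 \<Longrightarrow> row_tuple j p (schema j ! k) = Some (inp (p + k))"
begin

lemma row_tuple_in: "j < 3 \<Longrightarrow> p \<in> rows j \<Longrightarrow> row_tuple j p \<in> I ! j"
  using bij by (auto simp: bij_betw_def)

lemma row_tuple_eq: "j < 3 \<Longrightarrow> p \<in> rows j \<Longrightarrow> q \<in> rows j \<Longrightarrow> row_tuple j p = row_tuple j q \<longleftrightarrow> p = q"
  using bij by (auto simp: bij_betw_def inj_on_def)

lemma row_tuple_dom: "j < 3 \<Longrightarrow> p \<in> rows j \<Longrightarrow> dom (row_tuple j p) = set (schema j)"
  using row_tuple_in wf by (auto simp: wf_rel_def)

lemma row_tuple_cols:
  assumes "j < 3" "p \<in> rows j"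
  shows "row_tuple j p (2 * j) = Some (inp p)" "row_tuple j p (2 * j + 1) = Some (inp (p + 1))"
    "row_tuple j p (2 * ((j + 1) mod 3)) = Some (inp (p + 2))" "row_tuple j p (2 * ((j + 1) mod 3) + 1) = Some (inp (p + 3))"
    "row_tuple j p (6 + j) = Some (inp (p + 4))"
  using row_tuple[OF assms, of 0] row_tuple[OF assms, of 1] row_tuple[OF assms, of 2] row_tuple[OF assms, of 3] row_tuple[OF assms, of 4]
  by (simp_all add: schema_def)

lemma n_eq: "j < 3 \<Longrightarrow> n j = card (I ! j)"
  using bij_betw_same_card[OF bij] by (simp add: card_rows)

text \<open>A shared variable is read from the relation that holds its block in columns 0 and 1; in
  a triangle the other relation with this block gives the same value.\<close>

definition joined :: "(nat \<Rightarrow> nat) \<Rightarrow> tuple" where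
  "joined \<tau> x = (if x < 6 then row_tuple (x div 2) (\<tau> (x div 2)) x else if x < 9 then row_tuple (x - 6) (\<tau> (x - 6)) x else None)"

lemma joined_col:
  assumes \<tau>: "\<tau> \<in> triangles" and j: "j < 3" and k: "k < 5"
  shows "joined \<tau> (schema j ! k) = Some (inp (\<tau> j + k))"
proof -
  define j1 where "j1 = (j + 1) mod 3"
  have j1: "j1 < 3" by (simp add: j1_def)
  have r: "\<tau> j \<in> rows j" "\<tau> j1 \<in> rows j1" and m: "agree (\<tau> j) (\<tau> j1)"
    using \<tau> j j1 by (auto simp: triangles_def j1_def)
  have schema: "schema j = [2 * j, 2 * j + 1, 2 * j1, 2 * j1 + 1, 6 + j]" by (simp add: schema_def j1_def)
  have jn: "joined \<tau> (2 * i) = row_tuple i (\<tau> i) (2 * i)" "joined \<tau> (2 * i + 1) = row_tuple i (\<tau> i) (2 * i + 1)"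
    "joined \<tau> (6 + i) = row_tuple i (\<tau> i) (6 + i)" if "i < 3" for i
    using that by (simp_all add: joined_def)
  consider "k = 0" | "k = 1" | "k = 2" | "k = 3" | "k = 4" using k by linarith
  then show ?thesis
  proof cases
    case 3
    then show ?thesis using jn(1)[OF j1] row_tuple_cols(1)[OF j1 r(2)] m unfolding schema agree_def by simp
  next
    case 4
    have "schema j ! 3 = 2 * j1 + 1" unfolding schema by (simp add: numeral_3_eq_3)
    then show ?thesis using 4 jn(2)[OF j1] row_tuple_cols(2)[OF j1 r(2)] m unfolding agree_def by simp
  next
    case 5
    have "schema j ! 4 = 6 + j" unfolding schema by (simp add: eval_nat_numeral)
    then show ?thesis using 5 jn(3)[OF j] row_tuple_cols(5)[OF j r(1)] by simp
  qed (use jn[OF j] row_tuple_cols[OF j r(1)] in \<open>simp_all add: schema\<close>)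
qed

lemma joined_restrict:
  assumes "\<tau> \<in> triangles" "j < 3"
  shows "joined \<tau> |` set (schema j) = row_tuple j (\<tau> j)"
proof
  fix x
  have r: "\<tau> j \<in> rows j" using assms by (auto simp: triangles_def)
  show "(joined \<tau> |` set (schema j)) x = row_tuple j (\<tau> j) x"
  proof (cases "x \<in> set (schema j)")
    case True
    then obtain k where "k < 5" "x = schema j ! k" by (auto simp: in_set_conv_nth)
    then show ?thesis using joined_col[OF assms] row_tuple[OF assms(2) r] True by simp
  next
    case False
    then have "x \<notin> dom (row_tuple j (\<tau> j))" using row_tuple_dom[OF assms(2) r] by simp
    then show ?thesis using False by (simp add: domIff)
  qed
qed

lemma dom_joined: "\<tau> \<in> triangles \<Longrightarrow> dom (joined \<tau>) = {..<9}"
proof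
  assume \<tau>: "\<tau> \<in> triangles"
  show "dom (joined \<tau>) \<subseteq> {..<9}" by (auto simp: joined_def split: if_splits)
  show "{..<9} \<subseteq> dom (joined \<tau>)"
  proof
    fix x :: nat assume "x \<in> {..<9}"
    then obtain j where "j < 3" "x \<in> set (schema j)" unfolding dom_union_schema by auto
    then show "x \<in> dom (joined \<tau>)"
      using joined_col[OF \<tau> \<open>j < 3\<close>] by (auto simp: in_set_conv_nth)
  qed
qed

lemma bij_joined: "bij_betw joined triangles (answer Q3 I)"
proof (rule bij_betwI')
  fix \<tau> \<sigma> assume \<tau>: "\<tau> \<in> triangles" "\<sigma> \<in> triangles"
  show "joined \<tau> = joined \<sigma> \<longleftrightarrow> \<tau> = \<sigma>"
  proof
    assume e: "joined \<tau> = joined \<sigma>"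
    show "\<tau> = \<sigma>"
    proof
      fix j
      show "\<tau> j = \<sigma> j"
      proof (cases "j < 3")
        case True
        then have "row_tuple j (\<tau> j) = row_tuple j (\<sigma> j)" using joined_restrict \<tau> e by metis
        then show ?thesis using row_tuple_eq[OF True] \<tau> True by (auto simp: triangles_def)
      qed (use \<tau> in \<open>auto simp: triangles_def\<close>)
    qed
  qed simp
next
  fix \<tau> assume "\<tau> \<in> triangles"
  then show "joined \<tau> \<in> answer Q3 I"
    using dom_joined joined_restrict row_tuple_in by (auto simp: answer_Q3[OF len] triangles_def)
next
  fix u assume "u \<in> answer Q3 I"
  then have u: "dom u = {..<9}" "\<And>j. j < 3 \<Longrightarrow> u |` set (schema j) \<in> I ! j" by (auto simp: answer_Q3[OF len])
  have "\<exists>p. p \<in> rows j \<and> row_tuple j p = u |` set (schema j)" if "j < 3" for j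
  proof -
    have "u |` set (schema j) \<in> row_tuple j ` rows j" using u(2)[OF that] bij[OF that] by (simp add: bij_betw_def)
    then show ?thesis by auto
  qed
  then obtain f where f: "\<And>j. j < 3 \<Longrightarrow> f j \<in> rows j \<and> row_tuple j (f j) = u |` set (schema j)" by metis
  define \<tau> where "\<tau> j = (if j < 3 then f j else 0)" for j
  have uc: "u x = row_tuple j (f j) x" if "j < 3" "x \<in> set (schema j)" for j x
    using f[OF that(1)] that(2) by simp
  have "\<tau> \<in> triangles"
  proof -
    have "agree (f j) (f ((j + 1) mod 3))" if j: "j < 3" for j
    proof -
      define j1 where "j1 = (j + 1) mod 3"
      have j1: "j1 < 3" by (simp add: j1_def)
      have "2 * j1 \<in> set (schema j) \<inter> set (schema j1)" "2 * j1 + 1 \<in> set (schema j) \<inter> set (schema j1)"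
        by (auto simp: schema_def j1_def)
      then have "row_tuple j (f j) (2 * j1) = row_tuple j1 (f j1) (2 * j1)" "row_tuple j (f j) (2 * j1 + 1) = row_tuple j1 (f j1) (2 * j1 + 1)"
        using uc[OF j, of "2 * j1"] uc[OF j1, of "2 * j1"] uc[OF j, of "2 * j1 + 1"] uc[OF j1, of "2 * j1 + 1"]
        by simp_all
      then show ?thesis
        using row_tuple_cols[of j "f j"] row_tuple_cols[of j1 "f j1"] f[OF j] f[OF j1] j j1
        by (simp add: agree_def j1_def)
    qed
    then show ?thesis using f by (auto simp: triangles_def \<tau>_def)
  qed
  moreover have "u = joined \<tau>"
  proof
    fix x
    show "u x = joined \<tau> x"
    proof (cases "x < 9")
      case True
      then have "x \<in> (\<Union>j<3. set (schema j))" using dom_union_schema by blast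
      then obtain j where j: "j < 3" "x \<in> set (schema j)" by auto
      have "joined \<tau> x = row_tuple j (\<tau> j) x"
        using joined_restrict[OF \<open>\<tau> \<in> triangles\<close> j(1)] j(2) by (metis restrict_in)
      then show ?thesis using uc[OF j] j(1) by (simp add: \<tau>_def)
    next
      case False
      then have "x \<notin> dom u" "x \<notin> dom (joined \<tau>)" using u(1) dom_joined[OF \<open>\<tau> \<in> triangles\<close>] by auto
      then show ?thesis by (simp add: domIff)
    qed
  qed
  ultimately show "\<exists>\<tau>\<in>triangles. u = joined \<tau>" by blast
qed

lemma row_joined:
  assumes "\<tau> \<in> triangles"
  shows "row (sorted_list_of_set (query_vars Q3)) (joined \<tau>) = output_row \<tau>"
proof -
  have s: "sorted_list_of_set {..<9::nat} = [0,1,2,3,4,5,6,7,8]"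
    unfolding lessThan_atLeast0 sorted_list_of_set_range by (simp add: upt_rec)
  have z: "schema 0 = [0,1,2,3,6]" "schema 1 = [2,3,4,5,7]" "schema 2 = [4,5,0,1,8]" by (simp_all add: schema_def)
  show ?thesis
    unfolding query_vars_Q3 s
    using joined_col[OF assms, of 0 0] joined_col[OF assms, of 0 1] joined_col[OF assms, of 0 2] joined_col[OF assms, of 0 3]
      joined_col[OF assms, of 1 2] joined_col[OF assms, of 1 3] joined_col[OF assms, of 0 4] joined_col[OF assms, of 1 4]
      joined_col[OF assms, of 2 4]
    unfolding z by (simp add: row_def output_row_def)
qed

text \<open>Here the constraints make the time uniform: a relation pays at most 4 * 6 * m^4 for its
  light rows, and there are at most (6 * m^2)^2 pairs of heavy rows. The factor 60000 rounds up 2000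
  * 18 + 208 * 72 + 208 * 36.\<close>

lemma wp_join_program_model:
  assumes I: "I \<in> models Q3 (PC3 m)"
    and s: "arrays s 0 = inp" "\<And>a i. a \<noteq> 0 \<Longrightarrow> arrays s a i = 0" "\<And>r. regs s r = 0" "out s = []"
    and st: "st 0 = 20" "\<And>j. j < 3 \<Longrightarrow> st (Suc j) = st j + 5 * n j + 1" "\<And>j. j < 3 \<Longrightarrow> inp (st j - 1) = n j"
  shows "\<exists>t s' ts. exec join_program s t s' \<and> distinct ts \<and> set ts = answer Q3 I \<and>
     out s' = concat (map (row (sorted_list_of_set (query_vars Q3))) ts) \<and> t \<le> 60000 * m ^ 4 + 2000"
proof -
  have M: "degree_bounds m j (I ! j)" "partitioned j (I ! j)" if "j < 3" for j using I that by (auto simp: models_PC3)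
  have nB: "n j \<le> 6 * m ^ 4" if "j < 3" for j using M(1)[OF that] n_eq[OF that] by (simp add: degree_bounds_def)
  have key: "p = q" if "j < 3" "p \<in> rows j" "q \<in> rows j" "inp p = inp q" "inp (p + 2) = inp (q + 2)" for j p q
  proof -
    have "row_tuple j p = row_tuple j q"
      using M(1)[OF that(1)] row_tuple_in[OF that(1)] row_tuple_cols[OF that(1)] that unfolding degree_bounds_def by metis
    then show ?thesis using row_tuple_eq that by blast
  qed
  \<comment> \<open>The partition of the tuples is transferred to addresses, with columns in place
    of variables.\<close>
  have "\<exists>src. (\<forall>p\<in>rows j. src p < (5::nat)) \<and> (\<forall>p\<in>rows j. \<forall>q\<in>rows j. src q = src p \<longrightarrow>
      inp (q + src p) = inp (p + src p) \<longrightarrow> q = p)" if j: "j < 3" for j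
  proof -
    obtain f where f: "\<And>t. t \<in> I ! j \<Longrightarrow> f t \<in> set (schema j)"
      "\<And>t t'. t \<in> I ! j \<Longrightarrow> t' \<in> I ! j \<Longrightarrow> f t' = f t \<Longrightarrow> t' (f t) = t (f t) \<Longrightarrow> t' = t"
      using M(2)[OF j] unfolding partitioned_def by blast
    have "\<exists>k<5. schema j ! k = f (row_tuple j p)" if "p \<in> rows j" for p
      using f(1)[OF row_tuple_in[OF j that]] by (auto simp: in_set_conv_nth)
    then obtain src where src: "\<And>p. p \<in> rows j \<Longrightarrow> src p < 5 \<and> schema j ! src p = f (row_tuple j p)" by metis
    have "q = p" if pq: "p \<in> rows j" "q \<in> rows j" "src q = src p" "inp (q + src p) = inp (p + src p)" for p q
    proof -
      have "f (row_tuple j q) = f (row_tuple j p)" using src[OF pq(1)] src[OF pq(2)] pq(3) by simp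
      moreover have "row_tuple j q (f (row_tuple j p)) = row_tuple j p (f (row_tuple j p))"
        using src[OF pq(1)] row_tuple[OF j pq(1), of "src p"] row_tuple[OF j pq(2), of "src p"] pq(4) by simp
      ultimately have "row_tuple j q = row_tuple j p" using f(2)[OF row_tuple_in[OF j pq(1)] row_tuple_in[OF j pq(2)]] by simp
      then show ?thesis using row_tuple_eq[OF j] pq by simp
    qed
    then show ?thesis using src by blast
  qed
  then obtain src where src: "\<And>j p. j < 3 \<Longrightarrow> p \<in> rows j \<Longrightarrow> src j p < (5::nat)"
    "\<And>j p q. j < 3 \<Longrightarrow> p \<in> rows j \<Longrightarrow> q \<in> rows j \<Longrightarrow> src j q = src j p \<Longrightarrow>
      inp (q + src j p) = inp (p + src j p) \<Longrightarrow> q = p" by metis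
  obtain t s' h where ex: "exec join_program s t s'" and
    h': "\<forall>j<3. \<forall>p\<in>rows j. h j (inp (p + 4)) \<in> col_rows j 4 (inp (p + 4)) \<and> cost j p \<le> cost j (h j (inp (p + 4)))" and
    t: "0 + t \<le> 0 + 2000 * (n 0 + n 1 + n 2 + 1) +
       208 * (\<Sum>j<3. \<Sum>p\<in>{p \<in> rows j. h j (inp (p + 4)) \<noteq> p}. cost j p) +
       208 * card {p \<in> rows 0. h 0 (inp (p + 4)) = p} * card {p \<in> rows 1. h 1 (inp (p + 4)) = p}" and
    o: "has_output s' triangles"
  proof -
    have "wp join_program (join_program_post 0) 0 s" by (rule wp_join_program) (use s st key in auto)
    then show thesis unfolding wp_def join_program_post_def by (elim exE conjE) (erule (3) that)
  qed
  have h: "h j (inp (p + 4)) \<in> col_rows j 4 (inp (p + 4)) \<and> cost j p \<le> cost j (h j (inp (p + 4)))"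
    if "j < 3" "p \<in> rows j" for j p using h' that by blast
  have light: "(\<Sum>p\<in>{p \<in> rows j. h j (inp (p + 4)) \<noteq> p}. cost j p) \<le> 4 * (6 * m ^ 4)" if j: "j < 3" for j
  proof (rule light_cost_le[where src = "src j", OF j])
    show "n i \<le> 6 * m ^ 4" if "i < 3" for i by (rule nB[OF that])
    show "src j p < 5" if "p \<in> rows j" for p by (rule src(1)[OF j that])
    show "q = p" if "p \<in> rows j" "q \<in> rows j" "src j q = src j p" "inp (q + src j p) = inp (p + src j p)" for p q
      by (rule src(2)[OF j that])
    show "h j (inp (p + 4)) \<in> col_rows j 4 (inp (p + 4)) \<and> cost j p \<le> cost j (h j (inp (p + 4)))" if "p \<in> rows j" for p
      by (rule h[OF j that])
  qed
  have "(\<Sum>j<3. \<Sum>p\<in>{p \<in> rows j. h j (inp (p + 4)) \<noteq> p}. cost j p) \<le> (\<Sum>j<(3::nat). 4 * (6 * m ^ 4))"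
    by (rule sum_mono, rule light) simp
  then have ll: "(\<Sum>j<3. \<Sum>p\<in>{p \<in> rows j. h j (inp (p + 4)) \<noteq> p}. cost j p) \<le> 72 * m ^ 4"
    by simp
  have c: "card {p \<in> rows j. h j (inp (p + 4)) = p} \<le> 6 * m ^ 2" if "j < 3" for j
  proof -
    have "(\<lambda>t. t (6 + j)) ` (I ! j) = (\<lambda>p. row_tuple j p (6 + j)) ` rows j"
      unfolding bij_betw_imp_surj_on[OF bij[OF that], symmetric] image_image ..
    also have "\<dots> = Some ` ((\<lambda>p. inp (p + 4)) ` rows j)"
      unfolding image_image using row_tuple_cols(5)[OF that] by (intro image_cong) auto
    finally have "card ((\<lambda>p. inp (p + 4)) ` rows j) = card ((\<lambda>t. t (6 + j)) ` (I ! j))"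
      by (simp add: card_image)
    then show ?thesis using M(1)[OF that] heavy_count_le[where h = "h j" and j = j] by (simp add: degree_bounds_def)
  qed
  have "card {p \<in> rows 0. h 0 (inp (p + 4)) = p} * card {p \<in> rows 1. h 1 (inp (p + 4)) = p} \<le> 6 * m ^ 2 * (6 * m ^ 2)"
    by (intro mult_le_mono c) auto
  also have "6 * m ^ 2 * (6 * m ^ 2) = 36 * m ^ 4"
    by (simp add: power2_eq_square power4_eq_xxxx)
  finally have hh: "208 * card {p \<in> rows 0. h 0 (inp (p + 4)) = p} * card {p \<in> rows 1. h 1 (inp (p + 4)) = p}
      \<le> 208 * (36 * m ^ 4)" by (simp only: mult.assoc mult_le_mono2)
  have "n 0 \<le> 6 * m ^ 4" "n 1 \<le> 6 * m ^ 4" "n 2 \<le> 6 * m ^ 4" by (auto intro: nB)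
  moreover have "t \<le> 60000 * M + 2000"
    if "a \<le> 6 * M" "b \<le> 6 * M" "c \<le> 6 * M" "0 + t \<le> 0 + 2000 * (a + b + c + 1) + 208 * S + P"
       "S \<le> 72 * M" "P \<le> 208 * (36 * M)" for a b c S P M :: nat
    using that by simp
  ultimately have "t \<le> 60000 * m ^ 4 + 2000" using t ll hh by blast
  moreover obtain ts where ts: "distinct ts" "set ts = triangles" "out s' = concat (map output_row ts)"
    using o by (auto simp: has_output_def)
  have "distinct (map joined ts)" "set (map joined ts) = answer Q3 I"
    using ts bij_joined by (auto simp: bij_betw_def distinct_map)
  moreover have "map (row (sorted_list_of_set (query_vars Q3))) (map joined ts) = map output_row ts"
    using ts(2) row_joined by (auto simp: comp_def)
  ultimately show ?thesis using ex ts(3) \<open>t \<le> _\<close> by metis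
qed

end

section \<open>Decoding the input array\<close>

lemma length_concat_5: "\<forall>r\<in>set rs. length r = 5 \<Longrightarrow> length (concat rs) = 5 * length rs"
  by (induction rs) auto

lemma nth_concat_5:
  "\<forall>r\<in>set rs. length r = 5 \<Longrightarrow> i < length rs \<Longrightarrow> k < 5 \<Longrightarrow> concat rs ! (5 * i + k) = rs ! i ! k"
proof (induction rs arbitrary: i)
  case (Cons r rs)
  then show ?case by (cases i) (auto simp: nth_append)
qed simp

definition block :: "nat list list \<Rightarrow> nat list" where
  "block rs = length rs # concat rs"

lemma block_nth:
  assumes "\<forall>rs\<in>set D. \<forall>r\<in>set rs. length r = 5" "j < length D"
  defines "off \<equiv> (\<Sum>i<j. 5 * length (D ! i) + 1)"
  shows "off < length (concat (map block D))" "concat (map block D) ! off = length (D ! j)"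
    "i < length (D ! j) \<Longrightarrow> k < 5 \<Longrightarrow> off + 1 + (5 * i + k) < length (concat (map block D)) \<and>
       concat (map block D) ! (off + 1 + (5 * i + k)) = D ! j ! i ! k"
proof -
  have "length (concat (map block (take j' D))) = (\<Sum>i<j'. 5 * length (D ! i) + 1)" if "j' \<le> length D" for j'
    using that
  proof (induction j')
    case (Suc j')
    have "D ! j' \<in> set D" using Suc.prems by simp
    then have "\<forall>r\<in>set (D ! j'). length r = 5" using assms(1) by blast
    then show ?case using Suc
      by (simp add: take_Suc_conv_app_nth block_def length_concat_5[of "D ! j'"])
  qed simp
  then have l: "length (concat (map block (take j D))) = off" using assms(2) by (simp add: off_def)
  have e: "concat (map block D) = concat (map block (take j D)) @ block (D ! j) @ concat (map block (drop (Suc j) D))"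
    by (subst id_take_nth_drop[OF assms(2)]) simp
  have "D ! j \<in> set D" using assms(2) by simp
  then have D5: "\<forall>r\<in>set (D ! j). length r = 5" using assms(1) by blast
  show "off < length (concat (map block D))" unfolding e by (simp add: l block_def)
  show "concat (map block D) ! off = length (D ! j)" unfolding e by (simp add: nth_append l block_def)
  assume "i < length (D ! j)" "k < 5"
  then have "5 * i + k < length (concat (D ! j))" using length_concat_5[OF D5] by simp
  then show "off + 1 + (5 * i + k) < length (concat (map block D)) \<and>
       concat (map block D) ! (off + 1 + (5 * i + k)) = D ! j ! i ! k"
    unfolding e using nth_concat_5[OF D5] \<open>i < _\<close> \<open>k < 5\<close>
    by (simp add: nth_append l block_def)
qed

lemma join_program_correct:
  assumes I: "I \<in> models Q3 (PC3 m)" and D: "is_listing Q3 I D"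
  shows "\<exists>t s' ts. exec join_program (init_state (encode Q3 D)) t s' \<and> distinct ts \<and> set ts = answer Q3 I \<and>
     out s' = concat (map (row (sorted_list_of_set (query_vars Q3))) ts) \<and> t \<le> 60000 * m ^ 4 + 2000"
proof -
  have len: "length D = 3" "length I = 3" and wf: "\<And>j. j < 3 \<Longrightarrow> wf_rel j (I ! j)"
    and dist: "\<And>j. j < 3 \<Longrightarrow> distinct (D ! j)" and setD: "\<And>j. j < 3 \<Longrightarrow> set (D ! j) = row (schema j) ` (I ! j)"
    using I D by (auto simp: models_PC3 is_listing_def Q3_nth)
  have D5: "\<forall>rs\<in>set D. \<forall>r\<in>set rs. length r = 5"
  proof (intro ballI)
    fix rs r assume "rs \<in> set D" "r \<in> set rs"
    then obtain j where "j < 3" "r \<in> set (D ! j)" by (auto simp: in_set_conv_nth len)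
    then show "length r = 5" using setD by (auto simp: row_def schema_def)
  qed
  define xs where "xs = encode Q3 D"
  define inp where "inp i = (if i < length xs then xs ! i else 0)" for i
  define n where "n j = length (D ! j)" for j
  define st where "st j = 20 + (\<Sum>i<j. 5 * n i + 1)" for j
  define pre where "pre = length Q3 # concat (map (\<lambda>z. length z # z) Q3)"
  have pre: "length pre = 19" by (simp add: pre_def Q3_def schema_def)
  have xs: "xs = pre @ concat (map block D)" by (simp add: xs_def encode_def pre_def block_def[abs_def])
  have cnt: "inp (st j - 1) = n j" if "j < 3" for j
    using block_nth(1,2)[OF D5, of j] that
    by (simp add: inp_def xs nth_append pre st_def n_def len)
  have ent: "inp (st j + 5 * i + k) = D ! j ! i ! k" if "j < 3" "i < n j" "k < 5" for j i k
    using block_nth(3)[OF D5, of j i k] that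
    by (simp add: inp_def xs nth_append pre st_def n_def len add.assoc)
  interpret layout inp st n by standard (simp add: st_def)
  have "\<exists>t. t \<in> I ! j \<and> (\<forall>k<5. t (schema j ! k) = Some (inp (p + k)))" if j: "j < 3" and p: "p \<in> rows j" for j p
  proof -
    obtain i where i: "i < n j" "p = st j + 5 * i" using p by (auto simp: rows_def rows_upto_def)
    then have "D ! j ! i \<in> row (schema j) ` (I ! j)" using setD[OF j] by (auto simp: n_def)
    then obtain t where t: "t \<in> I ! j" "D ! j ! i = row (schema j) t" by auto
    have "t (schema j ! k) = Some (inp (p + k))" if k: "k < 5" for k
    proof -
      have l: "length (schema j) = 5" by (simp add: schema_def)
      then have "schema j ! k \<in> dom t" using wf[OF j] t(1) k by (simp add: wf_rel_def)
      moreover have "inp (p + k) = the (t (schema j ! k))"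
        using ent[OF j i(1) k] i(2) t(2) k l by (simp add: row_def)
      ultimately show ?thesis by auto
    qed
    with t show ?thesis by blast
  qed
  then obtain row_tuple where row_tuple: "\<And>j p. j < 3 \<Longrightarrow> p \<in> rows j \<Longrightarrow> row_tuple j p \<in> I ! j"
     "\<And>j p k. j < 3 \<Longrightarrow> p \<in> rows j \<Longrightarrow> k < 5 \<Longrightarrow> row_tuple j p (schema j ! k) = Some (inp (p + k))" by metis
  have row_row_tuple: "row (schema j) (row_tuple j (st j + 5 * i)) = D ! j ! i" if j: "j < 3" and i: "i < n j" for i j
  proof (rule nth_equalityI)
    have l: "length (schema j) = 5" by (simp add: schema_def)
    have "D ! j \<in> set D" "D ! j ! i \<in> set (D ! j)" using i j len by (simp_all add: n_def)
    then have r: "length (D ! j ! i) = 5" using D5 by blast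
    show "length (row (schema j) (row_tuple j (st j + 5 * i))) = length (D ! j ! i)" by (simp add: row_def l r)
    fix k assume "k < length (row (schema j) (row_tuple j (st j + 5 * i)))"
    then have "k < 5" by (simp add: row_def l)
    then show "row (schema j) (row_tuple j (st j + 5 * i)) ! k = D ! j ! i ! k"
      using row_tuple(2)[OF j rows_upto_rows(1)[OF i]] ent[OF j i] by (simp add: row_def l)
  qed
  have row_inj: "t = u" if "j < 3" "t \<in> I ! j" "u \<in> I ! j" "row (schema j) t = row (schema j) u" for j t u
  proof
    fix x
    show "t x = u x"
    proof (cases "x \<in> set (schema j)")
      case True
      then have "x \<in> dom t" "x \<in> dom u" using wf[OF that(1)] that by (simp_all add: wf_rel_def)
      then show ?thesis using that(4) True by (auto simp: row_def)
    next
      case False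
      then have "x \<notin> dom t" "x \<notin> dom u" using wf[OF that(1)] that by (simp_all add: wf_rel_def)
      then show ?thesis by (simp add: domIff)
    qed
  qed
  have bij: "bij_betw (row_tuple j) (rows j) (I ! j)" if j: "j < 3" for j
  proof (rule bij_betw_imageI)
    show "inj_on (row_tuple j) (rows j)"
    proof (rule inj_onI)
      fix p q assume *: "p \<in> rows j" "q \<in> rows j" "row_tuple j p = row_tuple j q"
      then obtain i i' where i: "i < n j" "p = st j + 5 * i" "i' < n j" "q = st j + 5 * i'"
        by (auto simp: rows_def rows_upto_def)
      then have "D ! j ! i = D ! j ! i'" using row_row_tuple[OF j] * by metis
      then show "p = q" using i dist[OF j] by (simp add: nth_eq_iff_index_eq n_def)
    qed
    show "row_tuple j ` rows j = I ! j"
    proof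
      show "row_tuple j ` rows j \<subseteq> I ! j" using row_tuple(1)[OF j] by auto
      show "I ! j \<subseteq> row_tuple j ` rows j"
      proof
        fix t assume t: "t \<in> I ! j"
        then have "row (schema j) t \<in> set (D ! j)" using setD[OF j] by auto
        then obtain i where i: "i < n j" "D ! j ! i = row (schema j) t" by (auto simp: in_set_conv_nth n_def)
        have "row_tuple j (st j + 5 * i) = t"
          using row_inj[OF j row_tuple(1)[OF j rows_upto_rows(1)[OF i(1)]] t] row_row_tuple[OF j i(1)] i(2) by simp
        then show "t \<in> row_tuple j ` rows j" using rows_upto_rows(1)[OF i(1)] by blast
      qed
    qed
  qed
  interpret presented inp st n I row_tuple
    by standard (use len wf bij row_tuple in auto)
  show ?thesis
  proof (rule wp_join_program_model[OF I])
    show "inp (st j - 1) = n j" if "j < 3" for j by (rule cnt[OF that])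
  qed (auto simp: init_state_def inp_def xs_def st_def fun_eq_iff)
qed

text \<open>A time unit produces at most one number, so any running time of an enumeration bounds
  the size of the answer.\<close>

lemma exec_out_length: "exec p s t s' \<Longrightarrow> length (out s') \<le> length (out s) + t"
  by (induction rule: exec.induct) auto

lemma listing_exists: "\<exists>D. is_listing Q I D" if "is_database Q I"
proof -
  have f: "finite (row (Q ! i) ` (I ! i))" if "i < length Q" for i
    using \<open>is_database Q I\<close> that by (auto simp: is_database_def list_all2_conv_all_nth)
  define D where "D = map (\<lambda>i. SOME l. distinct l \<and> set l = row (Q ! i) ` (I ! i)) [0..<length Q]"
  have "distinct (D ! i) \<and> set (D ! i) = row (Q ! i) ` (I ! i)" if "i < length Q" for i
  proof -
    have "\<exists>l. distinct l \<and> set l = row (Q ! i) ` (I ! i)"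
      using finite_distinct_list[OF f[OF that]] by blast
    from someI_ex[OF this] show ?thesis using that by (simp add: D_def)
  qed
  then show ?thesis unfolding is_listing_def by (intro exI[of _ D]) (simp add: D_def)
qed

lemma enumerates_join_program: "I \<in> models Q3 (PC3 m) \<Longrightarrow> enumerates join_program Q3 I"
  unfolding enumerates_def using join_program_correct by blast

lemma run_time_join_program:
  assumes "I \<in> models Q3 (PC3 m)"
  shows "run_time join_program Q3 I \<le> 60000 * m ^ 4 + 2000"
proof -
  let ?T = "{t. \<exists>D s. is_listing Q3 I D \<and> exec join_program (init_state (encode Q3 D)) t s}"
  have T: "?T \<subseteq> {..60000 * m ^ 4 + 2000}"
    using join_program_correct[OF assms] exec_deterministic by (fastforce)
  obtain D where "is_listing Q3 I D" using listing_exists[of Q3 I] assms unfolding models_def by blast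
  then have "?T \<noteq> {}" using join_program_correct[OF assms] by blast
  then show ?thesis unfolding run_time_def
    using T finite_subset[OF T] by (subst Max_le_iff) auto
qed

text \<open>The join program serves as the proof of this bound: it emits nine numbers per answer
  within the stated time.\<close>

lemma card_answer_model:
  assumes "I \<in> models Q3 (PC3 m)"
  shows "card (answer Q3 I) \<le> 60000 * m ^ 4 + 2000"
proof -
  obtain D where "is_listing Q3 I D" using listing_exists[of Q3 I] assms unfolding models_def by blast
  then obtain t s ts where *: "exec join_program (init_state (encode Q3 D)) t s" "distinct ts" "set ts = answer Q3 I"
     "out s = concat (map (row (sorted_list_of_set (query_vars Q3))) ts)" "t \<le> 60000 * m ^ 4 + 2000"
    using join_program_correct[OF assms] by blast
  have "length (out s) = 9 * length ts"
    unfolding *(4) query_vars_Q3 by (induction ts) (auto simp: row_def)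
  then have "length ts \<le> t" using exec_out_length[OF *(1)] by (simp add: init_state_def)
  moreover have "card (answer Q3 I) = length ts" using distinct_card *(2,3) by metis
  ultimately show ?thesis using *(5) by simp
qed

lemma bdd_PC3: "bdd_above ((\<lambda>I. card (answer Q3 I)) ` models Q3 (PC3 m))"
  by (rule bdd_aboveI[of _ "60000 * m ^ 4 + 2000"]) (use card_answer_model in auto)

lemma empty_model: "[{}, {}, {}] \<in> models Q3 (PC3 m)"
  by (auto simp: models_PC3 wf_rel_def degree_bounds_def partitioned_def less_3)

lemma comb_bound_PC3_le: "comb_bound Q3 (PC3 m) \<le> 60000 * m ^ 4 + 2000"
  unfolding comb_bound_def using empty_model card_answer_model by (intro cSUP_least) auto

lemma comb_bound_PC3_ge: "I \<in> models Q3 (PC3 m) \<Longrightarrow> card (answer Q3 I) \<le> comb_bound Q3 (PC3 m)"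
  unfolding comb_bound_def by (rule cSUP_upper[OF _ bdd_PC3])

section \<open>Databases attaining the bounds\<close>

definition atom_tuple :: "nat \<Rightarrow> (nat \<Rightarrow> nat) \<Rightarrow> tuple" where
  "atom_tuple j a x = (if x \<in> set (schema j) then Some (a x) else None)"

lemma dom_atom_tuple [simp]: "dom (atom_tuple j a) = set (schema j)"
  by (auto simp: atom_tuple_def split: if_splits)

text \<open>All relations are projections of one set of assignments, so that each member of
  \<open>A\<close> gives an answer.\<close>

definition uniform_database :: "(nat \<Rightarrow> nat) set \<Rightarrow> database" where
  "uniform_database A = map (\<lambda>j. atom_tuple j ` A) [0, 1, 2]"

lemma uniform_database_nth: "j < 3 \<Longrightarrow> uniform_database A ! j = atom_tuple j ` A"
  unfolding less_3 by (auto simp: uniform_database_def)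

text \<open>Assignments are total functions; fixing them to 0 beyond the nine variables makes
  distinct ones give distinct answers.\<close>

lemma card_answer_uniform_database:
  assumes "finite A" "\<And>a x. a \<in> A \<Longrightarrow> x \<ge> 9 \<Longrightarrow> a x = 0"
  shows "card A \<le> card (answer Q3 (uniform_database A))"
proof (rule card_inj_on_le)
  let ?f = "\<lambda>a x :: nat. if x < 9 then Some (a x :: nat) else None"
  have l: "length (uniform_database A) = 3" by (simp add: uniform_database_def)
  show "finite (answer Q3 (uniform_database A))"
    using card_answer_le[OF l] assms(1) by (simp add: uniform_database_nth)
  show "inj_on ?f A"
  proof (rule inj_onI)
    fix a b assume *: "a \<in> A" "b \<in> A" "?f a = ?f b"
    show "a = b"
    proof
      fix x
      show "a x = b x"
        using fun_cong[OF *(3), of x] assms(2)[OF *(1), of x] assms(2)[OF *(2), of x]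
        by (auto split: if_splits)
    qed
  qed
  have "?f a |` set (schema j) = atom_tuple j a" if "j < 3" for a j
  proof
    fix x
    have "x < 9" if "x \<in> set (schema j)" using \<open>j < 3\<close> that dom_union_schema by blast
    then show "(?f a |` set (schema j)) x = atom_tuple j a x" by (simp add: restrict_map_def atom_tuple_def)
  qed
  moreover have "dom (?f a) = {..<9}" for a :: "nat \<Rightarrow> nat" by (auto split: if_splits)
  ultimately show "?f ` A \<subseteq> answer Q3 (uniform_database A)" by (auto simp: answer_Q3[OF l] uniform_database_nth)
qed

lemma card_subset_singleton: "A \<subseteq> {x} \<Longrightarrow> card A \<le> 1"
  by (drule subset_singletonD) auto

text \<open>All shared variables carry the same value, which makes every shared column a
  key.\<close>

definition diagonal :: "nat \<Rightarrow> (nat \<Rightarrow> nat) set" where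
  "diagonal m = (\<lambda>u x. if x < 6 then u else 0) ` {..<m}"

text \<open>Only the first variable of each block varies, so columns 0 and 2 determine a row, as the
  degree constraints demand.\<close>

definition grid :: "nat \<Rightarrow> (nat \<Rightarrow> nat) set" where
  "grid m = (\<lambda>(u, v, w) x. if x = 0 then u else if x = 2 then v else if x = 4 then w else 0) `
     ({..<m} \<times> {..<m} \<times> {..<m})"

lemma schema_less_6: "j < 3 \<Longrightarrow> 2 * j < 6 \<and> 2 * ((j + 1) mod 3) < (6::nat)"
  unfolding less_3 by auto

lemma diagonal_model:
  assumes "n > 0"
  shows "uniform_database (diagonal (n ^ 4)) \<in> models Q3 (PC3 n)"
  unfolding models_PC3
proof (intro conjI allI impI)
  fix j :: nat assume j: "j < 3"
  let ?R = "uniform_database (diagonal (n ^ 4)) ! j"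
  have R: "?R = (\<lambda>u. atom_tuple j (\<lambda>x. if x < 6 then u else 0)) ` {..<n ^ 4}"
    by (simp add: uniform_database_nth[OF j] diagonal_def image_image)
  show "wf_rel j ?R" by (auto simp: wf_rel_def R)
  have key: "atom_tuple j (\<lambda>x. if x < 6 then u else 0) (2 * j) = Some u" for u
    using schema_less_6[OF j] schema_subset(1) by (simp add: atom_tuple_def)
  have "card ?R \<le> card {..<n ^ 4}" unfolding R by (rule card_image_le) simp
  then have "card ?R \<le> 6 * n ^ 4" by simp
  moreover have "(\<lambda>t. t (6 + j)) ` ?R \<subseteq> {Some 0}" by (auto simp: R atom_tuple_def schema_def)
  then have "card ((\<lambda>t. t (6 + j)) ` ?R) \<le> 1" by (rule card_subset_singleton)
  then have "card ((\<lambda>t. t (6 + j)) ` ?R) \<le> 6 * n ^ 2" using assms one_le_power[of n 2] by linarith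
  ultimately show "degree_bounds n j ?R" by (auto simp: degree_bounds_def R key)
  show "partitioned j ?R" unfolding partitioned_def using schema_subset(1)
    by (intro exI[of _ "\<lambda>_. 2 * j"]) (auto simp: R key)
qed (simp add: uniform_database_def)

lemma grid_model:
  assumes "n > 0"
  shows "uniform_database (grid (n ^ 2)) \<in> models Q3 (degree_constraints (PC3 n))"
  unfolding models_DC3
proof (intro conjI allI impI)
  fix j :: nat assume j: "j < 3"
  define j1 where "j1 = (j + 1) mod 3"
  let ?R = "uniform_database (grid (n ^ 2)) ! j"
  define f where "f = (\<lambda>(u, v). atom_tuple j (\<lambda>x. if x = 2 * j then u else if x = 2 * j1 then v else 0))"
  have ne: "j1 \<noteq> j" using j unfolding j1_def less_3 by auto
  have R: "?R \<subseteq> f ` ({..<n ^ 2} \<times> {..<n ^ 2})"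
  proof
    fix t assume "t \<in> ?R"
    then obtain u v w where uvw: "u < n ^ 2" "v < n ^ 2" "w < n ^ 2"
      "t = atom_tuple j (\<lambda>x. if x = 0 then u else if x = 2 then v else if x = 4 then w else 0)"
      by (auto simp: uniform_database_nth[OF j] grid_def)
    have "t = f (if j = 0 then u else if j = 1 then v else w, if j = 0 then v else if j = 1 then w else u)"
      unfolding uvw(4) f_def using j unfolding less_3
      by (elim disjE) (auto simp: fun_eq_iff atom_tuple_def schema_def j1_def)
    then show "t \<in> f ` ({..<n ^ 2} \<times> {..<n ^ 2})" using uvw by auto
  qed
  have "finite ?R" using finite_subset[OF R] by simp
  then show "wf_rel j ?R" using R by (auto simp: wf_rel_def uniform_database_nth[OF j])
  have key: "f (u, v) (2 * j) = Some u" "f (u, v) (2 * j1) = Some v" for u v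
    using ne by (simp_all add: f_def atom_tuple_def schema_def j1_def)
  have "card ?R \<le> card (f ` ({..<n ^ 2} \<times> {..<n ^ 2}))" by (rule card_mono[OF _ R]) simp
  also have "\<dots> \<le> card ({..<n ^ 2} \<times> {..<n ^ 2})" by (rule card_image_le) simp
  also have "\<dots> = n ^ 4" by (simp flip: power_add)
  finally have "card ?R \<le> 6 * n ^ 4" by simp
  moreover have "(\<lambda>t. t (6 + j)) ` ?R \<subseteq> {Some 0}" using j by (auto simp: uniform_database_nth[OF j] grid_def atom_tuple_def schema_def)
  then have "card ((\<lambda>t. t (6 + j)) ` ?R) \<le> 1" by (rule card_subset_singleton)
  then have "card ((\<lambda>t. t (6 + j)) ` ?R) \<le> 6 * n ^ 2" using assms one_le_power[of n 2] by linarith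
  moreover have "t = t'" if "t \<in> ?R" "t' \<in> ?R" "t (2 * j) = t' (2 * j)" "t (2 * j1) = t' (2 * j1)" for t t'
    using subsetD[OF R that(1)] subsetD[OF R that(2)] that(3,4) key by auto
  ultimately show "degree_bounds n j ?R" by (auto simp: degree_bounds_def j1_def)
qed (simp add: uniform_database_def)

lemma comb_bound_PC3_lower:
  assumes "n > 0"
  shows "n ^ 4 \<le> comb_bound Q3 (PC3 n)"
proof -
  have "inj_on (\<lambda>u (x::nat). if x < 6 then u else (0::nat)) {..<n ^ 4}"
    by (rule inj_onI) (auto simp: fun_eq_iff dest: spec[of _ "0::nat"])
  then have "card (diagonal (n ^ 4)) = n ^ 4" by (simp add: diagonal_def card_image)
  moreover have "card (diagonal (n ^ 4)) \<le> card (answer Q3 (uniform_database (diagonal (n ^ 4))))"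
    by (rule card_answer_uniform_database) (auto simp: diagonal_def)
  ultimately show ?thesis using comb_bound_PC3_ge[OF diagonal_model[OF assms]] by simp
qed

lemma comb_bound_DC3_lower:
  assumes "n > 0"
  shows "n ^ 6 \<le> comb_bound Q3 (degree_constraints (PC3 n))"
proof -
  let ?g = "\<lambda>(u, v, w) (x::nat). if x = 0 then u else if x = 2 then v else if x = 4 then w else (0::nat)"
  have "inj ?g"
  proof (rule injI)
    fix a b :: "nat \<times> nat \<times> nat"
    assume e: "?g a = ?g b"
    show "a = b" using fun_cong[OF e, of 0] fun_cong[OF e, of 2] fun_cong[OF e, of "4::nat"]
      by (auto split: prod.splits)
  qed
  then have "card (grid (n ^ 2)) = n ^ 2 * (n ^ 2 * n ^ 2)"
    unfolding grid_def by (subst card_image) (auto intro: inj_on_subset simp: card_cartesian_product)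
  also have "\<dots> = n ^ 6" by (simp flip: power_add)
  finally have "card (grid (n ^ 2)) = n ^ 6" .
  moreover have "card (grid (n ^ 2)) \<le> card (answer Q3 (uniform_database (grid (n ^ 2))))"
    by (rule card_answer_uniform_database) (auto simp: grid_def)
  ultimately show ?thesis using comb_bound_ge[OF grid_model[OF assms]] by simp
qed

section \<open>A database that is bad for every ordering\<close>

lemma finite_natural_joined:
  assumes "\<And>j. j < length Zs \<Longrightarrow> finite (Rs ! j)"
  shows "finite (natural_join Zs Rs)"
proof (rule inj_on_finite)
  let ?f = "\<lambda>t. map (\<lambda>j. t |` (Zs ! j)) [0..<length Zs]"
  let ?U = "\<Union>j<length Zs. Rs ! j"
  show "finite {l. set l \<subseteq> ?U \<and> length l = length Zs}"
    by (rule finite_lists_length_eq) (use assms in auto)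
  show "?f ` natural_join Zs Rs \<subseteq> {l. set l \<subseteq> ?U \<and> length l = length Zs}"
    by (fastforce simp: natural_join_def)
  show "inj_on ?f (natural_join Zs Rs)"
  proof (rule inj_onI)
    fix t u assume t: "t \<in> natural_join Zs Rs" "u \<in> natural_join Zs Rs" "?f t = ?f u"
    then have d: "dom t = \<Union> (set Zs)" "dom u = \<Union> (set Zs)" by (auto simp: natural_join_def)
    show "t = u"
    proof
      fix x
      show "t x = u x"
      proof (cases "x \<in> \<Union> (set Zs)")
        case True
        then obtain j where "j < length Zs" "x \<in> Zs ! j" by (auto simp: in_set_conv_nth)
        then have "t |` (Zs ! j) = u |` (Zs ! j)" using t(3) by (auto simp: map_eq_conv)
        then show ?thesis using \<open>x \<in> Zs ! j\<close> by (simp add: restrict_eq_iff)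
      next
        case False
        then have "x \<notin> dom t" "x \<notin> dom u" using d by simp_all
        then show ?thesis by (simp add: domIff)
      qed
    qed
  qed
qed

text \<open>
  All values of the part for \<open>z\<close> are tagged with \<open>z\<close>, which makes the six parts disjoint.  The block of \<open>z\<close> ranges
  over \<open>n\<^sup>3\<close> values and the other two blocks over \<open>n\<close> values.  The variable \<open>z\<close> itself carries the pair of the block
  values of the row, so it is a key in both of its relations; in the third relation the private
  column is the key.
\<close>

definition in_atom :: "nat \<Rightarrow> nat \<Rightarrow> bool" where
  "in_atom j z \<longleftrightarrow> z \<in> {2 * j, 2 * j + 1, 2 * ((j + 1) mod 3), 2 * ((j + 1) mod 3) + 1}"

definition tagged :: "nat \<Rightarrow> nat \<Rightarrow> nat" where
  "tagged a b = prod_encode (a, b)"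

lemma tagged_eq [simp]: "tagged a b = tagged a' b' \<longleftrightarrow> a = a' \<and> b = b'"
  by (simp add: tagged_def prod_encode_eq)

text \<open>\<open>u\<close> and \<open>v\<close> are the values of the two blocks of the row. The
  private column is constant in the big relations, whose n^4 rows would exceed its bound; the grid
  can afford the pair.\<close>

definition hard_entry :: "nat \<Rightarrow> nat \<Rightarrow> nat \<Rightarrow> nat \<Rightarrow> nat \<Rightarrow> nat" where
  "hard_entry j z u v x =
     (if x = z then tagged z (tagged u v)
      else if x = 2 * j \<or> x = 2 * j + 1 then tagged z u
      else if x < 6 then tagged z v
      else if in_atom j z then tagged z 0 else tagged z (tagged u v))"

definition side :: "nat \<Rightarrow> nat \<Rightarrow> nat \<Rightarrow> nat" where
  "side n z b = (if b = z div 2 then n ^ 3 else n)"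

definition hard_relation :: "nat \<Rightarrow> nat \<Rightarrow> relation" where
  "hard_relation n j = (\<Union>z<6. (\<lambda>(u, v). atom_tuple j (hard_entry j z u v)) ` ({..<side n z j} \<times> {..<side n z ((j + 1) mod 3)}))"

definition hard_database :: "nat \<Rightarrow> database" where
  "hard_database n = map (hard_relation n) [0, 1, 2]"

lemma hard_database_nth: "j < 3 \<Longrightarrow> hard_database n ! j = hard_relation n j"
  unfolding less_3 by (auto simp: hard_database_def)

lemma map2_hard_database_nth: "j < 3 \<Longrightarrow> map2 f Q3 (hard_database n) ! j = f (schema j) (hard_relation n j)"
  unfolding less_3 by (auto simp: hard_database_def Q3_def)

lemma hard_relationE:
  assumes "t \<in> hard_relation n j"
  obtains z u v where "z < 6" "u < side n z j" "v < side n z ((j + 1) mod 3)" "t = atom_tuple j (hard_entry j z u v)"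
  using assms by (auto simp: hard_relation_def)

text \<open>Every column shows the tag, so rows of different parts agree in no column and each
  constraint can be checked part by part.\<close>

lemma hard_entry_tag:
  "x \<in> set (schema j) \<Longrightarrow> hard_entry j z u v x = hard_entry j z' u' v' x \<Longrightarrow> z = z'"
  by (auto simp: hard_entry_def split: if_splits)

lemma atom_tuple_eqD: "atom_tuple j a x = atom_tuple j b x \<Longrightarrow> x \<in> set (schema j) \<Longrightarrow> a x = b x"
  by (simp add: atom_tuple_def)

lemma side_product:
  assumes "j < 3" "z < 6"
  shows "side n z j * side n z ((j + 1) mod 3) \<le> n ^ 4"
    and "\<not> in_atom j z \<Longrightarrow> side n z j * side n z ((j + 1) mod 3) = n ^ 2"
proof -
  have ne: "(j + 1) mod 3 \<noteq> j" using assms(1) unfolding less_3 by auto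
  have le: "n * n \<le> n ^ 4" by (cases n) (simp_all add: eval_nat_numeral)
  have eq: "n ^ 3 * n = n ^ 4" "n * n ^ 3 = n ^ 4" by (simp_all add: eval_nat_numeral)
  show "side n z j * side n z ((j + 1) mod 3) \<le> n ^ 4"
    using ne le eq by (auto simp: side_def)
  show "side n z j * side n z ((j + 1) mod 3) = n ^ 2" if "\<not> in_atom j z"
  proof -
    have "z = 2 * (z div 2) \<or> z = 2 * (z div 2) + 1" by presburger
    then have "z div 2 \<noteq> j" "z div 2 \<noteq> (j + 1) mod 3" using that unfolding in_atom_def by auto
    then show ?thesis by (simp add: side_def power2_eq_square)
  qed
qed

lemma hard_database_model:
  assumes "n > 0"
  shows "hard_database n \<in> models Q3 (PC3 n)"
  unfolding models_PC3
proof (intro conjI allI impI)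
  fix j :: nat assume j: "j < 3"
  define j1 where "j1 = (j + 1) mod 3"
  have ne: "j1 \<noteq> j" "j1 < 3" using j unfolding j1_def less_3 by auto
  let ?R = "hard_database n ! j"
  have R: "?R = hard_relation n j" by (rule hard_database_nth[OF j])
  show "wf_rel j ?R" unfolding R wf_rel_def by (auto simp: hard_relation_def)
  have "card ?R \<le> (\<Sum>z<6. card ((\<lambda>(u, v). atom_tuple j (hard_entry j z u v)) ` ({..<side n z j} \<times> {..<side n z j1})))"
    unfolding R hard_relation_def j1_def by (rule card_UN_le) simp
  also have "\<dots> \<le> (\<Sum>z<(6::nat). n ^ 4)"
  proof (rule sum_mono)
    fix z :: nat assume z: "z \<in> {..<6}"
    have "card ((\<lambda>(u, v). atom_tuple j (hard_entry j z u v)) ` ({..<side n z j} \<times> {..<side n z j1}))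
        \<le> card ({..<side n z j} \<times> {..<side n z j1})" by (rule card_image_le) simp
    then show "card ((\<lambda>(u, v). atom_tuple j (hard_entry j z u v)) ` ({..<side n z j} \<times> {..<side n z j1})) \<le> n ^ 4"
      using side_product(1)[OF j, of z n] z by (simp add: j1_def)
  qed
  finally have 1: "card ?R \<le> 6 * n ^ 4" by simp
  \<comment> \<open>The private values of part \<open>z\<close>: a single one in a big relation, n *
    n in the grid.\<close>
  define g where "g z = (\<lambda>(u, v). Some (if in_atom j z then tagged z 0 else tagged z (tagged u v)))" for z
  have "(\<lambda>t. t (6 + j)) ` ?R = (\<Union>z<6. g z ` ({..<side n z j} \<times> {..<side n z j1}))"
    unfolding R hard_relation_def image_UN image_image g_def j1_def using j
    by (intro SUP_cong refl image_cong) (auto simp: atom_tuple_def schema_def hard_entry_def)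
  then have "card ((\<lambda>t. t (6 + j)) ` ?R) \<le> (\<Sum>z<6. card (g z ` ({..<side n z j} \<times> {..<side n z j1})))"
    using card_UN_le[of "{..<6}" "\<lambda>z. g z ` ({..<side n z j} \<times> {..<side n z j1})"] by simp
  also have "\<dots> \<le> (\<Sum>z<(6::nat). n ^ 2)"
  proof (rule sum_mono)
    fix z :: nat assume z: "z \<in> {..<6}"
    show "card (g z ` ({..<side n z j} \<times> {..<side n z j1})) \<le> n ^ 2"
    proof (cases "in_atom j z")
      case True
      then have "g z ` ({..<side n z j} \<times> {..<side n z j1}) \<subseteq> {Some (tagged z 0)}" by (auto simp: g_def)
      then have "card (g z ` ({..<side n z j} \<times> {..<side n z j1})) \<le> 1" by (rule card_subset_singleton)
      then show ?thesis using assms one_le_power[of n 2] by linarith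
    next
      case False
      have "card (g z ` ({..<side n z j} \<times> {..<side n z j1})) \<le> card ({..<side n z j} \<times> {..<side n z j1})"
        by (rule card_image_le) simp
      then show ?thesis using side_product(2)[OF j _ False, of n] z by (simp add: j1_def)
    qed
  qed
  finally have 2: "card ((\<lambda>t. t (6 + j)) ` ?R) \<le> 6 * n ^ 2" by simp
  have 3: "t = t'" if t: "t \<in> ?R" "t' \<in> ?R" "t (2 * j) = t' (2 * j)" "t (2 * j1) = t' (2 * j1)" for t t'
  proof -
    obtain z u v where a: "t = atom_tuple j (hard_entry j z u v)" using t(1) unfolding R by (rule hard_relationE)
    obtain z' u' v' where b: "t' = atom_tuple j (hard_entry j z' u' v')" using t(2) unfolding R by (rule hard_relationE)
    have m: "2 * j \<in> set (schema j)" "2 * j1 \<in> set (schema j)" by (simp_all add: schema_def j1_def)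
    have e: "hard_entry j z u v (2 * j) = hard_entry j z' u' v' (2 * j)" "hard_entry j z u v (2 * j1) = hard_entry j z' u' v' (2 * j1)"
      using t(3,4) m unfolding a b by (auto dest: atom_tuple_eqD)
    \<comment> \<open>Once the tag has fixed the part, each of the two entries is a block value or,
      at \<open>z\<close>, the pair that contains it.\<close>
    have "z = z'" using hard_entry_tag[OF m(1) e(1)] .
    moreover have "u = u'" using e(1) \<open>z = z'\<close> by (auto simp: hard_entry_def split: if_splits)
    moreover have "v = v'" using e \<open>z = z'\<close> ne j by (auto simp: hard_entry_def split: if_splits)
    ultimately show ?thesis by (simp add: a b)
  qed
  show "degree_bounds n j ?R" unfolding degree_bounds_def using 1 2 3 by (auto simp: j1_def)
  define tag where "tag t = fst (prod_decode (the (t (6 + j))))" for t :: tuple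
  have tag: "tag (atom_tuple j (hard_entry j z u v)) = z" if "z < 6" for z u v
    using that by (simp add: tag_def atom_tuple_def schema_def hard_entry_def tagged_def)
  \<comment> \<open>The key of a row is \<open>z\<close> itself where the atom contains it and the
    private variable elsewhere; the part is recovered from the tag in the private column.\<close>
  define f where "f t = (if in_atom j (tag t) then tag t else 6 + j)" for t
  show "partitioned j ?R" unfolding partitioned_def
  proof (intro exI[of _ f] ballI conjI impI)
    fix t assume "t \<in> ?R"
    then obtain z u v where a: "z < 6" "t = atom_tuple j (hard_entry j z u v)" unfolding R by (rule hard_relationE)
    show ft: "f t \<in> set (schema j)" by (auto simp: f_def in_atom_def schema_def)
    fix t' assume *: "t' \<in> ?R" "f t' = f t" "t' (f t) = t (f t)"
    obtain z' u' v' where b: "z' < 6" "t' = atom_tuple j (hard_entry j z' u' v')" using *(1) unfolding R by (rule hard_relationE)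
    have e: "hard_entry j z' u' v' (f t) = hard_entry j z u v (f t)" using *(3) ft unfolding a b by (auto dest: atom_tuple_eqD)
    have "z' = z" using hard_entry_tag[OF ft e] .
    have "f t = (if in_atom j z then z else 6 + j)" using tag[OF a(1)] by (simp add: f_def a)
    then have "u' = u \<and> v' = v" using e \<open>z' = z\<close> a(1) j by (auto simp: hard_entry_def split: if_splits)
    then show "t' = t" using a b \<open>z' = z\<close> by simp
  qed
qed (simp add: hard_database_def)

text \<open>The bound in \<open>is_vaat\<close> concerns large databases only, so the hard ones have
  to grow.\<close>

lemma hard_database_size: "n \<le> database_size (hard_database n)"
proof -
  have f: "finite (hard_relation n 0)" by (auto simp: hard_relation_def)
  \<comment> \<open>The part for 4 is used because variable 4 does not occur in atom 0, so both
    sides are \<open>n\<close> there.\<close>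
  have "inj_on (\<lambda>u. atom_tuple 0 (hard_entry 0 4 u 0)) {..<n}"
  proof (rule inj_onI)
    fix u u' assume "atom_tuple 0 (hard_entry 0 4 u 0) = atom_tuple 0 (hard_entry 0 4 u' 0)"
    then have "hard_entry 0 4 u 0 0 = hard_entry 0 4 u' 0 0" by (intro atom_tuple_eqD[of 0]) (auto simp: schema_def)
    then show "u = u'" by (simp add: hard_entry_def)
  qed
  then have "card {..<n} \<le> card (hard_relation n 0)"
  proof (rule card_inj_on_le[OF _ _ f])
    show "(\<lambda>u. atom_tuple 0 (hard_entry 0 4 u 0)) ` {..<n} \<subseteq> hard_relation n 0"
    proof
      fix t assume "t \<in> (\<lambda>u. atom_tuple 0 (hard_entry 0 4 u 0)) ` {..<n}"
      then obtain u where "u < n" "t = atom_tuple 0 (hard_entry 0 4 u 0)" by auto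
      then show "t \<in> hard_relation n 0" unfolding hard_relation_def
        by (intro UN_I[of 4] image_eqI[of _ _ "(u, 0)"]) (auto simp: side_def)
    qed
  qed
  then show ?thesis by (simp add: database_size_def hard_database_def)
qed

text \<open>Just before the last shared variable \<open>z\<close> is added, the part for
  \<open>z\<close> constrains nothing but the three block values: each of their n * n * n^3
  combinations extends to an intermediate tuple.\<close>

lemma max_intermediate_hard_database:
  assumes ord: "is_ordering Q3 ord"
  shows "n ^ 5 \<le> max_intermediate ord Q3 (hard_database n)"
proof -
  have d: "distinct ord" "set ord = {..<9}" using ord by (auto simp: is_ordering_def query_vars_Q3)
  then have "0 \<in> set ord" by simp
  then have "\<exists>x\<in>set ord. x < 6" by (rule bexI[rotated]) simp
  \<comment> \<open>\<open>z\<close> is the last shared variable; only private ones follow, and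
    \<open>ys\<close> may contain private ones too.\<close>
  then obtain ys z ws where ord_eq: "ord = ys @ z # ws" and z: "z < 6" and ws: "\<forall>x\<in>set ws. \<not> x < 6"
    using split_list_last_prop[of ord "\<lambda>x. x < 6"] by blast
  define W where "W = set ys"
  have zW: "z \<notin> W" using d(1) by (simp add: ord_eq W_def)
  have W6: "x \<in> W" if "x < 6" "x \<noteq> z" for x
  proof -
    have "x \<in> set ord" using that d(2) by simp
    then show ?thesis using that ws by (auto simp: ord_eq W_def)
  qed
  have W9: "W \<subseteq> {..<9}" using d(2) by (auto simp: ord_eq W_def)
  define C where "C = (\<Pi>\<^sub>E b\<in>{..<3}. {..<side n z b})"
  have "card C = (\<Prod>b<3. side n z b)" unfolding C_def by (simp add: card_PiE)
  also have "\<dots> = n ^ 5"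
  proof -
    have "z div 2 = 0 \<or> z div 2 = 1 \<or> z div 2 = 2" using z by presburger
    then show ?thesis by (auto simp: side_def eval_nat_numeral)
  qed
  finally have cardC: "card C = n ^ 5" .
  define a where "a c x = (if x < 6 then tagged z (c (x div 2)) else hard_entry (x - 6) z (c (x - 6)) (c ((x - 6 + 1) mod 3)) x)"
    for c :: "nat \<Rightarrow> nat" and x
  define f where "f c x = (if x \<in> W then Some (a c x) else None)" for c x
  let ?J = "restricted_answer W Q3 (hard_database n)"
  have ai: "a c x = hard_entry j z (c j) (c ((j + 1) mod 3)) x" if "j < 3" and x: "x \<in> set (schema j)" and "x \<noteq> z" for c x j
  proof -
    define j1 where "j1 = (j + 1) mod 3"
    have j1: "j1 \<noteq> j" "2 * j1 + 1 < 6" "2 * j + 1 < 6"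
      using that(1) unfolding less_3 j1_def by auto
    have par: "2 * j1 + 1 \<noteq> 2 * j" "2 * j1 \<noteq> 2 * j + 1" by presburger+
    have a: "a c (2 * i) = tagged z (c i)" "a c (2 * i + 1) = tagged z (c i)" if "2 * i + 1 < 6" for i
      using that by (simp_all add: a_def)
    consider "x = 2 * j" | "x = 2 * j + 1" | "x = 2 * j1" | "x = 2 * j1 + 1" | "x = 6 + j"
      using x unfolding schema_def j1_def by auto
    then show ?thesis
    proof cases
      case 3
      then show ?thesis using a(1)[OF j1(2)] j1 par that(3) unfolding j1_def[symmetric] by (simp add: hard_entry_def)
    next
      case 4
      then show ?thesis using a(2)[OF j1(2)] j1 par that(3) unfolding j1_def[symmetric] by (simp add: hard_entry_def)
    next
      case 5
      then show ?thesis by (simp add: a_def)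
    qed (use a[OF j1(3)] that(3) in \<open>simp_all add: hard_entry_def\<close>)
  qed
  have "card C \<le> card ?J"
  proof (rule card_inj_on_le[where f = f])
    show "inj_on f C"
    proof (rule inj_onI)
      fix c c' assume c: "c \<in> C" "c' \<in> C" "f c = f c'"
      show "c = c'"
      proof (rule PiE_ext[OF c(1)[unfolded C_def] c(2)[unfolded C_def]])
        fix b :: nat assume b: "b \<in> {..<3}"
        \<comment> \<open>If the first variable of the block is \<open>z\<close>, its twin still
          shows the block value.\<close>
        define x where "x = (if 2 * b = z then 2 * b + 1 else 2 * b)"
        have x: "x \<in> W" "x < 6" "x div 2 = b" using b by (auto simp: x_def intro!: W6)
        have "a c x = a c' x" using fun_cong[OF c(3), of x] x(1) by (simp add: f_def)
        then show "c b = c' b" using x by (simp add: a_def)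
      qed
    qed
    \<comment> \<open>Finiteness matters for the lower bound because \<open>card\<close> of an
      infinite set is 0.\<close>
    show "finite ?J" unfolding restricted_answer_def
    proof (rule finite_natural_joined)
      fix j assume "j < length (map (\<lambda>schema. set schema \<inter> W) Q3)"
      then have j: "j < 3" by simp
      have "finite (hard_relation n j)" by (auto simp: hard_relation_def)
      then show "finite (map2 (\<lambda>schema R. project (set schema \<inter> W) R) Q3 (hard_database n) ! j)"
        unfolding map2_hard_database_nth[OF j] project_def by simp
    qed
    show "f ` C \<subseteq> ?J"
    proof
      fix t assume "t \<in> f ` C"
      then obtain c where c: "c \<in> C" "t = f c" by auto
      have "dom t = W" by (auto simp: c f_def split: if_splits)
      also have "W = (\<Union>j<3. set (schema j) \<inter> W)" using W9 dom_union_schema by blast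
      also have "\<dots> = \<Union> (set (map (\<lambda>schema. set schema \<inter> W) Q3))"
        by (auto simp: Q3_def less_3)
      finally have dom: "dom t = \<Union> (set (map (\<lambda>schema. set schema \<inter> W) Q3))" .
      have "t |` (set (schema j) \<inter> W) \<in> project (set (schema j) \<inter> W) (hard_relation n j)" if j: "j < 3" for j
      proof -
        have "c j < side n z j" "c ((j + 1) mod 3) < side n z ((j + 1) mod 3)"
          using c(1) j unfolding C_def by (auto simp: PiE_iff)
        then have "atom_tuple j (hard_entry j z (c j) (c ((j + 1) mod 3))) \<in> hard_relation n j"
          unfolding hard_relation_def using z by auto
        \<comment> \<open>Away from \<open>z\<close> the entries of a row depend only on the values
          of its own blocks, so choices for different relations are compatible.\<close>
        moreover have "t |` (set (schema j) \<inter> W) = atom_tuple j (hard_entry j z (c j) (c ((j + 1) mod 3))) |` (set (schema j) \<inter> W)"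
          unfolding restrict_eq_iff using ai[OF j, of _ c] zW by (auto simp: c f_def atom_tuple_def)
        ultimately show ?thesis unfolding project_def by blast
      qed
      then show "t \<in> ?J" unfolding restricted_answer_def natural_join_def mem_Collect_eq using dom
        by (simp add: Q3_nth map2_hard_database_nth)
    qed
  qed
  also have "card ?J \<le> max_intermediate ord Q3 (hard_database n)"
    unfolding max_intermediate_def
  proof (rule Max_ge)
    \<comment> \<open>Prefixes are counted from length 1, so the prefix before \<open>z\<close> must
      not be empty.\<close>
    have "W \<noteq> {}"
    proof (cases "z = 0")
      case True
      then show ?thesis using W6[of 1] by auto
    next
      case False
      then show ?thesis using W6[of 0] by auto
    qed
    then have "1 \<le> length ys" by (cases ys) (auto simp: W_def)
    then show "card ?J \<in> (\<lambda>i. card (restricted_answer (set (take i ord)) Q3 (hard_database n))) ` {1..length ord}"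
      by (intro image_eqI[of _ _ "length ys"]) (auto simp: ord_eq W_def)
  qed simp
  finally show ?thesis using cardC by simp
qed

section \<open>Asymptotic comparison\<close>

lemma comb_bound_PC3_upper: "n > 0 \<Longrightarrow> comb_bound Q3 (PC3 n) \<le> 62000 * n ^ 4"
  using comb_bound_PC3_le[of n] one_le_power[of n 4] by linarith

lemma smallo_PC3_DC3:
  "(\<lambda>n. real (comb_bound Q3 (PC3 n))) \<in> o(\<lambda>n. real (comb_bound Q3 (degree_constraints (PC3 n))))"
proof (rule landau_o.smallI)
  fix c :: real assume c: "c > 0"
  obtain N :: nat where N: "62000 / c < N" using reals_Archimedean2 by blast
  show "\<forall>\<^sub>F n in sequentially. norm (real (comb_bound Q3 (PC3 n))) \<le>
      c * norm (real (comb_bound Q3 (degree_constraints (PC3 n))))"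
    using eventually_ge_at_top[of "max N 1"]
  proof eventually_elim
    case (elim n)
    then have n: "n > 0" "real N \<le> real n" by auto
    have "real (comb_bound Q3 (PC3 n)) \<le> real (62000 * n ^ 4)"
      using comb_bound_PC3_upper[OF n(1)] by (simp only: of_nat_le_iff)
    also have "\<dots> = 62000 * real n ^ 4" by simp
    also have "\<dots> \<le> (c * real n) * real n ^ 4"
    proof (rule mult_right_mono)
      have "62000 < c * N" using N c by (simp add: field_simps)
      also have "\<dots> \<le> c * n" using n(2) c by (intro mult_left_mono) auto
      finally show "62000 \<le> c * real n" by simp
    qed simp
    also have "\<dots> = c * real n ^ 5" by (simp add: eval_nat_numeral)
    also have "\<dots> \<le> c * real n ^ 6" using n c by (intro mult_left_mono power_increasing) auto
    also have "real n ^ 6 \<le> real (comb_bound Q3 (degree_constraints (PC3 n)))"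
      using comb_bound_DC3_lower[OF n(1)] by (metis of_nat_le_iff of_nat_power)
    finally show ?case using c by simp
  qed
qed

lemma join_program_in_time: "enumerates_in_time join_program Q3 (\<lambda>n. models Q3 (PC3 n)) (\<lambda>n. comb_bound Q3 (PC3 n))"
  unfolding enumerates_in_time_def
proof (intro conjI allI ballI exI)
  show "enumerates join_program Q3 I" if "I \<in> models Q3 (PC3 n)" for n I by (rule enumerates_join_program[OF that])
  show "\<forall>\<^sub>F n in sequentially. \<forall>I\<in>models Q3 (PC3 n). real (run_time join_program Q3 I) \<le> 62000 * real (comb_bound Q3 (PC3 n))"
    using eventually_gt_at_top[of 0]
  proof eventually_elim
    case (elim n)
    show ?case
    proof
      fix I assume "I \<in> models Q3 (PC3 n)"
      then have "run_time join_program Q3 I \<le> 62000 * comb_bound Q3 (PC3 n)"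
        using run_time_join_program[of I n] comb_bound_PC3_lower[OF elim] one_le_power[of n 4] elim by linarith
      then show "real (run_time join_program Q3 I) \<le> 62000 * real (comb_bound Q3 (PC3 n))"
        by (metis of_nat_le_iff of_nat_mult of_nat_numeral)
    qed
  qed
qed

text \<open>One database defeats every ordering, so \<open>ord\<close> may depend on it: the time
  would be at least a constant times n^5 and at most a constant times n^4.\<close>

lemma vaat_too_slow:
  assumes "is_vaat Q3 p"
  shows "\<not> enumerates_in_time p Q3 (\<lambda>n. models Q3 (PC3 n)) (\<lambda>n. comb_bound Q3 (PC3 n))"
proof
  assume "enumerates_in_time p Q3 (\<lambda>n. models Q3 (PC3 n)) (\<lambda>n. comb_bound Q3 (PC3 n))"
  then obtain c where "\<forall>\<^sub>F n in sequentially. \<forall>I\<in>models Q3 (PC3 n). real (run_time p Q3 I) \<le> c * real (comb_bound Q3 (PC3 n))"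
    unfolding enumerates_in_time_def by blast
  then obtain N where N: "\<And>n I. n \<ge> N \<Longrightarrow> I \<in> models Q3 (PC3 n) \<Longrightarrow>
      real (run_time p Q3 I) \<le> c * real (comb_bound Q3 (PC3 n))"
    unfolding eventually_sequentially by blast
  obtain ord where ord: "\<And>I. is_ordering Q3 (ord I)" and
    om: "(\<lambda>I. real (run_time p Q3 I)) \<in> \<Omega>[large_databases Q3](\<lambda>I. real (max_intermediate (ord I) Q3 I))"
    using assms unfolding is_vaat_def by blast
  obtain d where d: "d > 0" and
    ev: "\<forall>\<^sub>F I in large_databases Q3. norm (real (run_time p Q3 I)) \<ge> d * norm (real (max_intermediate (ord I) Q3 I))"
    using om by (elim landau_omega.bigE)
  obtain M where M: "\<And>I. database_size I \<ge> M \<Longrightarrow> is_database Q3 I \<Longrightarrow>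
      real (run_time p Q3 I) \<ge> d * real (max_intermediate (ord I) Q3 I)"
    using ev unfolding large_databases_def eventually_inf_principal eventually_filtercomap_at_top_linorder by auto
  define C where "C = \<bar>c\<bar> * 62000"
  obtain L :: nat where L: "C / d < L" using reals_Archimedean2 by blast
  \<comment> \<open>\<open>N\<close> is the threshold of the assumed time bound, \<open>M\<close>
    that of the lower bound, reached because the database has at least \<open>n\<close> rows, and
    \<open>L\<close> lets n^5 beat the constants.\<close>
  define n where "n = max (max N M) (max L 1)"
  have n: "n \<ge> N" "n \<ge> M" "n > 0" "real L \<le> real n" by (auto simp: n_def)
  have model: "hard_database n \<in> models Q3 (PC3 n)" by (rule hard_database_model[OF n(3)])
  have "d * real n ^ 5 \<le> d * real (max_intermediate (ord (hard_database n)) Q3 (hard_database n))"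
    using max_intermediate_hard_database[OF ord, of n] d by (intro mult_left_mono) (metis of_nat_le_iff of_nat_power, simp)
  also have "\<dots> \<le> real (run_time p Q3 (hard_database n))"
    using model hard_database_size[of n] n(2) by (intro M) (auto simp: models_def)
  also have "\<dots> \<le> c * real (comb_bound Q3 (PC3 n))" by (rule N[OF n(1) model])
  \<comment> \<open>The constant \<open>c\<close> is an arbitrary real number, so its absolute value
    is needed for monotonicity.\<close>
  also have "\<dots> \<le> \<bar>c\<bar> * real (comb_bound Q3 (PC3 n))" by (intro mult_right_mono) auto
  also have "\<dots> \<le> \<bar>c\<bar> * real (62000 * n ^ 4)"
    using comb_bound_PC3_upper[OF n(3)] by (intro mult_left_mono) (simp_all only: of_nat_le_iff abs_ge_zero)
  finally have "d * real n ^ 5 \<le> \<bar>c\<bar> * real (62000 * n ^ 4)" .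
  moreover have "real n ^ 5 = real n * real n ^ 4" by (simp add: eval_nat_numeral)
  ultimately have "(d * real n) * real n ^ 4 \<le> C * real n ^ 4" by (simp add: C_def)
  then have "d * real n \<le> C" using n(3) by simp
  moreover have "C < d * real n"
  proof -
    have "C < d * L" using L d by (simp add: field_simps)
    also have "\<dots> \<le> d * n" using n(4) d by (intro mult_left_mono) auto
    finally show ?thesis .
  qed
  ultimately show False by simp
qed

theorem theorem10:
  "\<exists>(Q :: query) (PC :: nat \<Rightarrow> pconstraint set).
     wf_query Q \<and>
     (\<forall>n. \<forall>c \<in> PC n. wf_constraint Q c) \<and>
     (\<forall>n. covered Q (PC n)) \<and>
     (\<lambda>n. real (comb_bound Q (PC n)))
       \<in> o(\<lambda>n. real (comb_bound Q (degree_constraints (PC n)))) \<and>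
     (\<exists>p. enumerates_in_time p Q (\<lambda>n. models Q (PC n)) (\<lambda>n. comb_bound Q (PC n))) \<and>
     (\<forall>p. is_vaat Q p \<longrightarrow>
        \<not> enumerates_in_time p Q (\<lambda>n. models Q (PC n)) (\<lambda>n. comb_bound Q (PC n)))"
  using wf_Q3 wf_PC3 covered_PC3 smallo_PC3_DC3 join_program_in_time vaat_too_slow
  by (intro exI[of _ Q3] exI[of _ PC3]) blast

end
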